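(* Among positive pretzel knots of odd type with a fixed odd crossing number $n$ (so that $n$ is the crossing number of some such knot), the $\Delta$-unknotting number is minimized by $P(1,1,n-2)$, and the minimum value is $\frac12(n-1)$.
   Context: A $\Delta$-move is a local move on knot diagrams. Inside a disk, the diagram consists of three arcs, each pair crossing exactly once, bounding a small triangle, with cyclic over/under information (arc 1 passes over arc 2, arc 2 over arc 3, arc 3 over arc 1, up to relabelling). The move replaces this by the diagram with the same endpoints obtained by pushing one arc across the crossing of the other two (so the triangle is reversed, as in a Reidemeister III move), keeping the over/under information of each pair. Diagrams may also be changed by ambient isotopy (Reidemeister moves). Any two knots are related by finitely many $\Delta$-moves (Murakami–Nakanishi). The $\Delta$-Gordian distance $d_G^{\Delta}(K,K')$ is the minimum number of $\Delta$-moves needed to deform $K$ into $K'$, and the $\Delta$-unknotting number is $u^{\Delta}(K)=d_G^{\Delta}(K,O)$, with $O$ the trivial knot. The crossing number of a knot is the minimal number of crossings over all its diagrams. The pretzel link $P(p_1,\dots,p_m)$ is obtained from $m$ vertical two-strand twisted columns (twisted bands) placed side by side, the $i$-th having $|p_i|$ half-twists (crossings) with handedness given by the sign of $p_i$, by joining adjacent columns cyclically at the top and at the bottom in the standard way. A positive pretzel knot of odd type is a pretzel knot $P(p_1,\dots,p_m)$ with $m$ and all $p_i$ odd and positive. Knots are not distinguished from their mirror images ($u^\Delta$ is invariant under mirror image). *)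

theory Defs
  imports Main "HOL-Library.Extended_Nat"
begin

text \<open>
  Knot diagrams are plane diagrams in Morse position, cut by horizontal lines into slices that
  each contain one local maximum, one local minimum or one crossing. A slice \<open>(i, p)\<close> has \<open>i\<close>
  vertical strands to the left of the piece \<open>p\<close>, and the list of slices is read from top to bottom.
  Every diagram is plane isotopic to one of this form.

  \<open>Cap\<close> is a local maximum, \<open>Cup\<close> a local minimum. In \<open>Cross True\<close> the over-strand runs
  from the upper left to the lower right, in \<open>Cross False\<close> from the upper right to the lower left.
\<close>

datatype piece = Cap | Cup | Cross bool

type_synonym diagram = "(nat \<times> piece) list"

fun top_ends :: "piece \<Rightarrow> nat" where
  "top_ends Cap = 0"
| "top_ends Cup = 2"
| "top_ends (Cross s) = 2"

fun bottom_ends :: "piece \<Rightarrow> nat" where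
  "bottom_ends Cap = 2"
| "bottom_ends Cup = 0"
| "bottom_ends (Cross s) = 2"

text \<open>\<open>tangle m D n\<close>: the slices fit together, with \<open>m\<close> ends at the top and \<open>n\<close> at the bottom.\<close>

fun tangle :: "nat \<Rightarrow> diagram \<Rightarrow> nat \<Rightarrow> bool" where
  "tangle m [] n \<longleftrightarrow> m = n"
| "tangle m ((i, p) # D) n \<longleftrightarrow>
     i + top_ends p \<le> m \<and> tangle (m - top_ends p + bottom_ends p) D n"

definition link_diagram :: "diagram \<Rightarrow> bool" where
  "link_diagram D \<longleftrightarrow> tangle 0 D 0"

text \<open>
  The points where the link meets the horizontal lines: \<open>(t, j)\<close> is the \<open>j\<close>-th point from the left
  (counted from 0) on the line below the first \<open>t\<close> slices. The relation \<open>joined\<close> connects the two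
  ends of each arc of each slice, so the components of the link are the classes of points under
  the equivalence relation it generates.
\<close>

fun width :: "nat \<Rightarrow> diagram \<Rightarrow> nat" where
  "width m [] = m"
| "width m ((i, p) # D) = width (m - top_ends p + bottom_ends p) D"

definition points :: "diagram \<Rightarrow> (nat \<times> nat) set" where
  "points D = {(t, j). t \<le> length D \<and> j < width 0 (take t D)}"

inductive joined :: "diagram \<Rightarrow> nat \<times> nat \<Rightarrow> nat \<times> nat \<Rightarrow> bool" for D where
  left: "t < length D \<Longrightarrow> D ! t = (i, p) \<Longrightarrow> j < i \<Longrightarrow> joined D (t, j) (Suc t, j)"
| right: "t < length D \<Longrightarrow> D ! t = (i, p) \<Longrightarrow>
    joined D (t, i + top_ends p + j) (Suc t, i + bottom_ends p + j)"
| cap: "t < length D \<Longrightarrow> D ! t = (i, Cap) \<Longrightarrow> joined D (Suc t, i) (Suc t, Suc i)"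
| cup: "t < length D \<Longrightarrow> D ! t = (i, Cup) \<Longrightarrow> joined D (t, i) (t, Suc i)"
| cross_down: "t < length D \<Longrightarrow> D ! t = (i, Cross s) \<Longrightarrow> joined D (t, i) (Suc t, Suc i)"
| cross_up: "t < length D \<Longrightarrow> D ! t = (i, Cross s) \<Longrightarrow> joined D (t, Suc i) (Suc t, i)"

definition knot_diagram :: "diagram \<Rightarrow> bool" where
  "knot_diagram D \<longleftrightarrow> link_diagram D \<and> points D \<noteq> {} \<and>
     (\<forall>x \<in> points D. \<forall>y \<in> points D. equivclp (joined D) x y)"

definition crossings :: "diagram \<Rightarrow> nat" where
  "crossings D = length (filter (\<lambda>(i, p). \<exists>s. p = Cross s) D)"

text \<open>
  Plane isotopy and Reidemeister moves for diagrams in Morse position: exchange of the heights of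
  two pieces side by side, cancellation of a maximum against a minimum, sliding a strand across a
  maximum or minimum, and the three Reidemeister moves. The remaining versions of the first two
  Reidemeister moves (a kink in a vertical strand, a bigon with antiparallel or horizontal sides)
  follow from these.

  In \<open>r3\<close> the three strands, numbered from the left at the top, cross in the order 12, 13, 23
  before and 23, 13, 12 after the move, and each pair keeps its over/under information \<open>x\<close>, \<open>y\<close>,
  \<open>z\<close>. This information is cyclic exactly if \<open>x = z\<close> and \<open>y \<noteq> x\<close>; the cyclic case is the
  Delta-move.
\<close>

inductive isotopy :: "diagram \<Rightarrow> diagram \<Rightarrow> bool" where
  exchange: "isotopy [(i, p), (i + bottom_ends p + k, q)] [(i + top_ends p + k, q), (i, p)]"
| zigzag_left: "isotopy [(i, Cap), (Suc i, Cup)] []"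
| zigzag_right: "isotopy [(Suc i, Cap), (i, Cup)] []"
| slide_cap: "isotopy [(i, Cap), (Suc i, Cross s)] [(Suc i, Cap), (i, Cross (\<not> s))]"
| slide_cup: "isotopy [(Suc i, Cross s), (i, Cup)] [(i, Cross (\<not> s)), (Suc i, Cup)]"
| r1_cap: "isotopy [(i, Cap), (i, Cross s)] [(i, Cap)]"
| r1_cup: "isotopy [(i, Cross s), (i, Cup)] [(i, Cup)]"
| r2: "isotopy [(i, Cross s), (i, Cross (\<not> s))] []"
| r3: "\<not> (x = z \<and> y \<noteq> x) \<Longrightarrow>
    isotopy [(i, Cross x), (Suc i, Cross y), (i, Cross z)]
            [(Suc i, Cross z), (i, Cross y), (Suc i, Cross x)]"

inductive delta :: "diagram \<Rightarrow> diagram \<Rightarrow> bool" where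
  "x = z \<Longrightarrow> y \<noteq> x \<Longrightarrow>
    delta [(i, Cross x), (Suc i, Cross y), (i, Cross z)]
          [(Suc i, Cross z), (i, Cross y), (Suc i, Cross x)]"

definition local_move :: "(diagram \<Rightarrow> diagram \<Rightarrow> bool) \<Rightarrow> diagram \<Rightarrow> diagram \<Rightarrow> bool" where
  "local_move R D D' \<longleftrightarrow> knot_diagram D \<and> knot_diagram D' \<and>
     (\<exists>u l r v. D = u @ l @ v \<and> D' = u @ r @ v \<and> R l r)"

definition isotopic :: "diagram \<Rightarrow> diagram \<Rightarrow> bool" where
  "isotopic D D' \<longleftrightarrow> knot_diagram D \<and> knot_diagram D' \<and> equivclp (local_move isotopy) D D'"

definition circle :: diagram where
  "circle = [(0, Cap), (0, Cup)]"

lemma knot_diagram_circle: "knot_diagram circle"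
proof -
  have pts: "points circle = {(1, 0), (1, 1)}"
  proof (rule set_eqI, clarify)
    fix t j :: nat
    consider "t = 0" | "t = 1" | "t = 2" | "t > 2" by linarith
    then show "(t, j) \<in> points circle \<longleftrightarrow> (t, j) \<in> {(1, 0), (1, 1)}"
      by cases (auto simp: points_def circle_def)
  qed
  have "joined circle (Suc 0, 0) (Suc 0, Suc 0)"
    by (rule joined.cap) (auto simp: circle_def)
  then have "equivclp (joined circle) (1, 0) (1, 1)"
    by (auto intro: r_into_equivclp)
  moreover have "link_diagram circle"
    by (simp add: link_diagram_def circle_def)
  ultimately show ?thesis
    unfolding knot_diagram_def pts by (auto intro: equivclp_sym)
qed

lemma part_equivp_isotopic: "part_equivp isotopic"
proof (rule part_equivpI)
  show "\<exists>D. isotopic D D"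
    using knot_diagram_circle by (auto simp: isotopic_def)
  show "symp isotopic"
    by (auto simp: symp_def isotopic_def intro: equivclp_sym)
  show "transp isotopic"
    by (auto simp: transp_def isotopic_def intro: equivclp_trans)
qed

quotient_type knot = diagram / partial: isotopic
  by (rule part_equivp_isotopic)

definition diagram_of :: "diagram \<Rightarrow> knot \<Rightarrow> bool" where
  "diagram_of D K \<longleftrightarrow> knot_diagram D \<and> abs_knot D = K"

definition trivial_knot :: knot where
  "trivial_knot = abs_knot circle"

definition crossing_number :: "knot \<Rightarrow> nat" where
  "crossing_number K = (LEAST c. \<exists>D. diagram_of D K \<and> crossings D = c)"

definition delta_adjacent :: "knot \<Rightarrow> knot \<Rightarrow> bool" where
  "delta_adjacent K K' \<longleftrightarrow>
     (\<exists>D D'. diagram_of D K \<and> diagram_of D' K' \<and> symclp (local_move delta) D D')"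

text \<open>Extended naturals, so that the infimum is taken over a possibly empty set.\<close>

definition delta_distance :: "knot \<Rightarrow> knot \<Rightarrow> enat" where
  "delta_distance K K' = Inf {enat k |k. (delta_adjacent ^^ k) K K'}"

definition delta_unknotting_number :: "knot \<Rightarrow> enat" where
  "delta_unknotting_number K = delta_distance K trivial_knot"

fun mirror_piece :: "piece \<Rightarrow> piece" where
  "mirror_piece Cap = Cap"
| "mirror_piece Cup = Cup"
| "mirror_piece (Cross s) = Cross (\<not> s)"

definition mirror_diagram :: "diagram \<Rightarrow> diagram" where
  "mirror_diagram D = map (map_prod id mirror_piece) D"

lemma mirror_piece_ends [simp]:
  "top_ends (mirror_piece p) = top_ends p" "bottom_ends (mirror_piece p) = bottom_ends p"
  by (cases p; simp)+

lemma mirror_piece_mirror_piece [simp]: "mirror_piece (mirror_piece p) = p"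
  by (cases p) auto

lemma length_mirror_diagram [simp]: "length (mirror_diagram D) = length D"
  by (simp add: mirror_diagram_def)

lemma mirror_diagram_mirror_diagram [simp]: "mirror_diagram (mirror_diagram D) = D"
  by (auto simp: mirror_diagram_def intro!: map_idI)

lemma tangle_mirror_diagram [simp]: "tangle m (mirror_diagram D) n = tangle m D n"
  by (induction m D n rule: tangle.induct) (auto simp: mirror_diagram_def)

lemma width_mirror_diagram [simp]: "width m (mirror_diagram D) = width m D"
  by (induction m D rule: width.induct) (auto simp: mirror_diagram_def)

lemma points_mirror_diagram [simp]: "points (mirror_diagram D) = points D"
proof -
  have "take t (mirror_diagram D) = mirror_diagram (take t D)" for t
    by (simp add: mirror_diagram_def take_map)
  then show ?thesis by (simp add: points_def)
qed

lemma joined_mirror_diagram: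
  assumes "joined D x y"
  shows "joined (mirror_diagram D) x y"
proof -
  have nth: "mirror_diagram D ! t = (i, mirror_piece p)" if "t < length D" "D ! t = (i, p)" for t i p
    using that by (simp add: mirror_diagram_def)
  show ?thesis
    using assms
  proof cases
    case (left t i p j)
    then show ?thesis using nth joined.left[of t "mirror_diagram D"] by simp
  next
    case (right t i p j)
    then show ?thesis using nth joined.right[of t "mirror_diagram D" i "mirror_piece p" j] by simp
  next
    case (cap t i)
    then show ?thesis using nth joined.cap[of t "mirror_diagram D"] by simp
  next
    case (cup t i)
    then show ?thesis using nth joined.cup[of t "mirror_diagram D"] by simp
  next
    case (cross_down t i s)
    then show ?thesis using nth joined.cross_down[of t "mirror_diagram D"] by simp
  next
    case (cross_up t i s)
    then show ?thesis using nth joined.cross_up[of t "mirror_diagram D"] by simp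
  qed
qed

lemma knot_diagram_mirror_diagram [simp]: "knot_diagram (mirror_diagram D) = knot_diagram D"
proof -
  have "joined (mirror_diagram D) = joined D"
    using joined_mirror_diagram[of D] joined_mirror_diagram[of "mirror_diagram D"] by fastforce
  then show ?thesis by (simp add: knot_diagram_def link_diagram_def)
qed

lemma isotopy_mirror_diagram: "isotopy l r \<Longrightarrow> isotopy (mirror_diagram l) (mirror_diagram r)"
proof (induction rule: isotopy.induct)
  case (exchange i p k q)
  then show ?case
    using isotopy.exchange[of i "mirror_piece p" k "mirror_piece q"]
    by (simp add: mirror_diagram_def)
qed (auto simp: mirror_diagram_def
       intro: isotopy.intros isotopy.slide_cap[of _ "\<not> _", simplified]
              isotopy.slide_cup[of _ "\<not> _", simplified] isotopy.r2[of _ "\<not> _", simplified])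

lemma isotopic_mirror_diagram:
  assumes "isotopic D D'"
  shows "isotopic (mirror_diagram D) (mirror_diagram D')"
proof -
  have step: "local_move isotopy (mirror_diagram D) (mirror_diagram D')"
    if "local_move isotopy D D'" for D D'
  proof -
    from that obtain u l r v where "D = u @ l @ v" "D' = u @ r @ v" "isotopy l r"
      by (auto simp: local_move_def)
    then have "mirror_diagram D = mirror_diagram u @ mirror_diagram l @ mirror_diagram v"
      "mirror_diagram D' = mirror_diagram u @ mirror_diagram r @ mirror_diagram v"
      "isotopy (mirror_diagram l) (mirror_diagram r)"
      by (simp_all add: mirror_diagram_def isotopy_mirror_diagram[unfolded mirror_diagram_def])
    moreover have "knot_diagram (mirror_diagram D)" "knot_diagram (mirror_diagram D')"
      using that by (simp_all add: local_move_def)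
    ultimately show ?thesis unfolding local_move_def by blast
  qed
  have "equivclp (local_move isotopy) D D'"
    using assms by (simp add: isotopic_def)
  then have "equivclp (local_move isotopy) (mirror_diagram D) (mirror_diagram D')"
  proof (induction rule: equivclp_induct)
    case base
    show ?case by simp
  next
    case (step y z)
    then show ?case
      using \<open>\<And>D D'. local_move isotopy D D' \<Longrightarrow> _\<close>
      by (meson equivclp_into_equivclp)
  qed
  with assms show ?thesis by (simp add: isotopic_def)
qed

lift_definition mirror :: "knot \<Rightarrow> knot" is mirror_diagram
  by (rule isotopic_mirror_diagram)

text \<open>
  The pretzel diagram: arcs at the top joining the left strand of the first to the right strand of
  the last column and the right strand of each column to the left strand of the next, then the
  columns, occupying positions \<open>2 * i\<close> and \<open>2 * i + 1\<close>, then the same arcs at the bottom.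
\<close>

definition pretzel_diagram :: "int list \<Rightarrow> diagram" where
  "pretzel_diagram ps =
     (0, Cap) # map (\<lambda>i. (2 * i + 1, Cap)) [0..<length ps - 1] @
     concat (map (\<lambda>i. replicate (nat \<bar>ps ! i\<bar>) (2 * i, Cross (0 < ps ! i))) [0..<length ps]) @
     map (\<lambda>i. (2 * i + 1, Cup)) (rev [0..<length ps - 1]) @ [(0, Cup)]"

definition pretzel_knot :: "int list \<Rightarrow> knot \<Rightarrow> bool" where
  "pretzel_knot ps K \<longleftrightarrow> diagram_of (pretzel_diagram ps) K"

definition positive_odd_pretzel_knot :: "knot \<Rightarrow> bool" where
  "positive_odd_pretzel_knot K \<longleftrightarrow>
     (\<exists>ps. odd (length ps) \<and> (\<forall>p \<in> set ps. 0 < p \<and> odd p) \<and> pretzel_knot ps K)"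

text \<open>Knots are not distinguished from their mirror images.\<close>

definition positive_odd_pretzel_knots :: "nat \<Rightarrow> knot set" where
  "positive_odd_pretzel_knots n =
     {K. (positive_odd_pretzel_knot K \<or> positive_odd_pretzel_knot (mirror K)) \<and>
         crossing_number K = n}"

end

theory Submission
  imports Defs "HOL-Computational_Algebra.Formal_Power_Series"
begin

text \<open>
  Let \<open>a\<^sub>2\<close> be the second coefficient of the Conway polynomial. A Delta-move changes \<open>a\<^sub>2\<close> by at
  most one, and for \<open>P(p\<^sub>1, \<dots>, p\<^sub>m)\<close> of odd type it equals \<open>(2 * e\<^sub>2 + m - 1) / 8\<close>, where \<open>e\<^sub>2\<close> is the
  second elementary symmetric function of the \<open>p\<^sub>i\<close>; for \<open>m \<ge> 3\<close> this is at least
  \<open>(p\<^sub>1 + \<dots> + p\<^sub>m - 1) / 2\<close>. Conversely one Delta-move turns \<open>P(1, 1, r)\<close> into \<open>P(1, 1, r - 2)\<close>, and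
  \<open>P(1, 1, - 1)\<close> is trivial.

  Both \<open>a\<^sub>2\<close> and the crossing number \<open>p\<^sub>1 + \<dots> + p\<^sub>m\<close> come from the Kauffman bracket, evaluated by
  transfer matrices acting on rows of colours, so that invariance under a local move is an identity
  between local weights. With \<open>d = q + 1 / q\<close> colours and Kronecker weights, the growth for
  \<open>q \<longrightarrow> \<infinity>\<close> of the product of the brackets of a diagram and its mirror image bounds the number of
  crossings from below (Kauffman, Murasugi, Thistlethwaite). With two colours and \<open>q = exp h\<close>, the
  coefficient of \<open>h\<^sup>2\<close> of the same product is an affine function of \<open>a\<^sub>2\<close>.
\<close>

section \<open>Transfer matrices\<close>

text \<open>No loop of a state is ever traced: a state is measured by its number of colourings,
  which is \<open>d\<close> to the number of its loops. That a change of one smoothing adds at most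
  one loop becomes a comparison of solution sets, made by subtracting a fixed solution modulo
  \<open>d\<close>; hence \<open>d\<close> has to be an integer.

  A knot diagram with \<open>c\<close> crossings has a product of order at most
  \<open>q ^ (2 * c + 2)\<close>: the coefficients give \<open>q ^ c\<close>, and two opposite
  states have at most \<open>c + 2\<close> loops together, each worth about \<open>q\<close>. A
  pretzel diagram of odd type with \<open>n\<close> crossings and at least three columns attains
  \<open>q ^ (2 * n + 2)\<close>, and the constants do not involve \<open>q\<close>.

  The brackets of the two sides of a Delta-move differ by \<open>4 h\<^sup>2 + ...\<close> times the
  difference of two planar smoothings. So this difference is needed only at \<open>h = 0\<close>,
  where it is a signed count of at most six orientations. The other bracket has constant term at
  most \<open>2\<close> in absolute value, and both factors of the product change:
  \<open>2 * (4 * 6) * 2 = 96\<close>, exactly one unit of \<open>a\<^sub>2\<close>.\<close>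

type_synonym 'a slice = "nat \<times> nat \<times> nat \<times> 'a"
type_synonym ('c, 'r) weight = "'c list \<Rightarrow> 'c list \<Rightarrow> 'r"

definition words :: "'c set \<Rightarrow> nat \<Rightarrow> 'c list set" where
  "words S n = {y. set y \<subseteq> S \<and> length y = n}"

fun fits :: "nat \<Rightarrow> 'a slice list \<Rightarrow> nat \<Rightarrow> bool" where
  "fits m [] n \<longleftrightarrow> m = n"
| "fits m ((i, t, b, W) # sl) n \<longleftrightarrow> i + t \<le> m \<and> fits (m - t + b) sl n"

text \<open>The argument \<open>g\<close> is the continuation below the slices. Keeping it arbitrary
  lets an identity between two short lists of slices be used inside every diagram.\<close>

fun transfer :: "'c set \<Rightarrow> ('c, 'r::comm_ring_1) weight slice list \<Rightarrow> ('c list \<Rightarrow> 'r) \<Rightarrow> 'c list \<Rightarrow> 'r" where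
  "transfer S [] g y = g y"
| "transfer S ((i, t, b, W) # sl) g y =
     (\<Sum>x\<in>words S b. W (take t (drop i y)) x * transfer S sl g (take i y @ x @ drop (i + t) y))"

abbreviation closed_sum :: "'c set \<Rightarrow> ('c, 'r::comm_ring_1) weight slice list \<Rightarrow> 'r" where
  "closed_sum S sl \<equiv> transfer S sl (\<lambda>_. 1) []"

lemma finite_words [simp]: "finite S \<Longrightarrow> finite (words S n)"
  unfolding words_def by (rule finite_lists_length_eq)

lemma words_0 [simp]: "words S 0 = {[]}"
  by (auto simp: words_def)

lemma length_words: "y \<in> words S n \<Longrightarrow> length y = n"
  by (simp add: words_def)

lemma append_words [simp]: "l @ r \<in> words S n \<longleftrightarrow> l \<in> words S (length l) \<and> r \<in> words S (n - length l) \<and> length l \<le> n"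
  by (auto simp: words_def)

lemma Cons_words [simp]: "x # r \<in> words S n \<longleftrightarrow> x \<in> S \<and> r \<in> words S (n - 1) \<and> 0 < n"
  by (auto simp: words_def)

lemma Nil_words [simp]: "[] \<in> words S n \<longleftrightarrow> n = 0"
  by (auto simp: words_def)

lemma splice_words:
  assumes "y \<in> words S m" "x \<in> words S b" "i + t \<le> m"
  shows "take i y @ x @ drop (i + t) y \<in> words S (m - t + b)"
  using assms set_take_subset[of i y] set_drop_subset[of "i + t" y] by (fastforce simp: words_def)

lemma window_words:
  assumes "y \<in> words S m" "i + t \<le> m"
  shows "take t (drop i y) \<in> words S t"
  using assms set_take_subset[of t "drop i y"] set_drop_subset[of i y] by (fastforce simp: words_def)

lemma words_split:
  assumes "y \<in> words S m" "i + t \<le> m"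
  obtains l a r where "y = l @ a @ r" "length l = i" "length a = t"
    "l \<in> words S i" "a \<in> words S t" "r \<in> words S (m - i - t)"
proof -
  have y: "y = take i y @ take t (drop i y) @ drop (i + t) y"
    by (metis append_take_drop_id drop_drop add.commute)
  have "length (take i y) = i" "length (take t (drop i y)) = t"
    using assms by (auto simp: words_def)
  moreover have "take i y \<in> words S i"
    using assms set_take_subset[of i y] by (auto simp: words_def)
  moreover have "drop (i + t) y \<in> words S (m - i - t)"
    using assms set_drop_subset[of "i + t" y] by (auto simp: words_def)
  ultimately show ?thesis using y that window_words[OF assms] by metis
qed

lemma sum_words_Suc:
  "(\<Sum>x\<in>words S (Suc n). f x) = (\<Sum>a\<in>S. \<Sum>x\<in>words S n. f (a # x))"
proof -
  have "words S (Suc n) = (\<lambda>(a, x). a # x) ` (S \<times> words S n)"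
    by (auto simp: words_def image_iff length_Suc_conv)
  moreover have "inj_on (\<lambda>(a, x). a # x) (S \<times> words S n)"
    by (auto simp: inj_on_def)
  ultimately show ?thesis
    by (simp add: sum.reindex sum.cartesian_product case_prod_unfold)
qed

lemma sum_words_2: "(\<Sum>x\<in>words S 2. f x) = (\<Sum>a\<in>S. \<Sum>b\<in>S. f [a, b])"
  by (simp add: numeral_2_eq_2 sum_words_Suc)

lemma fits_append: "fits m (a @ b) n \<longleftrightarrow> (\<exists>k. fits m a k \<and> fits k b n)"
  by (induction m a n rule: fits.induct) auto

lemma fits_unique: "fits m a n \<Longrightarrow> fits m a n' \<Longrightarrow> n = n'"
  by (induction m a n rule: fits.induct) auto

lemma transfer_append: "transfer S (a @ b) g y = transfer S a (transfer S b g) y"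
proof (induction a arbitrary: y)
  case (Cons s a)
  then show ?case by (cases s) simp
qed simp

lemma transfer_cong:
  assumes "fits m sl n" "y \<in> words S m" "\<And>z. z \<in> words S n \<Longrightarrow> g z = g' z"
  shows "transfer S sl g y = transfer S sl g' y"
  using assms
proof (induction m sl n arbitrary: y rule: fits.induct)
  case (2 m i t b W sl n)
  then show ?case
    using splice_words[of y S m _ b i t] by (auto intro!: sum.cong)
qed simp

lemma transfer_scale: "transfer S sl (\<lambda>z. c * g z) y = c * transfer S sl g y"
proof (induction sl arbitrary: y)
  case (Cons s sl)
  then show ?case by (cases s) (simp add: sum_distrib_left algebra_simps)
qed simp

lemma transfer_add: "transfer S sl (\<lambda>z. g z + g' z) y = transfer S sl g y + transfer S sl g' y"
proof (induction sl arbitrary: y)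
  case (Cons s sl)
  then show ?case by (cases s) (simp add: sum.distrib algebra_simps)
qed simp

text \<open>The scalar \<open>c\<close> passes through \<open>u\<close> because
  \<open>transfer\<close> is linear in its continuation. So a local move only needs an identity for
  all continuations on rows of the width reached below \<open>u\<close>.\<close>

lemma transfer_replace:
  assumes "fits m u k" "y \<in> words S m"
    and "\<And>g z. z \<in> words S k \<Longrightarrow> transfer S l g z = c * transfer S r g z"
  shows "transfer S (u @ l @ v) g y = c * transfer S (u @ r @ v) g y"
proof -
  have "transfer S (u @ l @ v) g y = transfer S u (\<lambda>z. c * transfer S (r @ v) g z) y"
    unfolding transfer_append using assms by (intro transfer_cong) (auto simp: transfer_append)
  also have "\<dots> = c * transfer S (u @ r @ v) g y"
    by (simp only: transfer_scale transfer_append[of S u])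
  finally show ?thesis .
qed

text \<open>The two windows are disjoint, so each weight is unaffected by the other; only the order
  of the two sums changes.\<close>

lemma transfer_exchange:
  assumes "y \<in> words S m" "i + t + k + t' \<le> m"
  shows "transfer S [(i, t, b, W), (i + b + k, t', b', W')] g y =
    transfer S [(i + t + k, t', b', W'), (i, t, b, W)] g y"
proof -
  obtain l a r' where 1: "y = l @ a @ r'" "length l = i" "length a = t" "r' \<in> words S (m - i - t)"
    using words_split[of y S m i t] assms by (metis add.assoc add_leD1)
  moreover obtain c a' r where "r' = c @ a' @ r" "length c = k" "length a' = t'"
    using words_split[of r' S "m - i - t" k t'] 1 assms by (metis add_le_imp_le_diff diff_diff_left add.commute add.assoc)
  ultimately have y: "y = l @ a @ c @ a' @ r" "length l = i" "length a = t" "length c = k" "length a' = t'"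
    by auto
  have "transfer S [(i, t, b, W), (i + b + k, t', b', W')] g y =
    (\<Sum>x\<in>words S b. \<Sum>x'\<in>words S b'. W a x * (W' a' x' * g (l @ x @ c @ x' @ r)))"
    using y by (auto simp: sum_distrib_left length_words intro!: sum.cong)
  also have "\<dots> = (\<Sum>x'\<in>words S b'. \<Sum>x\<in>words S b. W a x * (W' a' x' * g (l @ x @ c @ x' @ r)))"
    by (rule sum.swap)
  also have "\<dots> = transfer S [(i + t + k, t', b', W'), (i, t, b, W)] g y"
    using y by (auto simp: sum_distrib_left length_words algebra_simps intro!: sum.cong)
  finally show ?thesis .
qed

definition slices :: "(piece \<Rightarrow> 'a) \<Rightarrow> diagram \<Rightarrow> 'a slice list" where
  "slices W D = map (\<lambda>(i, p). (i, top_ends p, bottom_ends p, W p)) D"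

lemma slices_simps [simp]:
  "slices W [] = []"
  "slices W ((i, p) # D) = (i, top_ends p, bottom_ends p, W p) # slices W D"
  "slices W (D @ D') = slices W D @ slices W D'"
  by (simp_all add: slices_def)

lemma fits_slices [simp]: "fits m (slices W D) n = tangle m D n"
  by (induction m D n rule: tangle.induct) auto

lemma tangle_append: "tangle m (a @ b) n \<longleftrightarrow> (\<exists>k. tangle m a k \<and> tangle k b n)"
  by (induction m a n rule: tangle.induct) auto

section \<open>Temperley-Lieb models\<close>

text \<open>The Kauffman bracket, divided by \<open>A\<close> or \<open>1/A\<close> for each crossing: \<open>\<kappa> True\<close> and
  \<open>\<kappa> False\<close> play the roles of \<open>1 / A\<^sup>2\<close> and \<open>A\<^sup>2\<close>.\<close>

fun tl_weight :: "('c \<Rightarrow> 'c \<Rightarrow> 'r) \<Rightarrow> ('c \<Rightarrow> 'c \<Rightarrow> 'r) \<Rightarrow> (bool \<Rightarrow> 'r::comm_ring_1) \<Rightarrow> piece \<Rightarrow> ('c, 'r) weight" where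
  "tl_weight M N \<kappa> Cap a x = M (x ! 0) (x ! 1)"
| "tl_weight M N \<kappa> Cup a x = N (a ! 0) (a ! 1)"
| "tl_weight M N \<kappa> (Cross s) a x = of_bool (x = a) + \<kappa> s * (N (a ! 0) (a ! 1) * M (x ! 0) (x ! 1))"

text \<open>The scalar by which the brackets of the two sides of a move differ. Exchange moves have the same
  shapes as curls and slides; the tests on the positions tell them apart.\<close>

fun framing_factor :: "(bool \<Rightarrow> 'r::comm_ring_1) \<Rightarrow> diagram \<Rightarrow> 'r" where
  "framing_factor \<kappa> [(i, Cap), (j, Cross s)] = (if j = i then - (\<kappa> s)\<^sup>2 else if j = Suc i then \<kappa> s else 1)"
| "framing_factor \<kappa> [(j, Cross s), (i, Cup)] = (if j = i then - (\<kappa> s)\<^sup>2 else if j = Suc i then \<kappa> s else 1)"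
| "framing_factor \<kappa> _ = 1"

text \<open>\<open>zig\<close> and \<open>zag\<close> straighten a strand. With \<open>E\<close> for
  a minimum followed by a maximum, \<open>E E\<close> is the loop value times \<open>E\<close>; so
  for inverse coefficients the second Reidemeister move requires
  \<open>\<kappa> True + \<kappa> False\<close> plus the loop value to vanish, which is
  \<open>loop\<close>.\<close>

locale tl_model =
  fixes S :: "'c set" and M N :: "'c \<Rightarrow> 'c \<Rightarrow> 'r::comm_ring_1" and \<kappa> :: "bool \<Rightarrow> 'r"
  assumes fin: "finite S"
    and zig: "a \<in> S \<Longrightarrow> c \<in> S \<Longrightarrow> (\<Sum>b\<in>S. M a b * N b c) = of_bool (a = c)"
    and zag: "a \<in> S \<Longrightarrow> c \<in> S \<Longrightarrow> (\<Sum>b\<in>S. N a b * M b c) = of_bool (a = c)"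
    and loop: "(\<Sum>a\<in>S. \<Sum>b\<in>S. M a b * N a b) = - (\<kappa> True + \<kappa> False)"
    and inv: "\<kappa> True * \<kappa> False = 1"
begin

definition P :: "diagram \<Rightarrow> ('c list \<Rightarrow> 'r) \<Rightarrow> 'c list \<Rightarrow> 'r" where
  "P D g y = transfer S (slices (tl_weight M N \<kappa>) D) g y"

definition \<delta> :: 'r where
  "\<delta> = - (\<kappa> True + \<kappa> False)"

lemma \<kappa>_inv [simp]: "\<kappa> s * \<kappa> (\<not> s) = 1" "\<kappa> (\<not> s) * \<kappa> s = 1"
  using inv by (cases s; simp add: mult.commute)+

lemma \<kappa>_sum: "\<kappa> s + \<kappa> (\<not> s) = - \<delta>"
  by (cases s) (simp_all add: \<delta>_def)

lemma \<delta>_split: "\<delta> = - \<kappa> s - \<kappa> (\<not> s)"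
  by (cases s) (simp_all add: \<delta>_def)

text \<open>The mirror image has the same matrices with the coefficients exchanged, so whatever is
  proved in the locale also holds for the second factor of a bracket product.\<close>

lemma swapped: "tl_model S M N (\<lambda>s. \<kappa> (\<not> s))"
  using fin zig zag loop inv by unfold_locales (simp_all add: algebra_simps)

lemma P_Nil [simp]: "P [] g y = g y"
  by (simp add: P_def)

lemma P_append: "P (D @ D') g y = P D (P D' g) y"
  by (simp add: P_def transfer_append[abs_def] P_def[abs_def])

lemma P_replace:
  assumes "y \<in> words S m" "tangle m u k"
    and "\<And>g z. z \<in> words S k \<Longrightarrow> P l g z = c * P r g z"
  shows "P (u @ l @ v) g y = c * P (u @ r @ v) g y"
  using transfer_replace[of m "slices (tl_weight M N \<kappa>) u" k y S
      "slices (tl_weight M N \<kappa>) l" c "slices (tl_weight M N \<kappa>) r" "slices (tl_weight M N \<kappa>) v" g] assms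
  by (simp add: P_def)

lemma P_add: "P D (\<lambda>z. g z + g' z) y = P D g y + P D g' y"
  by (simp add: P_def transfer_add)

lemma P_scale: "P D (\<lambda>z. c * g z) y = c * P D g y"
  by (simp add: P_def transfer_scale)

lemma P_cong:
  assumes "tangle m D n" "y \<in> words S m" "\<And>z. z \<in> words S n \<Longrightarrow> g z = g' z"
  shows "P D g y = P D g' y"
  unfolding P_def using assms by (intro transfer_cong) auto

lemma P_Cap: "length l = i \<Longrightarrow>
  P ((i, Cap) # D) g (l @ r) = (\<Sum>a\<in>S. \<Sum>b\<in>S. M a b * P D g (l @ [a, b] @ r))"
  by (simp add: P_def sum_words_2)

lemma P_Cup: "length l = i \<Longrightarrow> P ((i, Cup) # D) g (l @ [a, b] @ r) = N a b * P D g (l @ r)"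
  by (simp add: P_def)

lemma P_Cross:
  assumes "length l = i" "a \<in> S" "b \<in> S"
  shows "P ((i, Cross s) # D) g (l @ [a, b] @ r) =
    P D g (l @ [a, b] @ r) + \<kappa> s * P ((i, Cup) # (i, Cap) # D) g (l @ [a, b] @ r)"
proof -
  have "P ((i, Cross s) # D) g (l @ [a, b] @ r) =
    (\<Sum>x\<in>words S 2. of_bool (x = [a, b]) * P D g (l @ x @ r)) +
    \<kappa> s * (N a b * (\<Sum>x\<in>words S 2. M (x ! 0) (x ! 1) * P D g (l @ x @ r)))"
    using assms(1) by (simp add: P_def sum_distrib_left sum.distrib algebra_simps)
  also have "(\<Sum>x\<in>words S 2. of_bool (x = [a, b]) * P D g (l @ x @ r)) = P D g (l @ [a, b] @ r)"
    using assms fin by (subst sum.remove[of _ "[a, b]"]) (auto intro!: sum.neutral)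
  also have "N a b * (\<Sum>x\<in>words S 2. M (x ! 0) (x ! 1) * P D g (l @ x @ r)) =
      P ((i, Cup) # (i, Cap) # D) g (l @ [a, b] @ r)"
    using P_Cap[of l i D g r] P_Cup[of l i "(i, Cap) # D" g a b r] assms(1) by (simp add: sum_words_2)
  finally show ?thesis .
qed

text \<open>The skein relation inside a diagram. Together with \<open>zigzag_in\<close> and
  \<open>loop_in\<close> it replaces sums over colours by computation in the Temperley-Lieb
  algebra.\<close>

lemma cross_expand:
  assumes "y \<in> words S m" "tangle m u k" "i + 2 \<le> k"
  shows "P (u @ (i, Cross s) # v) g y = P (u @ v) g y + \<kappa> s * P (u @ (i, Cup) # (i, Cap) # v) g y"
proof -
  have "P (u @ (i, Cross s) # v) g y =
     P u (\<lambda>z. P v g z + \<kappa> s * P ((i, Cup) # (i, Cap) # v) g z) y"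
    unfolding P_append
  proof (rule P_cong[OF assms(2,1)])
    fix z assume "z \<in> words S k"
    then obtain l a r where z: "z = l @ a @ r" "length l = i" "a \<in> words S 2"
      using assms(3) by (metis words_split)
    then obtain x x' where "a = [x, x']" "x \<in> S" "x' \<in> S"
      by (auto simp: words_def length_Suc_conv numeral_2_eq_2)
    with z show "P ((i, Cross s) # v) g z = P v g z + \<kappa> s * P ((i, Cup) # (i, Cap) # v) g z"
      using P_Cross by blast
  qed
  then show ?thesis by (simp only: P_add P_scale P_append)
qed

lemma zigzag:
  assumes "y \<in> words S m" "i < m"
  shows "P [(i, Cap), (Suc i, Cup)] g y = g y" "P [(Suc i, Cap), (i, Cup)] g y = g y"
proof -
  obtain l x r where z: "y = l @ x @ r" and l: "length l = i" and "x \<in> words S 1"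
    using words_split[of y S m i 1] assms by (metis Suc_eq_plus1 Suc_leI)
  then obtain c where y: "y = l @ [c] @ r" "c \<in> S"
    by (auto simp: words_def length_Suc_conv)
  have "P [(i, Cap), (Suc i, Cup)] g y = (\<Sum>a\<in>S. \<Sum>b\<in>S. M a b * P [(Suc i, Cup)] g ((l @ [a]) @ [b, c] @ r))"
    unfolding y by (subst P_Cap) (auto simp: l)
  also have "\<dots> = (\<Sum>a\<in>S. \<Sum>b\<in>S. M a b * (N b c * g (l @ [a] @ r)))"
    by (subst P_Cup) (auto simp: l)
  also have "\<dots> = (\<Sum>a\<in>S. (\<Sum>b\<in>S. M a b * N b c) * g (l @ [a] @ r))"
    by (simp add: sum_distrib_right mult.assoc)
  also have "\<dots> = (\<Sum>a\<in>S. of_bool (a = c) * g (l @ [a] @ r))"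
    using y by (intro sum.cong) (simp_all add: zig)
  also have "\<dots> = g y"
    using y fin by (subst sum.remove[of _ c]) (auto intro!: sum.neutral)
  finally show "P [(i, Cap), (Suc i, Cup)] g y = g y" .
  have "P [(Suc i, Cap), (i, Cup)] g y = (\<Sum>a\<in>S. \<Sum>b\<in>S. M a b * P [(i, Cup)] g (l @ [c, a] @ ([b] @ r)))"
    using P_Cap[of "l @ [c]" "Suc i" "[(i, Cup)]" g r] by (simp add: l y)
  also have "\<dots> = (\<Sum>a\<in>S. \<Sum>b\<in>S. M a b * (N c a * g (l @ [b] @ r)))"
    by (subst P_Cup) (auto simp: l)
  also have "\<dots> = (\<Sum>b\<in>S. \<Sum>a\<in>S. M a b * (N c a * g (l @ [b] @ r)))"
    by (rule sum.swap)
  also have "\<dots> = (\<Sum>b\<in>S. (\<Sum>a\<in>S. N c a * M a b) * g (l @ [b] @ r))"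
    by (simp add: sum_distrib_left sum_distrib_right mult_ac)
  also have "\<dots> = (\<Sum>b\<in>S. of_bool (b = c) * g (l @ [b] @ r))"
    using y by (intro sum.cong) (auto simp add: zag)
  also have "\<dots> = g y"
    using y fin by (subst sum.remove[of _ c]) (auto intro!: sum.neutral)
  finally show "P [(Suc i, Cap), (i, Cup)] g y = g y" .
qed

lemma loop_value:
  assumes "y \<in> words S m" "i \<le> m"
  shows "P [(i, Cap), (i, Cup)] g y = \<delta> * g y"
proof -
  obtain l r where y: "y = l @ r" "length l = i"
    using words_split[of y S m i 0] assms by (metis add_0_right append_Nil length_0_conv)
  have "P [(i, Cap), (i, Cup)] g y = (\<Sum>a\<in>S. \<Sum>b\<in>S. M a b * (N a b * g (l @ r)))"
    unfolding y(1) by (subst P_Cap[OF y(2)], subst P_Cup[OF y(2)]) simp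
  also have "\<dots> = (\<Sum>a\<in>S. \<Sum>b\<in>S. M a b * N a b) * g (l @ r)"
    by (simp add: sum_distrib_left sum_distrib_right mult_ac)
  finally show ?thesis using y by (simp add: loop \<delta>_def)
qed

lemma zigzag_in:
  assumes "y \<in> words S m" "tangle m u k" "i < k"
  shows "P (u @ (i, Cap) # (Suc i, Cup) # v) g y = P (u @ v) g y"
    "P (u @ (Suc i, Cap) # (i, Cup) # v) g y = P (u @ v) g y"
  using P_replace[OF assms(1,2), of "[(i, Cap), (Suc i, Cup)]" 1 "[]" v g]
    P_replace[OF assms(1,2), of "[(Suc i, Cap), (i, Cup)]" 1 "[]" v g] zigzag assms(3) by simp_all

lemma loop_in:
  assumes "y \<in> words S m" "tangle m u k" "i \<le> k"
  shows "P (u @ (i, Cap) # (i, Cup) # v) g y = \<delta> * P (u @ v) g y"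
  using P_replace[OF assms(1,2), of "[(i, Cap), (i, Cup)]" \<delta> "[]" v g] loop_value assms(3) by simp

text \<open>Write \<open>E\<close> and \<open>F\<close> for the minimum followed by a maximum at
  \<open>i\<close> and at \<open>Suc i\<close>. By \<open>E E = \<delta> E\<close>,
  \<open>F F = \<delta> F\<close>, \<open>E F E = E\<close> and \<open>F E F = F\<close>, the mixed
  terms of the two sides coincide, and \<open>E\<close> and \<open>F\<close> remain with opposite
  multiples of one coefficient. It vanishes for the third Reidemeister move and controls the
  Delta-move.\<close>

lemma triple_difference:
  assumes "y \<in> words S m" "i + 3 \<le> m"
  shows "P [(i, Cross x), (Suc i, Cross u), (i, Cross z)] g y
       - P [(Suc i, Cross z), (i, Cross u), (Suc i, Cross x)] g y
       = (\<kappa> x + \<kappa> z + \<kappa> x * \<kappa> z * \<delta> + \<kappa> x * \<kappa> u * \<kappa> z - \<kappa> u)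
         * (P [(i, Cup), (i, Cap)] g y - P [(Suc i, Cup), (Suc i, Cap)] g y)"
proof -
  let ?i = "(i, Cup) # (i, Cap) # ([] :: diagram)"
  let ?j = "(Suc i, Cup) # (Suc i, Cap) # ([] :: diagram)"
  have le: "i + 2 \<le> m" "Suc i + 2 \<le> m" using assms(2) by auto
  have T: "tangle m [] m" "tangle m ?i m" "tangle m ?j m" "tangle m (?i @ ?j) m" "tangle m (?j @ ?i) m"
    "tangle m (?i @ ?j @ ?i) m"
    using assms(2) by auto
  note X = cross_expand[OF assms(1)]
  have L: "P [(i, Cross x), (Suc i, Cross u), (i, Cross z)] g y =
     g y + \<kappa> x * P ?i g y + \<kappa> u * (P ?j g y + \<kappa> x * P (?i @ ?j) g y) +
     \<kappa> z * (P ?i g y + \<kappa> x * P (?i @ ?i) g y + \<kappa> u * (P (?j @ ?i) g y + \<kappa> x * P (?i @ ?j @ ?i) g y))"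
    using X[OF T(1) le(1), of x "[(Suc i, Cross u), (i, Cross z)]" g]
      X[OF T(1) le(2), of u "[(i, Cross z)]" g] X[OF T(2) le(2), of u "[(i, Cross z)]" g]
      X[OF T(1) le(1), of z "[]" g] X[OF T(2) le(1), of z "[]" g]
      X[OF T(3) le(1), of z "[]" g] X[OF T(4) le(1), of z "[]" g]
    by (simp add: algebra_simps)
  have R: "P [(Suc i, Cross z), (i, Cross u), (Suc i, Cross x)] g y =
     g y + \<kappa> z * P ?j g y + \<kappa> u * (P ?i g y + \<kappa> z * P (?j @ ?i) g y) +
     \<kappa> x * (P ?j g y + \<kappa> z * P (?j @ ?j) g y + \<kappa> u * (P (?i @ ?j) g y + \<kappa> z * P (?j @ ?i @ ?j) g y))"
    using X[OF T(1) le(2), of z "[(i, Cross u), (Suc i, Cross x)]" g]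
      X[OF T(1) le(1), of u "[(Suc i, Cross x)]" g] X[OF T(3) le(1), of u "[(Suc i, Cross x)]" g]
      X[OF T(1) le(2), of x "[]" g] X[OF T(2) le(2), of x "[]" g]
      X[OF T(3) le(2), of x "[]" g] X[OF T(5) le(2), of x "[]" g]
    by (simp add: algebra_simps)
  have U: "tangle m [(i, Cup)] (m - 2)" "tangle m [(Suc i, Cup)] (m - 2)"
    "tangle m [(i, Cup), (i, Cap), (Suc i, Cup)] (m - 2)" 
    "tangle m [(Suc i, Cup), (Suc i, Cap), (i, Cup)] (m - 2)"
    using assms(2) by auto
  have 1: "P (?i @ ?i) g y = \<delta> * P ?i g y"
    using loop_in[OF assms(1) U(1), of i "[(i, Cap)]" g] assms(2) by simp
  have 2: "P (?j @ ?j) g y = \<delta> * P ?j g y"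
    using loop_in[OF assms(1) U(2), of "Suc i" "[(Suc i, Cap)]" g] assms(2) by simp
  have 3: "P (?i @ ?j @ ?i) g y = P ?i g y"
    using zigzag_in(2)[OF assms(1) U(3), of i "[(i, Cap)]" g] assms(2)
      zigzag_in(1)[OF assms(1) U(1), of i "[(i, Cap)]" g] by simp
  have 4: "P (?j @ ?i @ ?j) g y = P ?j g y"
    using zigzag_in(1)[OF assms(1) U(4), of i "[(Suc i, Cap)]" g] assms(2)
      zigzag_in(2)[OF assms(1) U(2), of i "[(Suc i, Cap)]" g] by simp
  show ?thesis
    unfolding L R 1 2 3 4 by (simp add: algebra_simps)
qed

lemma triple_coefficient:
  assumes "\<not> (x = z \<and> u \<noteq> x)"
  shows "\<kappa> x + \<kappa> z + \<kappa> x * \<kappa> z * \<delta> + \<kappa> x * \<kappa> u * \<kappa> z - \<kappa> u = 0"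
proof (cases "x = z")
  case True
  then have [simp]: "z = x" "u = x" using assms by auto
  have d: "\<delta> = - \<kappa> x - \<kappa> (\<not> x)" by (rule \<delta>_split)
  have "\<kappa> x * \<kappa> x * \<kappa> (\<not> x) = \<kappa> x" by (simp add: mult.assoc)
  then show ?thesis by (simp add: d algebra_simps)
next
  case False
  then have [simp]: "z = (\<not> x)" by auto
  have "\<kappa> x * \<kappa> u * \<kappa> (\<not> x) = \<kappa> u * (\<kappa> x * \<kappa> (\<not> x))" by (simp only: mult_ac)
  then show ?thesis unfolding \<delta>_split[of x] by (simp add: algebra_simps)
qed

text \<open>A slide turns the vertical smoothing of the crossing into the horizontal one; as the
  vertical smoothing is normalized to coefficient \<open>1\<close>, a factor
  \<open>\<kappa> s\<close> appears. A curl contributes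
  \<open>1 + \<kappa> s * \<delta> = - (\<kappa> s)\<^sup>2\<close>.\<close>

lemma isotopy_factor:
  assumes "isotopy l r" "y \<in> words S m" "tangle m l n" "tangle m r n'"
  shows "P l g y = framing_factor \<kappa> l * P r g y"
  using assms
proof (induction rule: isotopy.induct)
  case (exchange i p k q)
  have ff: "framing_factor \<kappa> [(i, p), (i + bottom_ends p + k, q)] = 1"
    by (cases p; cases q) auto
  from exchange have "i + top_ends p + k + top_ends q \<le> m"
    by auto
  from transfer_exchange[OF exchange(1) this] show ?case by (simp add: ff P_def)
next
  case (zigzag_left i)
  then show ?case using zigzag(1)[of y m i g] by simp
next
  case (zigzag_right i)
  then show ?case using zigzag(2)[of y m i g] by simp
next
  case (slide_cap i s)
  then have le: "Suc i \<le> m" by auto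
  have T: "tangle m [(i, Cap)] (m + 2)" "tangle m [(Suc i, Cap)] (m + 2)" using le by auto
  have "P [(i, Cap), (Suc i, Cross s)] g y = P [(i, Cap)] g y + \<kappa> s * P [(Suc i, Cap)] g y"
    using cross_expand[OF slide_cap(1) T(1), of "Suc i" s "[]" g] le
      zigzag_in(1)[OF slide_cap(1), of "[]" m i "[(Suc i, Cap)]" g] by simp
  moreover have "P [(Suc i, Cap), (i, Cross (\<not> s))] g y = P [(Suc i, Cap)] g y + \<kappa> (\<not> s) * P [(i, Cap)] g y"
    using cross_expand[OF slide_cap(1) T(2), of "i" "\<not> s" "[]" g] le
      zigzag_in(2)[OF slide_cap(1), of "[]" m i "[(i, Cap)]" g] by simp
  ultimately show ?case by (simp add: distrib_left flip: mult.assoc)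
next
  case (slide_cup i s)
  then have le: "i + 3 \<le> m" by auto
  have T: "tangle m [(i, Cup)] (m - 2)" "tangle m [(Suc i, Cup)] (m - 2)" using le by auto
  have "P [(Suc i, Cross s), (i, Cup)] g y = P [(i, Cup)] g y + \<kappa> s * P [(Suc i, Cup)] g y"
    using cross_expand[OF slide_cup(1), of "[]" m "Suc i" s "[(i, Cup)]" g] le
      zigzag_in(2)[OF slide_cup(1) T(2), of i "[]" g] by simp
  moreover have "P [(i, Cross (\<not> s)), (Suc i, Cup)] g y = P [(Suc i, Cup)] g y + \<kappa> (\<not> s) * P [(i, Cup)] g y"
    using cross_expand[OF slide_cup(1), of "[]" m i "\<not> s" "[(Suc i, Cup)]" g] le
      zigzag_in(1)[OF slide_cup(1) T(1), of i "[]" g] by simp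
  ultimately show ?case by (simp add: distrib_left flip: mult.assoc)
next
  case (r1_cap i s)
  then have le: "i \<le> m" by auto
  have T: "tangle m [(i, Cap)] (m + 2)" using le by auto
  have "P [(i, Cap), (i, Cross s)] g y = P [(i, Cap)] g y + \<kappa> s * (\<delta> * P [(i, Cap)] g y)"
    using cross_expand[OF r1_cap(1) T(1), of i s "[]" g] le
      loop_in[OF r1_cap(1), of "[]" m i "[(i, Cap)]" g] by simp
  moreover have "\<delta> = - \<kappa> s - \<kappa> (\<not> s)" by (rule \<delta>_split)
  ultimately show ?case by (simp add: algebra_simps power2_eq_square flip: mult.assoc)
next
  case (r1_cup i s)
  then have le: "i + 2 \<le> m" by auto
  have T: "tangle m [(i, Cup)] (m - 2)" using le by auto
  have "P [(i, Cross s), (i, Cup)] g y = P [(i, Cup)] g y + \<kappa> s * (\<delta> * P [(i, Cup)] g y)"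
    using cross_expand[OF r1_cup(1), of "[]" m i s "[(i, Cup)]" g] le
      loop_in[OF r1_cup(1) T, of i "[]" g] by simp
  moreover have "\<delta> = - \<kappa> s - \<kappa> (\<not> s)" by (rule \<delta>_split)
  ultimately show ?case by (simp add: algebra_simps power2_eq_square flip: mult.assoc)
next
  case (r2 i s)
  then have le: "i + 2 \<le> m" by auto
  have T: "tangle m [(i, Cup)] (m - 2)" "tangle m [(i, Cup), (i, Cap)] m" using le by auto
  let ?E = "P [(i, Cup), (i, Cap)] g y"
  have "P [(i, Cross s), (i, Cross (\<not> s))] g y =
     g y + \<kappa> (\<not> s) * ?E + \<kappa> s * (?E + \<kappa> (\<not> s) * (\<delta> * ?E))"
    using cross_expand[OF r2(1), of "[]" m i s "[(i, Cross (\<not> s))]" g] le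
      cross_expand[OF r2(1), of "[]" m i "\<not> s" "[]" g]
      cross_expand[OF r2(1) T(2), of i "\<not> s" "[]" g]
      loop_in[OF r2(1) T(1), of i "[(i, Cap)]" g] by simp
  also have "\<dots> = g y"
    unfolding \<delta>_split[of s] by (simp add: algebra_simps flip: mult.assoc)
  finally show ?case by simp
next
  case (r3 x z u i)
  then have "i + 3 \<le> m" by auto
  from triple_difference[OF r3(2) this, of x u z g] triple_coefficient[OF r3(1)] show ?case by simp
qed

end

section \<open>Isotopy invariance of the product of the two brackets\<close>

lemma framing_factor_swapped:
  assumes "\<And>s. \<kappa> s * \<kappa> (\<not> s) = (1 :: 'r :: comm_ring_1)"
  shows "framing_factor \<kappa> D * framing_factor (\<lambda>s. \<kappa> (\<not> s)) D = 1"
  using assms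
  by (induction \<kappa> D rule: framing_factor.induct) (simp_all flip: power_mult_distrib)

definition bracket :: "'c set \<Rightarrow> ('c \<Rightarrow> 'c \<Rightarrow> 'r) \<Rightarrow> ('c \<Rightarrow> 'c \<Rightarrow> 'r) \<Rightarrow> (bool \<Rightarrow> 'r::comm_ring_1) \<Rightarrow> diagram \<Rightarrow> 'r" where
  "bracket S M N \<kappa> D = closed_sum S (slices (tl_weight M N \<kappa>) D)"

text \<open>The second factor is the bracket of the mirror image. The framing factors of the two cancel, so
  that no orientation and no writhe are needed.\<close>

definition bracket_product :: "'c set \<Rightarrow> ('c \<Rightarrow> 'c \<Rightarrow> 'r) \<Rightarrow> ('c \<Rightarrow> 'c \<Rightarrow> 'r) \<Rightarrow> (bool \<Rightarrow> 'r::comm_ring_1) \<Rightarrow> diagram \<Rightarrow> 'r" where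
  "bracket_product S M N \<kappa> D = bracket S M N \<kappa> D * bracket S M N (\<lambda>s. \<kappa> (\<not> s)) D"

lemma link_diagram_split:
  assumes "link_diagram (u @ l @ v)"
  obtains k n where "tangle 0 u k" "tangle k l n" "tangle n v 0"
  using assms by (auto simp: link_diagram_def tangle_append)

lemma tangle_unique: "tangle m D n \<Longrightarrow> tangle m D n' \<Longrightarrow> n = n'"
  using fits_unique[of m "slices id D" n n'] by simp

context tl_model
begin

lemma bracket_P: "bracket S M N \<kappa> D = P D (\<lambda>_. 1) []"
  by (simp add: bracket_def P_def)

lemma bracket_isotopy:
  assumes "isotopy l r" "link_diagram (u @ l @ v)" "link_diagram (u @ r @ v)"
  shows "bracket S M N \<kappa> (u @ l @ v) = framing_factor \<kappa> l * bracket S M N \<kappa> (u @ r @ v)"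
proof -
  obtain k n where 1: "tangle 0 u k" "tangle k l n"
    using link_diagram_split[OF assms(2)] by metis
  obtain n' where "tangle k r n'"
    using link_diagram_split[OF assms(3)] 1(1) tangle_unique by metis
  then show ?thesis
    unfolding bracket_P using 1 assms(1) by (intro P_replace[of _ 0] isotopy_factor) auto
qed

lemma bracket_product_isotopy:
  assumes "isotopy l r" "link_diagram (u @ l @ v)" "link_diagram (u @ r @ v)"
  shows "bracket_product S M N \<kappa> (u @ l @ v) = bracket_product S M N \<kappa> (u @ r @ v)"
proof -
  interpret s: tl_model S M N "\<lambda>s. \<kappa> (\<not> s)" by (rule swapped)
  have "bracket_product S M N \<kappa> (u @ l @ v) =
    (framing_factor \<kappa> l * framing_factor (\<lambda>s. \<kappa> (\<not> s)) l) * bracket_product S M N \<kappa> (u @ r @ v)"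
    unfolding bracket_product_def bracket_isotopy[OF assms] s.bracket_isotopy[OF assms] by (simp add: mult_ac)
  then show ?thesis
    using framing_factor_swapped[of \<kappa> l] by simp
qed

lemma bracket_product_isotopic:
  assumes "isotopic D D'"
  shows "bracket_product S M N \<kappa> D = bracket_product S M N \<kappa> D'"
proof -
  have "equivclp (local_move isotopy) D D'"
    using assms by (simp add: isotopic_def)
  then show ?thesis
  proof (induction rule: equivclp_induct)
    case (step y z)
    then show ?case
      by (auto simp: local_move_def knot_diagram_def dest: bracket_product_isotopy)
  qed simp
qed

end

section \<open>Colourings and components\<close>

type_synonym 'c rel = "'c list \<Rightarrow> 'c list \<Rightarrow> bool"

text \<open>The row above the first slice is left out of a path. Hence
  \<open>([] # \<rho>) ! t\<close> is the row on the line below the first \<open>t\<close> slices,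
  in the numbering of \<open>points\<close>.\<close>

fun paths :: "'c set \<Rightarrow> 'c rel slice list \<Rightarrow> 'c list \<Rightarrow> 'c list list set" where
  "paths S [] y = {[]}"
| "paths S ((i, t, b, R) # sl) y =
     (\<Union>x\<in>{x \<in> words S b. R (take t (drop i y)) x}.
        (#) (take i y @ x @ drop (i + t) y) ` paths S sl (take i y @ x @ drop (i + t) y))"

definition indicators :: "'c rel slice list \<Rightarrow> ('c, 'r::comm_ring_1) weight slice list" where
  "indicators sl = map (\<lambda>(i, t, b, R). (i, t, b, \<lambda>a x. of_bool (R a x))) sl"

lemma indicators_simps [simp]:
  "indicators [] = []"
  "indicators ((i, t, b, R) # sl) = (i, t, b, \<lambda>a x. of_bool (R a x)) # indicators sl"
  "indicators (sl @ sl') = indicators sl @ indicators sl'"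
  by (simp_all add: indicators_def)

lemma indicators_slices: "indicators (slices R D) = slices (\<lambda>p a x. of_bool (R p a x)) D"
  by (induction D) auto

lemma finite_paths: "finite S \<Longrightarrow> finite (paths S sl y)"
  by (induction S sl y rule: paths.induct) auto

lemma transfer_indicators:
  assumes "finite S"
  shows "transfer S (indicators sl) (\<lambda>_. 1) y = (of_nat (card (paths S sl y)) :: 'r::comm_ring_1)"
  using assms
proof (induction S sl y rule: paths.induct)
  case (2 S i t b R sl y)
  let ?X = "{x \<in> words S b. R (take t (drop i y)) x}"
  let ?y = "\<lambda>x. take i y @ x @ drop (i + t) y"
  have "card (paths S ((i, t, b, R) # sl) y) = (\<Sum>x\<in>?X. card ((#) (?y x) ` paths S sl (?y x)))"
    unfolding paths.simps using 2 by (intro card_UN_disjoint) (auto simp: finite_paths)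
  also have "\<dots> = (\<Sum>x\<in>?X. card (paths S sl (?y x)))"
    by (intro sum.cong) (auto intro!: card_image)
  finally have "of_nat (card (paths S ((i, t, b, R) # sl) y)) = ((\<Sum>x\<in>?X. of_nat (card (paths S sl (?y x)))) :: 'r)"
    by simp
  also have "\<dots> = (\<Sum>x\<in>words S b. of_bool (R (take t (drop i y)) x) * of_nat (card (paths S sl (?y x))))"
    using 2 by (intro sum.mono_neutral_cong_left) auto
  also have "\<dots> = transfer S (indicators ((i, t, b, R) # sl)) (\<lambda>_. 1) y"
    using "2.IH" 2(2) by (auto intro!: sum.cong)
  finally show ?case by simp
qed simp

definition step :: "'c set \<Rightarrow> 'c rel slice \<Rightarrow> 'c list \<Rightarrow> 'c list \<Rightarrow> bool" where
  "step S s y y' = (case s of (i, t, b, R) \<Rightarrow>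
     \<exists>x\<in>words S b. R (take t (drop i y)) x \<and> y' = take i y @ x @ drop (i + t) y)"

lemma Cons_in_paths: "y' # \<rho> \<in> paths S (s # sl) y \<longleftrightarrow> step S s y y' \<and> \<rho> \<in> paths S sl y'"
  by (cases s) (auto simp: step_def)

lemma Nil_in_paths: "[] \<in> paths S sl y \<longleftrightarrow> sl = []"
  by (cases sl) auto

lemma paths_iff:
  "\<rho> \<in> paths S sl y \<longleftrightarrow>
     length \<rho> = length sl \<and> (\<forall>t<length sl. step S (sl ! t) ((y # \<rho>) ! t) (\<rho> ! t))"
proof (induction sl arbitrary: y \<rho>)
  case (Cons s sl)
  show ?case
  proof (cases \<rho>)
    case (Cons y' \<rho>')
    then show ?thesis
      by (simp only: Cons_in_paths Cons.IH) (auto simp add: All_less_Suc2)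
  qed (auto simp: Nil_in_paths)
qed auto

text \<open>These relations make the colour constant along each strand, also through crossings, so
  the paths of a link diagram correspond to colourings of its components.\<close>

fun flip_rel :: "piece \<Rightarrow> 'c rel" where
  "flip_rel Cap a x \<longleftrightarrow> x ! 0 = x ! 1"
| "flip_rel Cup a x \<longleftrightarrow> a ! 0 = a ! 1"
| "flip_rel (Cross s) a x \<longleftrightarrow> x ! 0 = a ! 1 \<and> x ! 1 = a ! 0"

lemma length_rows:
  assumes "tangle m D n" "y \<in> words S m" "\<rho> \<in> paths S (slices R D) y" "t \<le> length D"
  shows "(y # \<rho>) ! t \<in> words S (width m (take t D))"
  using assms
proof (induction m D n arbitrary: y \<rho> t rule: tangle.induct)
  case (2 m i p D n)
  then obtain x \<rho>' where x: "x \<in> words S (bottom_ends p)" "\<rho> = (take i y @ x @ drop (i + top_ends p) y) # \<rho>'"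
    "\<rho>' \<in> paths S (slices R D) (take i y @ x @ drop (i + top_ends p) y)"
    by auto
  have w: "take i y @ x @ drop (i + top_ends p) y \<in> words S (m - top_ends p + bottom_ends p)"
    using 2 x by (intro splice_words) auto
  show ?case
  proof (cases t)
    case (Suc t')
    moreover have "tangle (m - top_ends p + bottom_ends p) D n" "t' \<le> length D"
      using 2 Suc by auto
    ultimately show ?thesis
      using 2(1)[OF _ w x(3), of t'] x(2) by simp
  qed (use 2 in simp)
qed simp

lemma flip_paths_joined:
  fixes S :: "'c set"
  assumes "tangle 0 D 0" "\<rho> \<in> paths S (slices flip_rel D) []" "joined D p p'"
  shows "(([] # \<rho>) ! fst p) ! snd p = (([] # \<rho>) ! fst p') ! snd p'"
proof -
  have len: "length \<rho> = length D" and
    st: "\<And>t. t < length D \<Longrightarrow> step S (slices flip_rel D ! t) (([] # \<rho>) ! t) (\<rho> ! t)"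
    using assms(2) by (auto simp: paths_iff slices_def)
  have main: "\<exists>l a x r. ([] # \<rho>) ! t = l @ a @ r \<and> ([] # \<rho>) ! Suc t = l @ x @ r \<and> length l = i \<and>
      length a = top_ends q \<and> length x = bottom_ends q \<and> flip_rel q a x" if t: "t < length D" "D ! t = (i, q)" for t i q
  proof -
    let ?y = "([] # \<rho>) ! t"
    have y: "?y \<in> words S (width 0 (take t D))"
      using length_rows[OF assms(1) _ assms(2)] t by (auto simp del: nth_Cons_Suc)
    have "tangle 0 (take t D @ (i, q) # drop (Suc t) D) 0"
      using assms(1) t id_take_nth_drop[of t D] by simp
    then obtain k where k: "tangle 0 (take t D) k" "i + top_ends q \<le> k"
      unfolding tangle_append by auto
    have "width 0 (take t D) = k"
    proof -
      have "tangle m E k \<Longrightarrow> width m E = k" for m E k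
        by (induction m E k rule: tangle.induct) auto
      then show ?thesis using k by simp
    qed
    then obtain l a r where y': "?y = l @ a @ r" "length l = i" "length a = top_ends q"
      using words_split[OF y] k(2) by metis
    have "slices (flip_rel :: piece \<Rightarrow> 'c rel) D ! t = (i, top_ends q, bottom_ends q, flip_rel q)"
      using t by (simp add: slices_def)
    then obtain x where "x \<in> words S (bottom_ends q)" "flip_rel q (take (top_ends q) (drop i ?y)) x"
       "\<rho> ! t = take i ?y @ x @ drop (i + top_ends q) ?y"
      using st[OF t(1)] unfolding step_def by auto
    then have "flip_rel q a x" "length x = bottom_ends q" "\<rho> ! t = l @ x @ r"
      using y' by (auto simp: length_words)
    then show ?thesis using y' by auto
  qed
  show ?thesis
    using assms(3)
  proof cases
    case (left t i p j)
    then show ?thesis using main[OF left(3,4)] by (auto simp: nth_append simp del: nth_Cons_Suc)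
  next
    case (right t i p j)
    from main[OF right(3,4)] obtain l a x r where m: "([] # \<rho>) ! t = l @ a @ r" "([] # \<rho>) ! Suc t = l @ x @ r" "length l = i"
      "length a = top_ends p" "length x = bottom_ends p" by blast
    then show ?thesis using right by (simp add: nth_append del: nth_Cons_Suc)
  next
    case (cap t i)
    from main[OF cap(3,4)] obtain l a x r where m: "([] # \<rho>) ! t = l @ a @ r" "([] # \<rho>) ! Suc t = l @ x @ r" "length l = i"
      "length x = 2" "x ! 0 = x ! 1" by auto
    then show ?thesis using cap by (simp add: nth_append del: nth_Cons_Suc)
  next
    case (cup t i)
    from main[OF cup(3,4)] obtain l a x r where m: "([] # \<rho>) ! t = l @ a @ r" "([] # \<rho>) ! Suc t = l @ x @ r" "length l = i"
      "length a = 2" "a ! 0 = a ! 1" by auto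
    then show ?thesis using cup by (simp add: nth_append del: nth_Cons_Suc)
  next
    case (cross_down t i s)
    from main[OF cross_down(3,4)] obtain l a x r where m: "([] # \<rho>) ! t = l @ a @ r" "([] # \<rho>) ! Suc t = l @ x @ r" "length l = i"
      "length a = 2" "length x = 2" "x ! 0 = a ! 1" "x ! 1 = a ! 0" by auto
    then show ?thesis using cross_down by (simp add: nth_append del: nth_Cons_Suc)
  next
    case (cross_up t i s)
    from main[OF cross_up(3,4)] obtain l a x r where m: "([] # \<rho>) ! t = l @ a @ r" "([] # \<rho>) ! Suc t = l @ x @ r" "length l = i"
      "length a = 2" "length x = 2" "x ! 0 = a ! 1" "x ! 1 = a ! 0" by auto
    then show ?thesis using cross_up by (simp add: nth_append del: nth_Cons_Suc)
  qed
qed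

text \<open>A colouring is constant along \<open>joined\<close>, so for a knot its value at one
  point determines it.\<close>

lemma card_flip_paths_knot:
  assumes "knot_diagram D" "finite S"
  shows "card (paths S (slices flip_rel D) []) \<le> card S"
proof -
  from assms(1) have T: "tangle 0 D 0" and eq: "\<And>x y. x \<in> points D \<Longrightarrow> y \<in> points D \<Longrightarrow> equivclp (joined D) x y"
    by (auto simp: knot_diagram_def link_diagram_def)
  obtain t0 j0 where x0: "(t0, j0) \<in> points D"
    using assms(1) by (auto simp: knot_diagram_def)
  let ?f = "\<lambda>\<rho>. (([] # \<rho>) ! t0) ! j0"
  have const: "(([] # \<rho>) ! t) ! j = ?f \<rho>" if "\<rho> \<in> paths S (slices flip_rel D) []" "(t, j) \<in> points D" for \<rho> t j
  proof -
    have "(([] # \<rho>) ! fst p) ! snd p = (([] # \<rho>) ! fst p') ! snd p'" if "equivclp (joined D) p p'" for p p'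
      using that
    proof (induction rule: equivclp_induct)
      case (step y z)
      then show ?case using flip_paths_joined[OF T \<open>\<rho> \<in> _\<close>] by metis
    qed simp
    from this[OF eq[OF that(2) x0]] show ?thesis by simp
  qed
  have rows: "([] # \<rho>) ! t \<in> words S (width 0 (take t D))" if "\<rho> \<in> paths S (slices flip_rel D) []" "t \<le> length D" for \<rho> t
    using length_rows[OF T _ that] by simp
  show ?thesis
  proof (rule card_inj_on_le[of ?f])
    show "inj_on ?f (paths S (slices flip_rel D) [])"
    proof (rule inj_onI)
      fix \<rho> \<rho>' assume H: "\<rho> \<in> paths S (slices flip_rel D) []" "\<rho>' \<in> paths S (slices flip_rel D) []" "?f \<rho> = ?f \<rho>'"
      then have len: "length \<rho> = length D" "length \<rho>' = length D"
        by (auto simp: paths_iff slices_def)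
      have "([] # \<rho>) ! t = ([] # \<rho>') ! t" if "t \<le> length D" for t
      proof (rule nth_equalityI)
        show "length (([] # \<rho>) ! t) = length (([] # \<rho>') ! t)"
          using rows[OF H(1) that] rows[OF H(2) that] by (simp add: length_words)
        fix j assume "j < length (([] # \<rho>) ! t)"
        then have "(t, j) \<in> points D"
          using rows[OF H(1) that] that by (simp add: points_def length_words)
        then show "([] # \<rho>) ! t ! j = ([] # \<rho>') ! t ! j"
          using const H by metis
      qed
      then have "([] # \<rho>) = ([] # \<rho>')"
        using len by (intro nth_equalityI) auto
      then show "\<rho> = \<rho>'" by simp
    qed
    show "?f ` paths S (slices flip_rel D) [] \<subseteq> S"
    proof clarify
      fix \<rho> assume H: "\<rho> \<in> paths S (slices flip_rel D) []"
      then show "?f \<rho> \<in> S"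
        using rows[OF H, of t0] x0 by (auto simp: points_def words_def)
    qed
  qed (rule assms(2))
qed

lemma tangle_width: "tangle m D k \<Longrightarrow> width m D = k"
  by (induction m D k rule: tangle.induct) auto

lemma flip_paths_of_joined:
  fixes f :: "nat \<times> nat \<Rightarrow> 'c"
  assumes T: "tangle 0 D 0" and J: "\<And>p p'. joined D p p' \<Longrightarrow> f p = f p'" and S: "range f \<subseteq> S"
  defines "row \<equiv> \<lambda>t. map (\<lambda>j. f (t, j)) [0..<width 0 (take t D)]"
  shows "map (\<lambda>t. row (Suc t)) [0..<length D] \<in> paths S (slices flip_rel D) []"
proof -
  let ?\<rho> = "map (\<lambda>t. row (Suc t)) [0..<length D]"
  have rows: "([] # ?\<rho>) ! t = row t" if "t \<le> length D" for t
    using that by (cases t) (auto simp: row_def)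
  have "step S (slices flip_rel D ! t) (row t) (row (Suc t))" if t: "t < length D" for t
  proof -
    obtain i q where q: "D ! t = (i, q)" by (cases "D ! t")
    let ?w = "width 0 (take t D)"
    have "tangle 0 (take t D @ (i, q) # drop (Suc t) D) 0"
      using T t q id_take_nth_drop[of t D] by simp
    then obtain k where k: "tangle 0 (take t D) k" "i + top_ends q \<le> k"
      unfolding tangle_append by auto
    then have w: "i + top_ends q \<le> ?w"
      by (auto dest: tangle_width)
    have w': "width 0 (take (Suc t) D) = ?w - top_ends q + bottom_ends q"
    proof -
      have "width m (E @ [(i, q)]) = width m E - top_ends q + bottom_ends q" for m E
        by (induction m E rule: width.induct) auto
      then show ?thesis using t q by (simp add: take_Suc_conv_app_nth)
    qed
    define x where "x = map (\<lambda>j. f (Suc t, i + j)) [0..<bottom_ends q]"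
    have len: "length (row t) = ?w" "length (row (Suc t)) = ?w - top_ends q + bottom_ends q" "length x = bottom_ends q"
      by (simp_all add: row_def w' x_def)
    have win: "take (top_ends q) (drop i (row t)) = map (\<lambda>j. f (t, i + j)) [0..<top_ends q]"
      using w by (intro nth_equalityI) (auto simp: row_def)
    have "row (Suc t) = take i (row t) @ x @ drop (i + top_ends q) (row t)"
    proof (rule nth_equalityI)
      show "length (row (Suc t)) = length (take i (row t) @ x @ drop (i + top_ends q) (row t))"
        using len w by simp
      fix j assume j: "j < length (row (Suc t))"
      then have v: "row (Suc t) ! j = f (Suc t, j)"
        by (simp add: row_def)
      consider "j < i" | "i \<le> j" "j < i + bottom_ends q" | "i + bottom_ends q \<le> j" by linarith
      then show "row (Suc t) ! j = (take i (row t) @ x @ drop (i + top_ends q) (row t)) ! j"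
      proof cases
        case 1
        then show ?thesis
          using J[OF joined.left[OF t q]] w len v by (simp add: nth_append row_def)
      next
        case 2
        moreover from this have "j - i < bottom_ends q" by linarith
        ultimately show ?thesis
          using w len v by (simp add: nth_append x_def)
      next
        case 3
        then obtain j' where j': "j = i + bottom_ends q + j'"
          using le_Suc_ex by blast
        then have "i + top_ends q + j' < ?w"
          using j len w by linarith
        then have "drop (i + top_ends q) (row t) ! j' = f (t, i + top_ends q + j')"
          by (simp add: row_def)
        moreover have "(take i (row t) @ x @ drop (i + top_ends q) (row t)) ! j = drop (i + top_ends q) (row t) ! j'"
          using w len j' by (simp add: nth_append)
        ultimately show ?thesis
          using J[OF joined.right[OF t q, of j']] v j' by simp
      qed
    qed
    moreover have "x \<in> words S (bottom_ends q)"
      using S by (auto simp: words_def x_def)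
    moreover have "flip_rel q (map (\<lambda>j. f (t, i + j)) [0..<top_ends q]) x"
      using J[OF joined.cap[OF t]] J[OF joined.cup[OF t]] J[OF joined.cross_down[OF t]] J[OF joined.cross_up[OF t]] q
      by (cases q) (auto simp: x_def numeral_2_eq_2)
    ultimately show ?thesis
      using t q win unfolding step_def by (auto simp: slices_def)
  qed
  then show ?thesis
    unfolding paths_iff using rows by (auto simp: slices_def)
qed

text \<open>If two points were not connected, the indicator function of the class of one of them
  would be a third colouring besides the two constant ones.\<close>

lemma knot_diagram_flip_paths:
  assumes T: "tangle 0 D 0" and two: "card (paths {0, 1 :: int} (slices flip_rel D) []) = 2"
  shows "knot_diagram D"
proof -
  let ?S = "{0, 1 :: int}" and ?\<rho> = "\<lambda>f. map (\<lambda>t. map (\<lambda>j. f (Suc t, j)) [0..<width 0 (take (Suc t) D)]) [0..<length D]"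
  have ne: "points D \<noteq> {}"
  proof (cases D)
    case Nil
    then show ?thesis using two by simp
  next
    case (Cons s D')
    then obtain p where "D = (0, p) # D'" "top_ends p = 0"
      using T by (cases s) auto
    then have "(1, 0) \<in> points D"
      by (cases p) (auto simp: points_def)
    then show ?thesis by auto
  qed
  have "equivclp (joined D) x y" if xy: "x \<in> points D" "y \<in> points D" for x y
  proof (rule ccontr)
    assume n: "\<not> equivclp (joined D) x y"
    define f where "f = (\<lambda>z. of_bool (equivclp (joined D) x z) :: int)"
    have fj: "f p = f p'" if "joined D p p'" for p p'
    proof -
      have "equivclp (joined D) p p'" "equivclp (joined D) p' p"
        using that by (auto intro: r_into_equivclp equivclp_sym)
      then have "equivclp (joined D) x p \<longleftrightarrow> equivclp (joined D) x p'"
        using equivclp_trans[of "joined D" x] by blast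
      then show ?thesis by (simp add: f_def)
    qed
    \<comment> \<open>The row on line \<open>0\<close> is empty, so a point has positive
      \<open>t\<close>, and its row is entry \<open>t - 1\<close> of the path.\<close>
    have val: "?\<rho> h ! (t - 1) ! j = h (t, j)" if "(t, j) \<in> points D" for t j and h :: "nat \<times> nat \<Rightarrow> int"
      using that by (cases t) (auto simp: points_def)
    have neq: "?\<rho> h \<noteq> ?\<rho> h'" if "z \<in> points D" "h z \<noteq> h' z" for h h' :: "nat \<times> nat \<Rightarrow> int" and z
      using val[of "fst z" "snd z" h] val[of "fst z" "snd z" h'] that by (metis prod.collapse)
    have "f x = 1" "f y = 0" using n by (auto simp: f_def)
    then have three: "card {?\<rho> f, ?\<rho> (\<lambda>_. 0), ?\<rho> (\<lambda>_. 1)} = 3"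
      using neq[OF xy(1), of f "\<lambda>_. 0"] neq[OF xy(2), of f "\<lambda>_. 1"] neq[OF xy(1), of "\<lambda>_. 0" "\<lambda>_. 1"] by simp
    have fS: "range f \<subseteq> ?S"
      by (auto simp: f_def)
    have "?\<rho> f \<in> paths ?S (slices flip_rel D) []"
      by (rule flip_paths_of_joined[OF T fj fS])
    moreover have "?\<rho> (\<lambda>_. 0) \<in> paths ?S (slices flip_rel D) []"
      by (rule flip_paths_of_joined[OF T, of "\<lambda>_. 0"]) simp_all
    moreover have "?\<rho> (\<lambda>_. 1) \<in> paths ?S (slices flip_rel D) []"
      by (rule flip_paths_of_joined[OF T, of "\<lambda>_. 1"]) simp_all
    ultimately have sub: "{?\<rho> f, ?\<rho> (\<lambda>_. 0), ?\<rho> (\<lambda>_. 1)} \<subseteq> paths ?S (slices flip_rel D) []"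
      by (simp only: insert_subset empty_subsetI simp_thms)
    have "finite (paths ?S (slices flip_rel D) [])"
      by (rule finite_paths) simp
    from card_mono[OF this sub] have "3 \<le> card (paths ?S (slices flip_rel D) [])"
      unfolding three .
    with two show False by simp
  qed
  with ne T show ?thesis by (simp add: knot_diagram_def link_diagram_def)
qed

section \<open>Invariance of the number of components under the moves\<close>

abbreviation flip_count :: "diagram \<Rightarrow> nat" where
  "flip_count D \<equiv> card (paths {0, 1 :: int} (slices flip_rel D) [])"

definition flip_weight :: "piece \<Rightarrow> (int, int) weight" where
  "flip_weight p a x = of_bool (flip_rel p a x)"

lemma flip_weight_simps:
  "flip_weight Cap a x = of_bool (x ! 0 = x ! 1)"
  "flip_weight Cup a x = of_bool (a ! 0 = a ! 1)"
  "flip_weight (Cross s) a x = of_bool (x ! 0 = a ! 1 \<and> x ! 1 = a ! 0)"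
  by (simp_all add: flip_weight_def)

lemma flip_count_transfer:
  "int (flip_count D) = closed_sum {0, 1} (slices flip_weight D)"
  using transfer_indicators[of "{0, 1 :: int}" "slices flip_rel D" "[]", where 'r = int]
  by (simp add: indicators_slices flip_weight_def[abs_def])

context
begin

private abbreviation "B \<equiv> {0, 1 :: int}"
private abbreviation "F \<equiv> transfer B"

lemma flip_Cap: "length l = i \<Longrightarrow>
  F (slices flip_weight ((i, Cap) # D)) g (l @ r) =
    F (slices flip_weight D) g (l @ [0, 0] @ r) + F (slices flip_weight D) g (l @ [1, 1] @ r)"
  by (simp add: sum_words_2 flip_weight_simps)

lemma flip_Cup: "length l = i \<Longrightarrow>
  F (slices flip_weight ((i, Cup) # D)) g (l @ [a, b] @ r) = of_bool (a = b) * F (slices flip_weight D) g (l @ r)"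
  by (simp add: flip_weight_simps)

lemma flip_Cross: "length l = i \<Longrightarrow> a \<in> B \<Longrightarrow> b \<in> B \<Longrightarrow>
  F (slices flip_weight ((i, Cross s) # D)) g (l @ [a, b] @ r) = F (slices flip_weight D) g (l @ [b, a] @ r)"
  by (auto simp: flip_weight_simps sum_words_2)

lemma words_B_split:
  assumes "y \<in> words B m" "i + n \<le> m"
  obtains l a r where "y = l @ a @ r" "length l = i" "a \<in> words B n"
  using words_split[OF assms] by metis

lemma flip_triple_window:
  assumes "a \<in> B" "b \<in> B" "c \<in> B" "length l = i"
  shows "F (slices flip_weight [(i, Cross x), (Suc i, Cross u), (i, Cross z)]) g (l @ [a, b, c] @ r) = g (l @ [c, b, a] @ r)"
    "F (slices flip_weight [(Suc i, Cross z), (i, Cross u), (Suc i, Cross x)]) g (l @ [a, b, c] @ r) = g (l @ [c, b, a] @ r)"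
  using assms
    flip_Cross[of l i a b x "[(Suc i, Cross u), (i, Cross z)]" g "c # r"]
    flip_Cross[of "l @ [b]" "Suc i" a c u "[(i, Cross z)]" g r]
    flip_Cross[of l i b c z "[]" g "a # r"]
    flip_Cross[of "l @ [a]" "Suc i" b c z "[(i, Cross u), (Suc i, Cross x)]" g r]
    flip_Cross[of l i a c u "[(Suc i, Cross x)]" g "b # r"]
    flip_Cross[of "l @ [c]" "Suc i" a b x "[]" g r]
  by simp_all

lemma flip_triple:
  assumes "y \<in> words B m" "i + 3 \<le> m"
  shows "F (slices flip_weight [(i, Cross x), (Suc i, Cross u), (i, Cross z)]) g y =
    F (slices flip_weight [(Suc i, Cross z), (i, Cross u), (Suc i, Cross x)]) g y"
proof -
  obtain l a r where "y = l @ a @ r" "length l = i" "a \<in> words B 3"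
    using words_B_split[of y m i 3] assms by auto
  then obtain a b c where "y = l @ [a, b, c] @ r" "length l = i" "a \<in> B" "b \<in> B" "c \<in> B"
    by (auto simp: words_def length_Suc_conv numeral_3_eq_3)
  then show ?thesis using flip_triple_window by metis
qed

lemma flip_isotopy:
  assumes "isotopy l r" "y \<in> words B m" "tangle m l n" "tangle m r n'"
  shows "F (slices flip_weight l) g y = F (slices flip_weight r) g y"
  using assms
proof (induction rule: isotopy.induct)
  case (exchange i p k q)
  then have "i + top_ends p + k + top_ends q \<le> m" by auto
  from transfer_exchange[OF exchange(1) this] show ?case by simp
next
  case (zigzag_left i)
  then obtain l a r where "y = l @ a @ r" "length l = i" "a \<in> words B 1"
    using words_B_split[of y m i 1] by auto
  then obtain c where c: "y = l @ [c] @ r" "length l = i" "c \<in> B"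
    by (auto simp: words_def length_Suc_conv)
  then show ?case
    using flip_Cap[of l i "[(Suc i, Cup)]" g "c # r"] flip_Cup[of "l @ [0]" "Suc i" "[]" g 0 c r]
      flip_Cup[of "l @ [1]" "Suc i" "[]" g 1 c r] by auto
next
  case (zigzag_right i)
  then obtain l a r where "y = l @ a @ r" "length l = i" "a \<in> words B 1"
    using words_B_split[of y m i 1] by auto
  then obtain c where c: "y = l @ [c] @ r" "length l = i" "c \<in> B"
    by (auto simp: words_def length_Suc_conv)
  then show ?case
    using flip_Cap[of "l @ [c]" "Suc i" "[(i, Cup)]" g "r"] flip_Cup[of "l" "i" "[]" g c 0 "0 # r"]
      flip_Cup[of "l" "i" "[]" g c 1 "1 # r"] by auto
next
  case (slide_cap i s)
  then obtain l a r where "y = l @ a @ r" "length l = i" "a \<in> words B 1"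
    using words_B_split[of y m i 1] by auto
  then obtain c where c: "y = l @ [c] @ r" "length l = i" "c \<in> B"
    by (auto simp: words_def length_Suc_conv)
  then show ?case
    using flip_Cap[of l i "[(Suc i, Cross s)]" g "c # r"] 
      flip_Cap[of "l @ [c]" "Suc i" "[(i, Cross (\<not> s))]" g r]
      flip_Cross[of "l @ [0]" "Suc i" 0 c s "[]" g r] flip_Cross[of "l @ [1]" "Suc i" 1 c s "[]" g r]
      flip_Cross[of l i c 0 "\<not> s" "[]" g "0 # r"] flip_Cross[of l i c 1 "\<not> s" "[]" g "1 # r"] by auto
next
  case (slide_cup i s)
  then have "i + 3 \<le> m" by auto
  then obtain l a r where "y = l @ a @ r" "length l = i" "a \<in> words B 3"
    using words_B_split[of y m i 3] slide_cup by auto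
  then obtain a b c where c: "y = l @ [a, b, c] @ r" "length l = i" "a \<in> B" "b \<in> B" "c \<in> B"
    by (auto simp: words_def length_Suc_conv numeral_3_eq_3)
  then show ?case
    using flip_Cross[of "l @ [a]" "Suc i" b c s "[(i, Cup)]" g r] flip_Cup[of l i "[]" g a c "b # r"]
      flip_Cross[of l i a b "\<not> s" "[(Suc i, Cup)]" g "c # r"] flip_Cup[of "l @ [b]" "Suc i" "[]" g a c r]
    by auto
next
  case (r1_cap i s)
  then obtain l a r where "y = l @ a @ r" "length l = i" "a \<in> words B 0"
    using words_B_split[of y m i 0] by auto
  then have c: "y = l @ r" "length l = i" by auto
  then show ?case
    using flip_Cap[of l i "[(i, Cross s)]" g r] flip_Cap[of l i "[]" g r]
      flip_Cross[of l i 0 0 s "[]" g r] flip_Cross[of l i 1 1 s "[]" g r] by auto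
next
  case (r1_cup i s)
  then obtain l a r where "y = l @ a @ r" "length l = i" "a \<in> words B 2"
    using words_B_split[of y m i 2] by auto
  then obtain a b where c: "y = l @ [a, b] @ r" "length l = i" "a \<in> B" "b \<in> B"
    by (auto simp: words_def length_Suc_conv numeral_2_eq_2)
  then show ?case
    using flip_Cup[of l i "[]" g a b r] flip_Cup[of l i "[]" g b a r]
      flip_Cross[of l i a b s "[(i, Cup)]" g r] by auto
next
  case (r2 i s)
  then obtain l a r where "y = l @ a @ r" "length l = i" "a \<in> words B 2"
    using words_B_split[of y m i 2] by auto
  then obtain a b where c: "y = l @ [a, b] @ r" "length l = i" "a \<in> B" "b \<in> B"
    by (auto simp: words_def length_Suc_conv numeral_2_eq_2)
  then show ?case
    using flip_Cross[of l i b a "\<not> s" "[]" g r]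
      flip_Cross[of l i a b s "[(i, Cross (\<not> s))]" g r] by auto
next
  case (r3 x z u i)
  then have "i + 3 \<le> m" by auto
  with r3(2) show ?case by (rule flip_triple)
qed

lemma flip_delta:
  assumes "delta l r" "y \<in> words B m" "tangle m l n"
  shows "F (slices flip_weight l) g y = F (slices flip_weight r) g y"
  using assms
proof (induction rule: delta.induct)
  case (1 x z u i)
  then have "i + 3 \<le> m" by auto
  with 1(3) show ?case by (rule flip_triple)
qed

lemma flip_count_replace:
  assumes "isotopy l r \<or> delta l r" "link_diagram (u @ l @ v)" "link_diagram (u @ r @ v)"
  shows "flip_count (u @ l @ v) = flip_count (u @ r @ v)"
proof -
  obtain k n where 1: "tangle 0 u k" "tangle k l n"
    using link_diagram_split[OF assms(2)] by metis
  obtain n' where "tangle k r n'"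
    using link_diagram_split[OF assms(3)] 1(1) tangle_unique by metis
  then have "F (slices flip_weight l) g y = F (slices flip_weight r) g y" if "y \<in> words B k" for g y
    using assms(1) flip_isotopy[OF _ that 1(2)] flip_delta[OF _ that 1(2)] by blast
  then have "closed_sum B (slices flip_weight (u @ l @ v)) = 1 * closed_sum B (slices flip_weight (u @ r @ v))"
    unfolding slices_simps using 1(1) by (intro transfer_replace[of 0 _ k]) simp_all
  then show ?thesis using flip_count_transfer by (metis mult_1 of_nat_eq_iff)
qed

end

lemma flip_count_knot:
  assumes "knot_diagram D"
  shows "flip_count D = 2"
proof (rule antisym)
  show "flip_count D \<le> 2"
    using card_flip_paths_knot[OF assms, of "{0, 1 :: int}"] by simp
  have T: "tangle 0 D 0" using assms by (simp add: knot_diagram_def link_diagram_def)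
  let ?\<rho> = "\<lambda>c :: int. map (\<lambda>t. map (\<lambda>j. c) [0..<width 0 (take (Suc t) D)]) [0..<length D]"
  obtain t j where p: "(t, j) \<in> points D" using assms by (auto simp: knot_diagram_def)
  then have "?\<rho> c ! (t - 1) ! j = c" for c
    by (cases t) (auto simp: points_def)
  then have "?\<rho> 0 \<noteq> ?\<rho> 1"
    by (metis zero_neq_one)
  then have two: "card {?\<rho> 0, ?\<rho> 1} = 2" by (rule card_2_iff[THEN iffD2, OF exI, OF exI, OF conjI[OF refl]])
  have "?\<rho> c \<in> paths {0, 1} (slices flip_rel D) []" if "c \<in> {0, 1}" for c
    by (rule flip_paths_of_joined[OF T, of "\<lambda>_. c"]) (use that in auto)
  then have sub: "{?\<rho> 0, ?\<rho> 1} \<subseteq> paths {0, 1} (slices flip_rel D) []"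
    by (simp only: insert_subset empty_subsetI insert_iff simp_thms)
  have "finite (paths {0, 1 :: int} (slices flip_rel D) [])"
    by (rule finite_paths) simp
  from card_mono[OF this sub] show "2 \<le> flip_count D" unfolding two .
qed

text \<open>The flip count recognizes knot diagrams, so after a move only the fitting of the slices
  has to be checked, never connectedness.\<close>

lemma knot_diagram_replace:
  assumes "isotopy l r \<or> delta l r \<or> isotopy r l \<or> delta r l" "knot_diagram (u @ l @ v)" "link_diagram (u @ r @ v)"
  shows "knot_diagram (u @ r @ v)"
proof -
  have "link_diagram (u @ l @ v)" using assms(2) by (simp add: knot_diagram_def)
  then have "flip_count (u @ r @ v) = 2"
    using flip_count_replace[of l r u v] flip_count_replace[of r l u v] assms flip_count_knot[OF assms(2)] by metis
  then show ?thesis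
    using assms(3) by (intro knot_diagram_flip_paths) (simp_all add: link_diagram_def)
qed

section \<open>Solution sets of colour equations and their dependence on a single slice\<close>

section \<open>Colouring counts\<close>

lemma paths_append:
  "\<rho> \<in> paths S (sl @ sl') y \<longleftrightarrow>
     (\<exists>\<rho>1 \<rho>2. \<rho> = \<rho>1 @ \<rho>2 \<and> \<rho>1 \<in> paths S sl y \<and> \<rho>2 \<in> paths S sl' (last (y # \<rho>1)))"
proof (induction sl arbitrary: y \<rho>)
  case (Cons s sl)
  show ?case
  proof
    assume "\<rho> \<in> paths S ((s # sl) @ sl') y"
    then obtain y' \<rho>' where 1: "\<rho> = y' # \<rho>'" "step S s y y'" "\<rho>' \<in> paths S (sl @ sl') y'"
      by (cases \<rho>) (auto simp: Nil_in_paths Cons_in_paths)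
    then obtain \<rho>1 \<rho>2 where "\<rho>' = \<rho>1 @ \<rho>2" "\<rho>1 \<in> paths S sl y'" "\<rho>2 \<in> paths S sl' (last (y' # \<rho>1))"
      using Cons.IH by blast
    then show "\<exists>\<rho>1 \<rho>2. \<rho> = \<rho>1 @ \<rho>2 \<and> \<rho>1 \<in> paths S (s # sl) y \<and> \<rho>2 \<in> paths S sl' (last (y # \<rho>1))"
      using 1 by (intro exI[of _ "y' # \<rho>1"] exI[of _ \<rho>2]) (auto simp: Cons_in_paths)
  next
    assume "\<exists>\<rho>1 \<rho>2. \<rho> = \<rho>1 @ \<rho>2 \<and> \<rho>1 \<in> paths S (s # sl) y \<and> \<rho>2 \<in> paths S sl' (last (y # \<rho>1))"
    then obtain \<rho>1 \<rho>2 where 1: "\<rho> = \<rho>1 @ \<rho>2" "\<rho>1 \<in> paths S (s # sl) y" "\<rho>2 \<in> paths S sl' (last (y # \<rho>1))"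
      by blast
    then obtain y' \<rho>' where 2: "\<rho>1 = y' # \<rho>'" "step S s y y'" "\<rho>' \<in> paths S sl y'"
      by (cases \<rho>1) (auto simp: Nil_in_paths Cons_in_paths)
    with 1 have "\<rho>2 \<in> paths S sl' (last (y' # \<rho>'))" by simp
    with 2 have "\<rho>' @ \<rho>2 \<in> paths S (sl @ sl') y'"
      unfolding Cons.IH by blast
    with 1 2 show "\<rho> \<in> paths S ((s # sl) @ sl') y"
      by (simp add: Cons_in_paths)
  qed
qed auto

lemma paths_slot:
  "\<rho> \<in> paths S (pre @ s # post) y \<longleftrightarrow>
     (\<exists>\<rho>1 r \<rho>2. \<rho> = \<rho>1 @ r # \<rho>2 \<and> \<rho>1 \<in> paths S pre y \<and> step S s (last (y # \<rho>1)) r \<and> \<rho>2 \<in> paths S post r)"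
proof -
  have "\<rho>2 \<in> paths S (s # post) z \<longleftrightarrow> (\<exists>r \<rho>'. \<rho>2 = r # \<rho>' \<and> step S s z r \<and> \<rho>' \<in> paths S post r)" for \<rho>2 z
    by (cases \<rho>2) (auto simp: Nil_in_paths Cons_in_paths)
  then show ?thesis unfolding paths_append by blast
qed

lemma paths_fits:
  assumes "fits m sl n" "y \<in> words S m" "\<rho> \<in> paths S sl y"
  shows "last (y # \<rho>) \<in> words S n"
  using assms
proof (induction m sl n arbitrary: y \<rho> rule: fits.induct)
  case (2 m i t b W sl n)
  then obtain x \<rho>' where x: "x \<in> words S b" "\<rho> = (take i y @ x @ drop (i + t) y) # \<rho>'"
    "\<rho>' \<in> paths S sl (take i y @ x @ drop (i + t) y)"
    by auto
  have "take i y @ x @ drop (i + t) y \<in> words S (m - t + b)"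
    using 2 x by (intro splice_words) auto
  moreover have "fits (m - t + b) sl n" using 2(2) unfolding fits.simps by blast
  ultimately have "last ((take i y @ x @ drop (i + t) y) # \<rho>') \<in> words S n"
    using "2.IH" x(3) by blast
  then show ?case
    using x(2) by (simp only: last_ConsR list.distinct simp_thms)
qed simp

text \<open>One slice list carries several systems of relations of the same shape. Labels
  \<open>0\<close> and \<open>1\<close> belong to two given solutions, label \<open>2\<close> to
  their pointwise combination.\<close>

definition label_at :: "nat \<Rightarrow> (nat \<Rightarrow> 'a) slice list \<Rightarrow> 'a slice list" where
  "label_at k = map (\<lambda>(i, t, b, L). (i, t, b, L k))"

definition constant_labels :: "'a slice list \<Rightarrow> (nat \<Rightarrow> 'a) slice list" where
  "constant_labels = map (\<lambda>(i, t, b, R). (i, t, b, \<lambda>_. R))"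

lemma label_at_simps [simp]:
  "label_at k [] = []"
  "label_at k ((i, t, b, L) # sl) = (i, t, b, L k) # label_at k sl"
  "label_at k (sl @ sl') = label_at k sl @ label_at k sl'"
  "label_at k (constant_labels pre) = pre"
  by (simp_all add: label_at_def constant_labels_def case_prod_unfold comp_def)

definition compatible :: "'c set \<Rightarrow> ('c \<Rightarrow> 'c \<Rightarrow> 'c) \<Rightarrow> nat \<times> nat \<times> nat \<times> (nat \<Rightarrow> 'c rel) \<Rightarrow> bool" where
  "compatible S F = (\<lambda>(i, t, b, L). \<forall>a\<in>words S t. \<forall>a'\<in>words S t. \<forall>x\<in>words S b. \<forall>x'\<in>words S b.
     L 0 a x \<longrightarrow> L 1 a' x' \<longrightarrow> L 2 (map2 F a a') (map2 F x x'))"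

lemma map2_words:
  assumes "\<And>u v. u \<in> S \<Longrightarrow> v \<in> S \<Longrightarrow> F u v \<in> S" "y \<in> words S n" "y' \<in> words S n"
  shows "map2 F y y' \<in> words S n"
  using assms by (auto simp: words_def dest: set_zip_leftD set_zip_rightD intro!: assms(1))

lemma paths_pointwise:
  assumes "fits m (label_at 0 sl) n" "y \<in> words S m" "y' \<in> words S m"
    and "\<rho> \<in> paths S (label_at 0 sl) y" "\<rho>' \<in> paths S (label_at 1 sl) y'"
    and "\<And>s. s \<in> set sl \<Longrightarrow> compatible S F s" and F: "\<And>u v. u \<in> S \<Longrightarrow> v \<in> S \<Longrightarrow> F u v \<in> S"
  shows "map2 (map2 F) \<rho> \<rho>' \<in> paths S (label_at 2 sl) (map2 F y y')"
  using assms(1-6)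
proof (induction sl arbitrary: m y y' \<rho> \<rho>')
  case (Cons s sl)
  obtain i t b L where s: "s = (i, t, b, L)" by (cases s)
  from Cons.prems s obtain x \<sigma> where x: "x \<in> words S b" "L 0 (take t (drop i y)) x" "\<rho> = (take i y @ x @ drop (i + t) y) # \<sigma>"
    "\<sigma> \<in> paths S (label_at 0 sl) (take i y @ x @ drop (i + t) y)"
    by auto
  from Cons.prems s obtain x' \<sigma>' where x': "x' \<in> words S b" "L 1 (take t (drop i y')) x'" "\<rho>' = (take i y' @ x' @ drop (i + t) y') # \<sigma>'"
    "\<sigma>' \<in> paths S (label_at 1 sl) (take i y' @ x' @ drop (i + t) y')"
    by auto
  have f: "i + t \<le> m" "fits (m - t + b) (label_at 0 sl) n" using Cons.prems s by auto
  have len: "length y = m" "length y' = m" "length x = b" "length x' = b"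
    using Cons.prems x x' by (auto simp: length_words)
  let ?y = "map2 F y y'" and ?x = "map2 F x x'"
  have w: "take i y @ x @ drop (i + t) y \<in> words S (m - t + b)" "take i y' @ x' @ drop (i + t) y' \<in> words S (m - t + b)"
    using Cons.prems x(1) x'(1) f(1) by (simp_all only: splice_words)
  have eq: "map2 F (take i y @ x @ drop (i + t) y) (take i y' @ x' @ drop (i + t) y') = take i ?y @ ?x @ drop (i + t) ?y"
    using len f by (simp add: take_map drop_map take_zip drop_zip)
  have "map2 (map2 F) \<sigma> \<sigma>' \<in> paths S (label_at 2 sl) (take i ?y @ ?x @ drop (i + t) ?y)"
    using Cons.IH[OF f(2) w x(4) x'(4)] Cons.prems(6) eq by simp
  moreover have "L 2 (map2 F (take t (drop i y)) (take t (drop i y'))) ?x"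
    using Cons.prems(6)[of s] x x' window_words[OF Cons.prems(2) f(1)] window_words[OF Cons.prems(3) f(1)]
    by (auto simp: compatible_def s)
  then have "L 2 (take t (drop i ?y)) ?x"
    by (simp add: take_map drop_map take_zip drop_zip)
  moreover have "?x \<in> words S b" by (rule map2_words[OF F x(1) x'(1)])
  ultimately have "(take i ?y @ ?x @ drop (i + t) ?y) # map2 (map2 F) \<sigma> \<sigma>' \<in> paths S (label_at 2 (s # sl)) ?y"
    by (auto simp: s Cons_in_paths step_def)
  then show ?case
    using x(3) x'(3) eq by simp
qed simp

lemma map2_cancel:
  assumes "\<And>u v w. u \<in> S \<Longrightarrow> v \<in> S \<Longrightarrow> w \<in> S \<Longrightarrow> F u w = F v w \<Longrightarrow> u = v"
    and "y \<in> words S n" "y' \<in> words S n" "z \<in> words S n" "map2 F y z = map2 F y' z"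
  shows "y = y'"
proof (rule nth_equalityI)
  show "length y = length y'" using assms by (simp add: length_words)
  fix j assume j: "j < length y"
  then have "map2 F y z ! j = map2 F y' z ! j" using assms(5) by simp
  then have "F (y ! j) (z ! j) = F (y' ! j) (z ! j)" using j assms(2-4) by (simp add: length_words)
  moreover have "y ! j \<in> S" "y' ! j \<in> S" "z ! j \<in> S"
    using j assms(2-4) by (auto simp: words_def)
  ultimately show "y ! j = y' ! j" using assms(1) by blast
qed

lemma paths_cancel:
  assumes F: "\<And>u v w. u \<in> S \<Longrightarrow> v \<in> S \<Longrightarrow> w \<in> S \<Longrightarrow> F u w = F v w \<Longrightarrow> u = v"
    and "fits m sl n" "y \<in> words S m" "y' \<in> words S m" "z \<in> words S m"
    and "\<rho> \<in> paths S sl y" "\<rho>' \<in> paths S sl y'" "\<tau> \<in> paths S sl z"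
    and "map2 (map2 F) \<rho> \<tau> = map2 (map2 F) \<rho>' \<tau>"
  shows "\<rho> = \<rho>'"
  using assms(2-)
proof (induction m sl n arbitrary: y y' z \<rho> \<rho>' \<tau> rule: fits.induct)
  case (2 m i t b W sl n)
  have *: "\<exists>r \<sigma>. \<rho> = r # \<sigma> \<and> r \<in> words S (m - t + b) \<and> \<sigma> \<in> paths S sl r"
    if "y \<in> words S m" "\<rho> \<in> paths S ((i, t, b, W) # sl) y" for y \<rho>
    using that splice_words[OF that(1), of _ b i t] 2(2) by auto
  obtain r \<sigma> where 1: "\<rho> = r # \<sigma>" "r \<in> words S (m - t + b)" "\<sigma> \<in> paths S sl r" using * 2 by metis
  obtain r' \<sigma>' where A: "\<rho>' = r' # \<sigma>'" "r' \<in> words S (m - t + b)" "\<sigma>' \<in> paths S sl r'" using * 2 by metis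
  obtain q \<theta> where 3: "\<tau> = q # \<theta>" "q \<in> words S (m - t + b)" "\<theta> \<in> paths S sl q" using * 2 by metis
  have "r = r'"
  proof (rule map2_cancel[of S F, OF F 1(2) A(2) 3(2)])
    show "map2 F r q = map2 F r' q" using 2(9) 1 A 3 by simp
  qed
  moreover have "\<sigma> = \<sigma>'"
  proof (rule "2.IH"[OF _ 1(2) A(2) 3(2) 1(3) A(3) 3(3)])
    show "fits (m - t + b) sl n" using 2(2) unfolding fits.simps by blast
    show "map2 (map2 F) \<sigma> \<theta> = map2 (map2 F) \<sigma>' \<theta>" using 2(9) 1 A 3 by simp
  qed
  ultimately show ?case using 1 A by simp
qed simp

definition sub_mod :: "nat \<Rightarrow> int \<Rightarrow> int \<Rightarrow> int" where
  "sub_mod d u v = (u - v) mod int d"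

abbreviation colours :: "nat \<Rightarrow> int set" where
  "colours d \<equiv> {0..<int d}"

lemma sub_mod_colours: "u \<in> colours d \<Longrightarrow> sub_mod d u v \<in> colours d"
  by (simp add: sub_mod_def)

lemma sub_mod_cancel:
  assumes "u \<in> colours d" "v \<in> colours d" "sub_mod d u w = sub_mod d v w"
  shows "u = v"
proof -
  have "u mod int d = v mod int d"
    using assms(3) by (simp add: sub_mod_def mod_eq_dvd_iff)
  then show ?thesis using assms by simp
qed

text \<open>The difference with a fixed solution maps the solutions of an inhomogeneous system
  injectively to those of the homogeneous one.\<close>

lemma card_paths_fibre:
  assumes "label_at 0 sl = label_at 1 sl" "fits 0 (label_at 0 sl) n"
    and "\<And>s. s \<in> set sl \<Longrightarrow> compatible (colours d) (sub_mod d) s"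
  shows "card (paths (colours d) (label_at 0 sl) []) \<le> card (paths (colours d) (label_at 2 sl) [])"
proof (cases "paths (colours d) (label_at 0 sl) [] = {}")
  case False
  then obtain \<tau> where \<tau>: "\<tau> \<in> paths (colours d) (label_at 0 sl) []" by auto
  show ?thesis
  proof (rule card_inj_on_le)
    show "inj_on (\<lambda>\<rho>. map2 (map2 (sub_mod d)) \<rho> \<tau>) (paths (colours d) (label_at 0 sl) [])"
    proof (rule inj_onI)
      fix \<rho> \<rho>' assume \<rho>: "\<rho> \<in> paths (colours d) (label_at 0 sl) []" "\<rho>' \<in> paths (colours d) (label_at 0 sl) []"
        and eq: "map2 (map2 (sub_mod d)) \<rho> \<tau> = map2 (map2 (sub_mod d)) \<rho>' \<tau>"
      have Nil: "[] \<in> words (colours d) 0" by simp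
      show "\<rho> = \<rho>'"
      proof (rule paths_cancel[OF _ assms(2) Nil Nil Nil \<rho> \<tau> eq])
        fix u v w assume "u \<in> colours d" "v \<in> colours d" "sub_mod d u w = sub_mod d v w"
        then show "u = v" by (rule sub_mod_cancel)
      qed
    qed
    show "(\<lambda>\<rho>. map2 (map2 (sub_mod d)) \<rho> \<tau>) ` paths (colours d) (label_at 0 sl) [] \<subseteq> paths (colours d) (label_at 2 sl) []"
      using paths_pointwise[of 0 sl n "[]" "colours d" "[]" _ \<tau> "sub_mod d"] assms \<tau> sub_mod_colours
      by auto
    show "finite (paths (colours d) (label_at 2 sl) [])" by (rule finite_paths) simp
  qed
qed simp

lemma paths_slotI:
  "\<lbrakk>\<rho>1 \<in> paths S pre y; step S s (last (y # \<rho>1)) r; \<rho>2 \<in> paths S post r\<rbrakk>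
    \<Longrightarrow> \<rho>1 @ r # \<rho>2 \<in> paths S (pre @ s # post) y"
  by (simp only: paths_slot) blast

lemma paths_slotE:
  assumes "\<rho> \<in> paths S (pre @ s # post) y"
  obtains \<rho>1 r \<rho>2 where "\<rho> = \<rho>1 @ r # \<rho>2" "\<rho>1 \<in> paths S pre y" "step S s (last (y # \<rho>1)) r" "\<rho>2 \<in> paths S post r"
  using assms by (simp only: paths_slot) blast

lemma paths_mono_slot:
  assumes "\<And>a x. R a x \<Longrightarrow> R' a x"
  shows "paths S (pre @ (i, t, b, R) # post) y \<subseteq> paths S (pre @ (i, t, b, R') # post) y"
proof
  fix \<rho> assume "\<rho> \<in> paths S (pre @ (i, t, b, R) # post) y"
  then show "\<rho> \<in> paths S (pre @ (i, t, b, R') # post) y"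
  proof (rule paths_slotE)
    fix \<rho>1 r \<rho>2
    assume *: "\<rho> = \<rho>1 @ r # \<rho>2" "\<rho>1 \<in> paths S pre y" "step S (i, t, b, R) (last (y # \<rho>1)) r" "\<rho>2 \<in> paths S post r"
    then have "step S (i, t, b, R') (last (y # \<rho>1)) r"
      using assms unfolding step_def by auto
    with * show ?thesis by (simp only: paths_slotI)
  qed
qed

lemma paths_cover_slot:
  assumes "fits m (pre @ (i, t, b, R) # post) n" "y \<in> words S m"
    and "\<And>a x. a \<in> words S t \<Longrightarrow> x \<in> words S b \<Longrightarrow> R a x \<Longrightarrow> \<exists>k\<in>K. R' k a x"
  shows "paths S (pre @ (i, t, b, R) # post) y \<subseteq> (\<Union>k\<in>K. paths S (pre @ (i, t, b, R' k) # post) y)"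
proof
  fix \<rho> assume "\<rho> \<in> paths S (pre @ (i, t, b, R) # post) y"
  then show "\<rho> \<in> (\<Union>k\<in>K. paths S (pre @ (i, t, b, R' k) # post) y)"
  proof (rule paths_slotE)
    fix \<rho>1 r \<rho>2
    assume *: "\<rho> = \<rho>1 @ r # \<rho>2" "\<rho>1 \<in> paths S pre y" "step S (i, t, b, R) (last (y # \<rho>1)) r" "\<rho>2 \<in> paths S post r"
    obtain k where k: "fits m pre k" "i + t \<le> k" using assms(1) by (auto simp: fits_append)
    have "last (y # \<rho>1) \<in> words S k" using paths_fits[OF k(1) assms(2) *(2)] .
    then have w: "take t (drop i (last (y # \<rho>1))) \<in> words S t" using k(2) by (rule window_words)
    obtain x where x: "x \<in> words S b" "R (take t (drop i (last (y # \<rho>1)))) x"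
      "r = take i (last (y # \<rho>1)) @ x @ drop (i + t) (last (y # \<rho>1))"
      using *(3) unfolding step_def by auto
    obtain j where "j \<in> K" "R' j (take t (drop i (last (y # \<rho>1)))) x"
      using assms(3)[OF w x(1,2)] by blast
    moreover from this x have "step S (i, t, b, R' j) (last (y # \<rho>1)) r"
      unfolding step_def by auto
    ultimately show ?thesis
      using * by (auto simp only: intro!: paths_slotI)
  qed
qed

text \<open>The alternating sum of a row detects an odd number of ends of a component on one side of a slice.\<close>

fun alternating_sum :: "int list \<Rightarrow> int" where
  "alternating_sum [] = 0"
| "alternating_sum (x # xs) = x - alternating_sum xs"

lemma alternating_sum_append:
  "alternating_sum (l @ r) = alternating_sum l + (- 1) ^ length l * alternating_sum r"
  by (induction l) auto

text \<open>The condition on \<open>alternating_sum\<close> reflects planarity: arcs join ends whose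
  contributions to the difference of the two sums cancel. Closure under every pointwise operation is
  the property of relations given by equations between entries.\<close>

definition smoothing :: "int rel slice \<Rightarrow> bool" where
  "smoothing = (\<lambda>(i, t, b, R). even (t + b) \<and>
     (\<forall>a x. length a = t \<longrightarrow> length x = b \<longrightarrow> R a x \<longrightarrow> alternating_sum a = alternating_sum x) \<and>
     (\<forall>F a a' x x'. length a = t \<longrightarrow> length a' = t \<longrightarrow> length x = b \<longrightarrow> length x' = b \<longrightarrow>
        R a x \<longrightarrow> R a' x' \<longrightarrow> R (map2 F a a') (map2 F x x')))"

lemma smoothing_compatible:
  "smoothing s \<Longrightarrow> s' \<in> set (constant_labels [s]) \<Longrightarrow> compatible S F s'"
  by (cases s) (simp add: smoothing_def compatible_def constant_labels_def length_words)

lemma compatible_constant_labels: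
  "list_all smoothing sl \<Longrightarrow> s' \<in> set (constant_labels sl) \<Longrightarrow> compatible S F s'"
  using smoothing_compatible by (fastforce simp: constant_labels_def list_all_iff)

lemma alternating_sum_slice:
  assumes "y \<in> words S m" "i + t \<le> m" "even (t + length x)" 
  shows "alternating_sum (take i y @ x @ drop (i + t) y) =
    alternating_sum y + (- 1) ^ i * (alternating_sum x - alternating_sum (take t (drop i y)))"
proof -
  obtain l a r where y: "y = l @ a @ r" "length l = i" "length a = t"
    using words_split[OF assms(1,2)] by metis
  have "(- 1 :: int) ^ length x = (- 1) ^ t"
    using assms(3) by (simp add: minus_one_power_iff)
  then show ?thesis
    using y by (simp add: alternating_sum_append power_add algebra_simps)
qed

lemma alternating_sum_paths:
  assumes "list_all smoothing sl" "fits m sl n" "y \<in> words S m" "\<rho> \<in> paths S sl y"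
  shows "alternating_sum (last (y # \<rho>)) = alternating_sum y"
  using assms
proof (induction sl arbitrary: m y \<rho>)
  case (Cons s sl)
  obtain i t b R where s: "s = (i, t, b, R)" by (cases s)
  from Cons.prems s obtain x \<sigma> where x: "x \<in> words S b" "R (take t (drop i y)) x" "\<rho> = (take i y @ x @ drop (i + t) y) # \<sigma>"
    "\<sigma> \<in> paths S sl (take i y @ x @ drop (i + t) y)"
    by auto
  have f: "i + t \<le> m" "fits (m - t + b) sl n" using Cons.prems s by auto
  have w: "take i y @ x @ drop (i + t) y \<in> words S (m - t + b)"
    using Cons.prems x(1) f(1) by (simp only: splice_words)
  have "alternating_sum (take i y @ x @ drop (i + t) y) = alternating_sum y"
  proof -
    have sm: "smoothing (i, t, b, R)" using Cons.prems(1) s by simp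
    have len: "length (take t (drop i y)) = t" "length x = b"
      using x(1) window_words[OF Cons.prems(3) f(1)] by (simp_all add: words_def)
    then have "alternating_sum (take t (drop i y)) = alternating_sum x"
      using sm x(2) by (simp add: smoothing_def)
    moreover have "even (t + length x)" using sm len by (simp add: smoothing_def)
    ultimately show ?thesis by (subst alternating_sum_slice[OF Cons.prems(3) f(1)]) simp_all
  qed
  then show ?case using Cons.IH[OF _ f(2) w x(4)] Cons.prems(1) x(3) by simp
qed simp

text \<open>Smoothings preserve the alternating sum, which is \<open>0\<close> for the empty first
  and last rows. So it is \<open>0\<close> on both sides of the slot, and the slot cannot change
  it.\<close>

lemma paths_unbalanced_slot:
  assumes "list_all smoothing pre" "list_all smoothing post" "fits 0 (pre @ (i, t, b, R) # post) 0"
    and "even (t + b)" "\<And>a x. length a = t \<Longrightarrow> length x = b \<Longrightarrow> R a x \<Longrightarrow> alternating_sum a \<noteq> alternating_sum x"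
  shows "paths S (pre @ (i, t, b, R) # post) [] = {}"
proof (rule ccontr)
  assume "paths S (pre @ (i, t, b, R) # post) [] \<noteq> {}"
  then obtain \<rho> where "\<rho> \<in> paths S (pre @ (i, t, b, R) # post) []" by auto
  then obtain \<rho>1 r \<rho>2 where *: "\<rho>1 \<in> paths S pre []" "step S (i, t, b, R) (last ([] # \<rho>1)) r" "\<rho>2 \<in> paths S post r"
    by (rule paths_slotE)
  let ?y = "last ([] # \<rho>1)"
  obtain k where k: "fits 0 pre k" "i + t \<le> k" "fits (k - t + b) post 0" using assms(3) by (auto simp: fits_append)
  have y: "?y \<in> words S k" using paths_fits[OF k(1) _ *(1)] by simp
  obtain x where x: "x \<in> words S b" "R (take t (drop i ?y)) x"
      "r = take i ?y @ x @ drop (i + t) ?y"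
    using *(2) unfolding step_def by auto
  have r: "r \<in> words S (k - t + b)" unfolding x(3) using y x(1) k(2) by (rule splice_words)
  have "alternating_sum ?y = 0" using alternating_sum_paths[OF assms(1) k(1) _ *(1)] by simp
  moreover have "alternating_sum r = 0"
    using alternating_sum_paths[OF assms(2) k(3) r *(3)] paths_fits[OF k(3) r *(3)] by (simp split: if_splits)
  moreover have "alternating_sum r = alternating_sum ?y +
      (- 1) ^ i * (alternating_sum x - alternating_sum (take t (drop i ?y)))"
    unfolding x(3) using x(1) assms(4) by (intro alternating_sum_slice[OF y k(2)]) (simp add: length_words)
  ultimately show False
    using assms(5)[OF length_words[OF window_words[OF y k(2)]] length_words[OF x(1)] x(2)] by simp
qed

section \<open>The two smoothings of a crossing, and the crossing as a vertex\<close>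

definition vertical :: "'c rel" where "vertical a x \<longleftrightarrow> a ! 0 = x ! 0 \<and> a ! 1 = x ! 1"
definition horizontal :: "'c rel" where "horizontal a x \<longleftrightarrow> a ! 0 = a ! 1 \<and> x ! 0 = x ! 1"
text \<open>With all four ends equal the crossing acts as a vertex of the shadow of the diagram, so
  colourings that are \<open>merged\<close> at every crossing see the connected pieces of the
  shadow.\<close>

definition merged :: "'c rel" where "merged a x \<longleftrightarrow> vertical a x \<and> horizontal a x"

fun smoothed :: "(bool \<Rightarrow> 'c rel) \<Rightarrow> piece \<Rightarrow> 'c rel" where
  "smoothed \<sigma> (Cross s) = \<sigma> s"
| "smoothed \<sigma> p = flip_rel p"

lemma length_2_conv: "length a = 2 \<longleftrightarrow> (\<exists>u v. a = [u, v])"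
  by (auto simp: numeral_2_eq_2 length_Suc_conv)

lemma smoothing_simps:
  "smoothing (i, 0, 2, flip_rel Cap)" "smoothing (i, 2, 0, flip_rel Cup)"
  "smoothing (i, 2, 2, vertical)" "smoothing (i, 2, 2, horizontal)" "smoothing (i, 2, 2, merged)"
proof -
  have *: "length a = 2 \<Longrightarrow> a = [a ! 0, a ! 1]" for a :: "int list"
    by (auto simp: length_2_conv)
  have **: "alternating_sum a = a ! 0 - a ! 1" if "length a = 2" for a
    by (subst *[OF that]) simp
  have h: "map2 F a a' ! 0 = F (a ! 0) (a' ! 0)" "map2 F a a' ! 1 = F (a ! 1) (a' ! 1)"
    if "length a = 2" "length a' = 2" for F and a a' :: "int list"
    using that by simp_all
  show "smoothing (i, 0, 2, flip_rel Cap)" "smoothing (i, 2, 0, flip_rel Cup)"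
    "smoothing (i, 2, 2, vertical)" "smoothing (i, 2, 2, horizontal)" "smoothing (i, 2, 2, merged)"
    unfolding smoothing_def vertical_def horizontal_def merged_def flip_rel.simps case_prod_conv
    by (simp_all only: ** h list.size alternating_sum.simps simp_thms even_add) (simp_all add: **)
qed

lemma smoothing_smoothed:
  assumes "\<And>s. \<sigma> s \<in> {vertical, horizontal, merged}"
  shows "list_all smoothing (slices (smoothed \<sigma>) D)"
proof (induction D)
  case (Cons q D)
  obtain i p where q: "q = (i, p)" by (cases q)
  have "smoothing (i, top_ends p, bottom_ends p, smoothed \<sigma> p)"
    using assms smoothing_simps by (cases p) (auto, metis)
  then show ?case using Cons q by simp
qed simp

abbreviation colourings :: "nat \<Rightarrow> int rel slice list \<Rightarrow> nat" where
  "colourings d sl \<equiv> card (paths (colours d) sl [])"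

lemma card_paths_mono_slot:
  assumes "\<And>a x. R a x \<Longrightarrow> R' a x"
  shows "colourings d (pre @ (i, t, b, R) # post) \<le> colourings d (pre @ (i, t, b, R') # post)"
  using paths_mono_slot[of R R', OF assms] by (intro card_mono finite_paths) auto

lemma words_2E:
  assumes "a \<in> words S 2" obtains u v where "a = [u, v]" "u \<in> S" "v \<in> S"
  using assms by (auto simp: words_def length_2_conv)

text \<open>\<open>merged\<close> removes one degree of freedom from a smoothing, the difference
  modulo \<open>d\<close> of the colours of its two arcs; this is \<open>key\<close>. On the
  colourings with a given key, subtracting a fixed one lands in the \<open>merged\<close>
  colourings, and there are \<open>d\<close> keys.\<close>

lemma colourings_split_merged:
  assumes "list_all smoothing pre" "list_all smoothing post" "fits 0 (pre @ (i, 2, 2, R) # post) 0"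
    and "R = vertical \<or> R = horizontal"
  shows "colourings d (pre @ (i, 2, 2, R) # post) \<le> d * colourings d (pre @ (i, 2, 2, merged) # post)"
proof -
  define key where "key a x = (if R = vertical then sub_mod d (a ! 0) (a ! 1) else sub_mod d (a ! 0) (x ! 0))" for a x :: "int list"
  define R' where "R' c a x \<longleftrightarrow> R a x \<and> key a x = c" for c a x
  have le: "colourings d (pre @ (i, 2, 2, R' c) # post) \<le> colourings d (pre @ (i, 2, 2, merged) # post)" for c
  proof -
    define sl where "sl = constant_labels pre @ (i, 2, 2, \<lambda>n. if n = (2 :: nat) then merged else R' c) # constant_labels post"
    have at: "label_at 0 sl = pre @ (i, 2, 2, R' c) # post" "label_at 1 sl = pre @ (i, 2, 2, R' c) # post"
      "label_at 2 sl = pre @ (i, 2, 2, merged) # post"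
      by (simp_all add: sl_def)
    have "fits 0 (label_at 0 sl) 0"
      using assms(3) by (simp add: at fits_append)
    moreover have "compatible (colours d) (sub_mod d) (i, 2, 2, \<lambda>n. if n = (2 :: nat) then merged else R' c)"
      unfolding compatible_def
    proof clarsimp
      fix a a' x x'
      assume w: "a \<in> words (colours d) 2" "a' \<in> words (colours d) 2" "x \<in> words (colours d) 2" "x' \<in> words (colours d) 2"
        and R: "R' c a x" "R' c a' x'"
      have "(p - q) mod int d = (p' - q') mod int d \<Longrightarrow> (p - p') mod int d = (q - q') mod int d" for p q p' q'
        by (simp add: mod_eq_dvd_iff algebra_simps)
      then have *: "sub_mod d p q = sub_mod d p' q' \<Longrightarrow> sub_mod d p p' = sub_mod d q q'" for p q p' q'
        unfolding sub_mod_def .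
      from w obtain p q p' q' u v u' v' where "a = [p, q]" "a' = [p', q']" "x = [u, v]" "x' = [u', v']"
        by (auto elim!: words_2E)
      then show "merged (map2 (sub_mod d) a a') (map2 (sub_mod d) x x')"
        using R assms(4) *[of p q p' q'] *[of p u p' u']
        by (auto simp: R'_def key_def merged_def vertical_def horizontal_def split: if_splits)
    qed
    ultimately have "colourings d (label_at 0 sl) \<le> colourings d (label_at 2 sl)"
      using compatible_constant_labels assms(1,2) at
      by (intro card_paths_fibre) (auto simp: sl_def)
    then show ?thesis by (simp only: at)
  qed
  have "paths (colours d) (pre @ (i, 2, 2, R) # post) [] \<subseteq> (\<Union>c\<in>colours d. paths (colours d) (pre @ (i, 2, 2, R' c) # post) [])"
    using assms(3)
  proof (rule paths_cover_slot)
    fix a x assume "a \<in> words (colours d) 2" "x \<in> words (colours d) 2" "R a x"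
    moreover from this have "key a x \<in> colours d"
      by (auto elim!: words_2E simp: key_def simp del: atLeastLessThan_iff intro!: sub_mod_colours)
    ultimately show "\<exists>c\<in>colours d. R' c a x" by (auto simp: R'_def)
  qed simp
  then have "colourings d (pre @ (i, 2, 2, R) # post) \<le>
      card (\<Union>c\<in>colours d. paths (colours d) (pre @ (i, 2, 2, R' c) # post) [])"
    by (intro card_mono) (auto simp: finite_paths)
  also have "\<dots> \<le> (\<Sum>c\<in>colours d. colourings d (pre @ (i, 2, 2, R' c) # post))"
    by (rule card_UN_le) simp
  also have "\<dots> \<le> (\<Sum>c\<in>colours d. colourings d (pre @ (i, 2, 2, merged) # post))"
    by (intro sum_mono le)
  finally show ?thesis by simp
qed

section \<open>Kauffman's dual states and the size of the Potts bracket product\<close>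

section \<open>A bound on the Potts model\<close>

text \<open>Some colouring is not \<open>merged\<close> at the slot. Fixing its value
  \<open>\<alpha>\<close> there allows a pointwise operation to single out one end of the crossing
  later.\<close>

lemma colourings_exceed_merged:
  assumes "fits 0 (pre @ (i, 2, 2, R) # post) 0" "colourings d (pre @ (i, 2, 2, merged) # post) < colourings d (pre @ (i, 2, 2, R) # post)"
    and "\<And>a x. R a x \<Longrightarrow> \<not> merged a x \<Longrightarrow> Q a x"
  obtains \<alpha> where "paths (colours d) (pre @ (i, 2, 2, \<lambda>a x. R a x \<and> Q a x \<and> a ! 0 = \<alpha>) # post) [] \<noteq> {}"
proof (rule ccontr)
  assume "\<not> thesis"
  with that have none: "paths (colours d) (pre @ (i, 2, 2, \<lambda>a x. R a x \<and> Q a x \<and> a ! 0 = \<alpha>) # post) [] = {}" for \<alpha>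
    by blast
  define R' where "R' k = (case k of None \<Rightarrow> merged | Some \<alpha> \<Rightarrow> (\<lambda>a x. R a x \<and> Q a x \<and> a ! 0 = \<alpha>))" for k :: "int option"
  have "paths (colours d) (pre @ (i, 2, 2, R) # post) [] \<subseteq> (\<Union>k\<in>UNIV. paths (colours d) (pre @ (i, 2, 2, R' k) # post) [])"
    using assms(1)
  proof (rule paths_cover_slot)
    fix a x :: "int list" assume "R a x"
    show "\<exists>k\<in>UNIV. R' k a x"
    proof (cases "merged a x")
      case True
      then show ?thesis by (intro bexI[of _ None]) (simp_all add: R'_def)
    next
      case False
      then show ?thesis using \<open>R a x\<close> assms(3) by (intro bexI[of _ "Some (a ! 0)"]) (simp_all add: R'_def)
    qed
  qed simp
  also have "\<dots> \<subseteq> paths (colours d) (pre @ (i, 2, 2, merged) # post) []"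
  proof (rule UN_least)
    fix k show "paths (colours d) (pre @ (i, 2, 2, R' k) # post) [] \<subseteq> paths (colours d) (pre @ (i, 2, 2, merged) # post) []"
      using none by (cases k) (simp_all add: R'_def)
  qed
  finally have "colourings d (pre @ (i, 2, 2, R) # post) \<le> colourings d (pre @ (i, 2, 2, merged) # post)"
    by (intro card_mono finite_paths) auto
  with assms(2) show False by simp
qed

text \<open>If both smoothings of a crossing disconnected the diagram, the product of the two
  colourings witnessing this would be supported on a component with a single end at the crossing.\<close>

lemma connected_smoothing:
  assumes "list_all smoothing pre" "list_all smoothing post" "fits 0 (pre @ (i, 2, 2, vertical) # post) 0"
    and "2 \<le> d" "colourings d (pre @ (i, 2, 2, merged) # post) \<le> d"
  shows "colourings d (pre @ (i, 2, 2, vertical) # post) \<le> d \<or> colourings d (pre @ (i, 2, 2, horizontal) # post) \<le> d"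
proof (rule ccontr)
  assume "\<not> ?thesis"
  then have gt: "colourings d (pre @ (i, 2, 2, merged) # post) < colourings d (pre @ (i, 2, 2, vertical) # post)"
    "colourings d (pre @ (i, 2, 2, merged) # post) < colourings d (pre @ (i, 2, 2, horizontal) # post)"
    using assms(5) by auto
  have f: "fits 0 (pre @ (i, 2, 2, R) # post) 0" for R :: "int rel"
    using assms(3) by (auto simp: fits_append)
  obtain \<alpha> where \<alpha>: "paths (colours d) (pre @ (i, 2, 2, \<lambda>a x. vertical a x \<and> a ! 0 \<noteq> a ! 1 \<and> a ! 0 = \<alpha>) # post) [] \<noteq> {}"
    using colourings_exceed_merged[OF f gt(1), of "\<lambda>a x. a ! 0 \<noteq> a ! 1"]
    by (auto simp: merged_def vertical_def horizontal_def)
  obtain \<beta> where \<beta>: "paths (colours d) (pre @ (i, 2, 2, \<lambda>a x. horizontal a x \<and> a ! 0 \<noteq> x ! 0 \<and> a ! 0 = \<beta>) # post) [] \<noteq> {}"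
    using colourings_exceed_merged[OF f gt(2), of "\<lambda>a x. a ! 0 \<noteq> x ! 0"]
    by (auto simp: merged_def vertical_def horizontal_def)
  \<comment> \<open>At the crossing the first colouring is \<open>\<alpha>\<close> on the left arc
    only, the second is \<open>\<beta>\<close> on the upper arc only. \<open>F\<close> detects the
    pair, so it is \<open>1\<close> at the upper left end alone, and the alternating sum of the
    window is \<open>1\<close> above and \<open>0\<close> below.\<close>
  define F where "F u v = (if u = \<alpha> \<and> v = \<beta> then 1 else 0 :: int)" for u v :: int
  define L where "L n = (if n = (0 :: nat) then (\<lambda>a x. vertical a x \<and> a ! 0 \<noteq> a ! 1 \<and> a ! 0 = \<alpha>)
     else if n = 1 then (\<lambda>a x. horizontal a x \<and> a ! 0 \<noteq> x ! 0 \<and> a ! 0 = \<beta>) else (\<lambda>a x. a = [1, 0] \<and> x = [0, 0 :: int]))" for n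
  define sl where "sl = constant_labels pre @ (i, 2, 2, L) # constant_labels post"
  have at: "label_at 0 sl = pre @ (i, 2, 2, \<lambda>a x. vertical a x \<and> a ! 0 \<noteq> a ! 1 \<and> a ! 0 = \<alpha>) # post"
    "label_at 1 sl = pre @ (i, 2, 2, \<lambda>a x. horizontal a x \<and> a ! 0 \<noteq> x ! 0 \<and> a ! 0 = \<beta>) # post"
    "label_at 2 sl = pre @ (i, 2, 2, \<lambda>a x. a = [1, 0] \<and> x = [0, 0 :: int]) # post"
    by (simp_all add: sl_def L_def)
  from \<alpha> \<beta> obtain \<rho> \<rho>' where \<rho>: "\<rho> \<in> paths (colours d) (label_at 0 sl) []" "\<rho>' \<in> paths (colours d) (label_at 1 sl) []"
    unfolding at by blast
  have slot: "compatible (colours d) F (i, 2, 2, L)"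
    unfolding compatible_def
  proof clarsimp
    fix a a' x x'
    assume w: "a \<in> words (colours d) 2" "a' \<in> words (colours d) 2" "x \<in> words (colours d) 2" "x' \<in> words (colours d) 2"
      and L: "L 0 a x" "L (Suc 0) a' x'"
    from w obtain p q p' q' u v u' v' where "a = [p, q]" "a' = [p', q']" "x = [u, v]" "x' = [u', v']"
      by (auto elim!: words_2E)
    with L show "L 2 (map2 F a a') (map2 F x x')"
      by (auto simp: L_def F_def vertical_def horizontal_def)
  qed
  have "map2 (map2 F) \<rho> \<rho>' \<in> paths (colours d) (label_at 2 sl) (map2 F [] [])"
  proof (rule paths_pointwise[OF _ _ _ \<rho>])
    show "fits 0 (label_at 0 sl) 0" unfolding at by (rule f)
    show "compatible (colours d) F s" if "s \<in> set sl" for s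
      using that slot
      by (auto simp only: sl_def set_append list.set Un_iff insert_iff empty_iff
          intro: compatible_constant_labels[OF assms(1)] compatible_constant_labels[OF assms(2)])
    show "F u v \<in> colours d" for u v using assms(4) by (simp add: F_def)
  qed simp_all
  moreover have "paths (colours d) (label_at 2 sl) [] = {}"
    unfolding at using assms(1,2) f by (rule paths_unbalanced_slot) auto
  ultimately show False by simp
qed

text \<open>Passing to \<open>merged\<close> costs a factor \<open>d\<close>, and going on to the
  other smoothing costs nothing. In terms of loops, a change of smoothing changes their number by at
  most one.\<close>

lemma colourings_swap:
  assumes "list_all smoothing pre" "list_all smoothing post" "fits 0 (pre @ (i, 2, 2, R) # post) 0"
    and "R \<in> {vertical, horizontal}" "R' \<in> {vertical, horizontal}"
  shows "colourings d (pre @ (i, 2, 2, R) # post) \<le> d * colourings d (pre @ (i, 2, 2, R') # post)"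
proof -
  have "colourings d (pre @ (i, 2, 2, R) # post) \<le> d * colourings d (pre @ (i, 2, 2, merged) # post)"
    using assms by (intro colourings_split_merged) auto
  moreover have "colourings d (pre @ (i, 2, 2, merged) # post) \<le> colourings d (pre @ (i, 2, 2, R') # post)"
    using assms(5) by (intro card_paths_mono_slot) (auto simp: merged_def)
  ultimately show ?thesis by (meson le_trans mult_le_mono2)
qed

text \<open>Read with \<open>d\<close> to the number of loops, this bounds the loops of two opposite
  states together by \<open>crossings D + 2\<close> when the shadow is connected. Each crossing is
  smoothed so that the shadow stays connected; this smoothing agrees with one of the two states, and
  correcting it in the other costs one factor \<open>d\<close>. The crossings already smoothed are
  in \<open>pre\<close>.\<close>

lemma kauffman_dual_states:
  fixes \<sigma> :: "bool \<Rightarrow> bool"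
  defines "v \<equiv> smoothed (\<lambda>s. if \<sigma> s then vertical else horizontal)"
    and "h \<equiv> smoothed (\<lambda>s. if \<sigma> s then horizontal else vertical)"
  assumes "2 \<le> d" "list_all smoothing pre" "fits 0 (pre @ slices (smoothed (\<lambda>_. merged)) D) 0"
    and "colourings d (pre @ slices (smoothed (\<lambda>_. merged)) D) \<le> d"
  shows "colourings d (pre @ slices v D) * colourings d (pre @ slices h D) \<le> d ^ (crossings D + 2)"
  using assms(4-)
proof (induction D arbitrary: pre)
  case Nil
  then have "colourings d pre * colourings d pre \<le> d * d"
    by (intro mult_mono) auto
  then show ?case by (simp add: crossings_def power2_eq_square)
next
  case (Cons q D)
  obtain i p where q: "q = (i, p)" by (cases q)
  show ?case
  proof (cases "\<exists>s. p = Cross s")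
    case False
    let ?s = "(i, top_ends p, bottom_ends p, flip_rel p)"
    have eq: "smoothed \<tau> p = flip_rel p" for \<tau> :: "bool \<Rightarrow> int rel" using False by (cases p) auto
    have sm: "smoothing ?s" using False smoothing_simps(1,2) by (cases p) auto
    have "colourings d ((pre @ [?s]) @ slices v D) * colourings d ((pre @ [?s]) @ slices h D) \<le> d ^ (crossings D + 2)"
      using Cons.prems sm by (intro Cons.IH) (simp_all add: q eq)
    then show ?thesis using False by (simp add: q eq v_def h_def crossings_def)
  next
    case True
    then obtain s where p: "p = Cross s" by blast
    let ?post = "\<lambda>R. slices (smoothed R) D"
    define c where "c R P = colourings d (pre @ (i, 2, 2, R) # slices P D)" for R :: "int rel" and P
    have prems: "fits 0 (pre @ (i, 2, 2, R) # slices P D) 0" for R :: "int rel" and P :: "piece \<Rightarrow> int rel"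
      using Cons.prems by (auto simp: fits_append q p)
    have sm: "list_all smoothing (?post R)" if "\<And>s. R s \<in> {vertical, horizontal, merged}" for R
      using that by (rule smoothing_smoothed)
    have vh: "list_all smoothing (slices v D)" "list_all smoothing (slices h D)"
      unfolding v_def h_def by (rule sm; simp)+
    have swap: "c R P \<le> d * c R' P" if "R \<in> {vertical, horizontal}" "R' \<in> {vertical, horizontal}" "P = v \<or> P = h" for R R' P
      unfolding c_def using Cons.prems(1) vh that prems by (intro colourings_swap) auto
    have "c merged (smoothed (\<lambda>_. merged)) \<le> d"
      using Cons.prems(3) by (simp add: c_def q p)
    then have "c vertical (smoothed (\<lambda>_. merged)) \<le> d \<or> c horizontal (smoothed (\<lambda>_. merged)) \<le> d"
      unfolding c_def using Cons.prems(1) assms(3) prems sm by (intro connected_smoothing) auto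
    then obtain R where R: "R \<in> {vertical, horizontal}" "c R (smoothed (\<lambda>_. merged)) \<le> d" by auto
    have "list_all smoothing (pre @ [(i, 2, 2, R)])"
      using Cons.prems(1) R(1) smoothing_simps(3,4) by auto
    then have IH: "c R v * c R h \<le> d ^ (crossings D + 2)"
      using Cons.IH[of "pre @ [(i, 2, 2, R)]"] R(2) prems by (simp add: c_def)
    define R1 where "R1 = (if \<sigma> s then vertical else horizontal :: int rel)"
    define R2 where "R2 = (if \<sigma> s then horizontal else vertical :: int rel)"
    have "R1 \<in> {vertical, horizontal}" "R2 \<in> {vertical, horizontal}" "R = R1 \<or> R = R2"
      using R(1) by (auto simp: R1_def R2_def)
    then have "c R1 v * c R2 h \<le> d * (c R v * c R h)"
      using swap[of R1 R v] swap[of R2 R h] R(1) by (auto simp: mult.left_commute mult.assoc intro!: mult_le_mono1 mult_le_mono2 dest: mult_le_mono1[where k = "c R h"] mult_le_mono2[where k = "c R v"])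
    also have "\<dots> \<le> d * d ^ (crossings D + 2)"
      using IH by simp
    finally show ?thesis
      by (simp add: q p c_def v_def h_def R1_def R2_def crossings_def)
  qed
qed

lemma transfer_split_slot:
  assumes "fits m (pre @ (i, t, b, W) # post) n" "y \<in> words S m"
    and "\<And>a x. a \<in> words S t \<Longrightarrow> x \<in> words S b \<Longrightarrow> W a x = W1 a x + c * W2 a x"
  shows "transfer S (pre @ (i, t, b, W) # post) g y =
    transfer S (pre @ (i, t, b, W1) # post) g y + c * transfer S (pre @ (i, t, b, W2) # post) g y"
proof -
  obtain k where k: "fits m pre k" "i + t \<le> k" using assms(1) by (auto simp: fits_append)
  have "transfer S (pre @ (i, t, b, W) # post) g y =
    transfer S pre (\<lambda>z. transfer S ((i, t, b, W1) # post) g z + c * transfer S ((i, t, b, W2) # post) g z) y"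
    unfolding transfer_append
  proof (rule transfer_cong[OF k(1) assms(2)])
    fix z assume "z \<in> words S k"
    then have "take t (drop i z) \<in> words S t" using k(2) by (rule window_words)
    then have "W (take t (drop i z)) x = W1 (take t (drop i z)) x + c * W2 (take t (drop i z)) x" if "x \<in> words S b" for x
      using that by (rule assms(3))
    then show "transfer S ((i, t, b, W) # post) g z =
        transfer S ((i, t, b, W1) # post) g z + c * transfer S ((i, t, b, W2) # post) g z"
      by (simp add: sum_distrib_left sum.distrib algebra_simps)
  qed
  also have "\<dots> = transfer S (pre @ (i, t, b, W1) # post) g y + c * transfer S (pre @ (i, t, b, W2) # post) g y"
    by (simp only: transfer_add transfer_scale transfer_append)
  finally show ?thesis .
qed

fun crossing_product :: "(bool \<Rightarrow> real) \<Rightarrow> diagram \<Rightarrow> real" where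
  "crossing_product f [] = 1"
| "crossing_product f ((i, Cross s) # D) = f s * crossing_product f D"
| "crossing_product f ((i, p) # D) = crossing_product f D"

lemma crossings_simps [simp]:
  "crossings [] = 0" "crossings ((i, Cap) # D) = crossings D" "crossings ((i, Cup) # D) = crossings D"
  "crossings ((i, Cross s) # D) = Suc (crossings D)" "crossings (D @ D') = crossings D + crossings D'"
  by (simp_all add: crossings_def)

lemma crossing_product_mult:
  "crossing_product f D * crossing_product f' D = crossing_product (\<lambda>s. f s * f' s) D"
  by (induction f D rule: crossing_product.induct) (simp_all add: mult_ac)

lemma crossing_product_const: "crossing_product (\<lambda>_. c) D = c ^ crossings D"
  by (induction "\<lambda>_ :: bool. c" D rule: crossing_product.induct) simp_all

lemma crossing_product_nonneg: "(\<And>s. 0 \<le> f s) \<Longrightarrow> 0 \<le> crossing_product f D"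
  by (induction f D rule: crossing_product.induct) simp_all

abbreviation kronecker :: "int \<Rightarrow> int \<Rightarrow> real" where
  "kronecker u v \<equiv> of_bool (u = v)"

lemma fits_indicators [simp]: "fits m (indicators sl) n = fits m sl n"
  by (induction m sl n rule: fits.induct) simp_all

lemma closed_sum_colourings:
  "closed_sum (colours d) (indicators sl) = real (colourings d sl)"
  using transfer_indicators[of "colours d" sl "[]", where 'r = real] by simp

text \<open>At each crossing both smoothings are compared with the one selected by
  \<open>\<sigma>\<close>: the other has at most \<open>d\<close> times as many colourings. This
  gives the factor \<open>1 + \<bar>\<kappa> s\<bar> * d\<close> when the vertical one is selected
  and \<open>d + \<bar>\<kappa> s\<bar>\<close> otherwise.\<close>

lemma bracket_state_bound:
  assumes f: "\<And>s. 0 \<le> f s" and v: "\<And>s. \<sigma> s \<Longrightarrow> 1 + \<bar>\<kappa> s\<bar> * real d \<le> f s"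
    and h: "\<And>s. \<not> \<sigma> s \<Longrightarrow> real d + \<bar>\<kappa> s\<bar> \<le> f s"
    and "list_all smoothing pre" "fits 0 pre k" "tangle k D 0"
  shows "\<bar>closed_sum (colours d) (indicators pre @ slices (tl_weight kronecker kronecker \<kappa>) D)\<bar>
    \<le> crossing_product f D * real (colourings d (pre @ slices (smoothed (\<lambda>s. if \<sigma> s then vertical else horizontal)) D))"
  using assms(4-)
proof (induction D arbitrary: pre k)
  case Nil
  then show ?case by (simp add: closed_sum_colourings)
next
  case (Cons q D)
  let ?S = "colours d" and ?W = "tl_weight kronecker kronecker \<kappa>"
  let ?R = "\<lambda>s. if \<sigma> s then vertical else horizontal :: int rel"
  obtain i p where q: "q = (i, p)" by (cases q)
  show ?case
  proof (cases "\<exists>s. p = Cross s")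
    case False
    let ?s = "(i, top_ends p, bottom_ends p, flip_rel p)"
    have eq: "?W p = (\<lambda>a x. of_bool (flip_rel p a x))" "smoothed ?R p = flip_rel p" "smoothing ?s"
      using False smoothing_simps(1,2) by (cases p; auto intro!: ext)+
    have "fits 0 (pre @ [?s]) (k - top_ends p + bottom_ends p)" "tangle (k - top_ends p + bottom_ends p) D 0"
      using Cons.prems(2,3) unfolding q by (auto simp: fits_append)
    then have "\<bar>closed_sum ?S (indicators (pre @ [?s]) @ slices ?W D)\<bar>
      \<le> crossing_product f D * real (colourings d ((pre @ [?s]) @ slices (smoothed ?R) D))"
      using Cons.prems eq(3) by (intro Cons.IH) auto
    moreover have "crossing_product f (q # D) = crossing_product f D"
      using False q by (cases p) auto
    ultimately show ?thesis by (simp add: q eq)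
  next
    case True
    then obtain s where p: "p = Cross s" by blast
    define J where "J R = closed_sum ?S (indicators pre @ (i, 2, 2, \<lambda>a x. of_bool (R a x)) # slices ?W D)" for R :: "int rel"
    define N where "N R = real (colourings d (pre @ (i, 2, 2, R) # slices (smoothed ?R) D))" for R
    have k: "i + 2 \<le> k" "tangle (k - 2 + 2) D 0" "tangle k D 0"
      using Cons.prems(3) le_add_diff_inverse2[of 2 k] by (auto simp: q p simp del: add_2_eq_Suc')
    have post: "list_all smoothing (slices (smoothed ?R) D)" by (rule smoothing_smoothed) simp
    have fit: "fits 0 (pre @ (i, 2, 2, R) # slices (smoothed ?R) D) 0" for R
      using Cons.prems(2) k by (auto simp: fits_append)
    have swap: "N R \<le> real d * N R'" if "R \<in> {vertical, horizontal}" "R' \<in> {vertical, horizontal}" for R R'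
      unfolding N_def of_nat_mult[symmetric] of_nat_le_iff
      by (rule colourings_swap[OF Cons.prems(1) post fit that])
    have bound: "\<bar>J R\<bar> \<le> crossing_product f D * N R" if "R \<in> {vertical, horizontal}" for R
    proof -
      have "list_all smoothing (pre @ [(i, 2, 2, R)])"
        using Cons.prems(1) that smoothing_simps(3,4) by auto
      moreover have "fits 0 (pre @ [(i, 2, 2, R)]) k"
        using Cons.prems(2) k by (auto simp: fits_append)
      ultimately show ?thesis
        using Cons.IH[of "pre @ [(i, 2, 2, R)]"] k(3) by (simp add: J_def N_def)
    qed
    have "closed_sum ?S (indicators pre @ slices ?W (q # D)) = J vertical + \<kappa> s * J horizontal"
      unfolding J_def slices_simps q p top_ends.simps bottom_ends.simps
    proof (rule transfer_split_slot[where m = 0 and n = 0])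
      show "fits 0 (indicators pre @ (i, 2, 2, ?W (Cross s)) # slices ?W D) 0"
        using Cons.prems(2) k by (auto simp: fits_append)
      fix a x assume "a \<in> words ?S 2" "x \<in> words ?S 2"
      then show "?W (Cross s) a x = of_bool (vertical a x) + \<kappa> s * of_bool (horizontal a x)"
        by (auto elim!: words_2E simp: vertical_def horizontal_def)
    qed simp
    then have "\<bar>closed_sum ?S (indicators pre @ slices ?W (q # D))\<bar> \<le> \<bar>J vertical\<bar> + \<bar>\<kappa> s\<bar> * \<bar>J horizontal\<bar>"
      by (metis abs_mult abs_triangle_ineq)
    also have "\<dots> \<le> crossing_product f D * N vertical + \<bar>\<kappa> s\<bar> * (crossing_product f D * N horizontal)"
      using bound by (intro add_mono mult_left_mono) auto
    also have "\<dots> = crossing_product f D * (N vertical + \<bar>\<kappa> s\<bar> * N horizontal)"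
      by (simp add: algebra_simps)
    also have "\<dots> \<le> crossing_product f D * (f s * N (?R s))"
    proof (rule mult_left_mono)
      have N0: "0 \<le> N R" for R by (simp add: N_def)
      show "N vertical + \<bar>\<kappa> s\<bar> * N horizontal \<le> f s * N (?R s)"
      proof (cases "\<sigma> s")
        case True
        have "N vertical + \<bar>\<kappa> s\<bar> * N horizontal \<le> N vertical + \<bar>\<kappa> s\<bar> * (real d * N vertical)"
          using swap[of horizontal vertical] by (intro add_left_mono mult_left_mono) auto
        also have "\<dots> = (1 + \<bar>\<kappa> s\<bar> * real d) * N vertical" by (simp add: algebra_simps)
        also have "\<dots> \<le> f s * N vertical" using v[OF True] N0 by (rule mult_right_mono)
        finally show ?thesis using True by simp
      next
        case False
        have "N vertical + \<bar>\<kappa> s\<bar> * N horizontal \<le> real d * N horizontal + \<bar>\<kappa> s\<bar> * N horizontal"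
          using swap[of vertical horizontal] by (intro add_right_mono) auto
        also have "\<dots> = (real d + \<bar>\<kappa> s\<bar>) * N horizontal" by (simp add: algebra_simps)
        also have "\<dots> \<le> f s * N horizontal" using h[OF False] N0 by (rule mult_right_mono)
        finally show ?thesis using False by simp
      qed
      show "0 \<le> crossing_product f D" using f by (rule crossing_product_nonneg)
    qed
    finally show ?thesis by (simp add: q p N_def mult_ac)
  qed
qed

lemma flip_paths_merged: "paths S (slices (smoothed (\<lambda>_. merged)) D) y \<subseteq> paths S (slices flip_rel D) y"
proof (induction D arbitrary: y)
  case (Cons q D)
  obtain i p where q: "q = (i, p)" by (cases q)
  have "smoothed (\<lambda>_. merged) p a x \<Longrightarrow> flip_rel p a x" for a x :: "'a list"
    by (cases p) (auto simp: merged_def vertical_def horizontal_def)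
  then show ?case using Cons unfolding q slices_simps paths.simps by blast
qed simp

text \<open>With \<open>d\<close> colours and Kronecker weights a diagram without crossings counts the colourings
  of its components, so \<open>d = q + 1 / q\<close> is the value of a loop.\<close>

definition potts_coefficient :: "real \<Rightarrow> bool \<Rightarrow> real" where
  "potts_coefficient q s = (if s then - 1 / q else - q)"

abbreviation potts_product :: "nat \<Rightarrow> real \<Rightarrow> diagram \<Rightarrow> real" where
  "potts_product d q \<equiv> bracket_product (colours d) kronecker kronecker (potts_coefficient q)"

lemma potts_model:
  assumes "0 < q" "real d = q + 1 / q"
  shows "tl_model (colours d) kronecker kronecker (potts_coefficient q)"
proof
  have *: "(\<Sum>b\<in>colours d. kronecker a b * kronecker b c) = of_bool (a = c)" if "a \<in> colours d" for a c
    using that by (subst sum.remove[of _ a]) (auto intro!: sum.neutral)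
  show "(\<Sum>b\<in>colours d. kronecker a b * kronecker b c) = of_bool (a = c)" if "a \<in> colours d" "c \<in> colours d" for a c
    using that(1) by (rule *)
  have "(\<Sum>b\<in>colours d. kronecker a b * kronecker a b) = 1" if "a \<in> colours d" for a
    using that by (subst sum.remove[of _ a]) (auto intro!: sum.neutral)
  then show "(\<Sum>a\<in>colours d. \<Sum>b\<in>colours d. kronecker a b * kronecker a b) =
      - (potts_coefficient q True + potts_coefficient q False)"
    using assms by (simp add: potts_coefficient_def)
qed (use assms in \<open>simp_all add: potts_coefficient_def\<close>)

text \<open>The selected state is vertical where the coefficient is \<open>- 1 / q\<close> and
  horizontal where it is \<open>- q\<close>. By \<open>d \<le> 2 * q\<close> the factors are at most
  \<open>3\<close> and \<open>3 * q\<close>. In the second bracket they are exchanged, so each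
  crossing costs \<open>9 * q\<close>, and the selected state is the opposite one, so that
  \<open>kauffman_dual_states\<close> applies.\<close>

lemma potts_product_bound:
  assumes D: "knot_diagram D" and q: "1 \<le> q" "real d = q + 1 / q"
  shows "\<bar>potts_product d q D\<bar> \<le> (9 * q) ^ crossings D * (2 * q) ^ (crossings D + 2)"
proof -
  let ?\<kappa> = "potts_coefficient q"
  let ?v = "smoothed (\<lambda>s. if s then vertical else horizontal) :: piece \<Rightarrow> int rel"
  let ?h = "smoothed (\<lambda>s. if s then horizontal else vertical) :: piece \<Rightarrow> int rel"
  have "1 / q \<le> q" using q(1) by (simp add: divide_le_eq) (metis mult_mono' mult_1 order_trans zero_le_one)
  then have d: "real d \<le> 2 * q" "2 \<le> d"
  proof -
    show "real d \<le> 2 * q" using \<open>1 / q \<le> q\<close> q(2) by simp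
    have "0 \<le> (q - 1)\<^sup>2 / q" using q(1) by simp
    also have "\<dots> = q + 1 / q - 2" using q(1) by (simp add: field_simps power2_eq_square)
    finally show "2 \<le> d" using q(2) by simp
  qed
  have T: "tangle 0 D 0" using D by (simp add: knot_diagram_def link_diagram_def)
  have dq: "real d / q \<le> 2" using d q(1) by (simp add: field_simps)
  have "\<bar>bracket (colours d) kronecker kronecker ?\<kappa> D\<bar>
      \<le> crossing_product (\<lambda>s. if s then 3 else 3 * q) D * real (colourings d ([] @ slices ?v D))"
    unfolding bracket_def
    using bracket_state_bound[of "\<lambda>s. if s then 3 else 3 * q" "\<lambda>s. s" ?\<kappa> d "[]" 0 D] d dq q T
    by (simp add: potts_coefficient_def)
  moreover have if_neg: "(\<lambda>s. if \<not> s then vertical else horizontal) = (\<lambda>s. if s then horizontal else vertical :: int rel)"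
    by auto
  have "\<bar>bracket (colours d) kronecker kronecker (\<lambda>s. ?\<kappa> (\<not> s)) D\<bar>
      \<le> crossing_product (\<lambda>s. if s then 3 * q else 3) D * real (colourings d ([] @ slices ?h D))"
    unfolding bracket_def
    using bracket_state_bound[of "\<lambda>s. if s then 3 * q else 3" "\<lambda>s. \<not> s" "\<lambda>s. ?\<kappa> (\<not> s)" d "[]" 0 D] d dq q T
    by (simp add: potts_coefficient_def if_distrib[of "\<lambda>R. smoothed R"] if_neg cong: if_cong)
  ultimately have "\<bar>potts_product d q D\<bar> \<le>
      (crossing_product (\<lambda>s. if s then 3 else 3 * q) D * real (colourings d ([] @ slices ?v D))) *
      (crossing_product (\<lambda>s. if s then 3 * q else 3) D * real (colourings d ([] @ slices ?h D)))"
    unfolding bracket_product_def abs_mult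
    using q(1) by (intro mult_mono) (auto intro!: mult_nonneg_nonneg crossing_product_nonneg)
  also have "\<dots> = (crossing_product (\<lambda>s. if s then 3 else 3 * q) D * crossing_product (\<lambda>s. if s then 3 * q else 3) D) *
      real (colourings d ([] @ slices ?v D) * colourings d ([] @ slices ?h D))"
    by simp
  also have "crossing_product (\<lambda>s. if s then 3 else 3 * q) D * crossing_product (\<lambda>s. if s then 3 * q else 3) D =
      crossing_product (\<lambda>_. 9 * q) D"
    unfolding crossing_product_mult by (rule arg_cong[where f = "\<lambda>f. crossing_product f D"]) auto
  also have "\<dots> = (9 * q) ^ crossings D" by (rule crossing_product_const)
  also have "colourings d ([] @ slices ?v D) * colourings d ([] @ slices ?h D) \<le> d ^ (crossings D + 2)"
  proof (rule kauffman_dual_states[OF d(2)])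
    show "fits 0 ([] @ slices (smoothed (\<lambda>_. merged)) D) 0" using T by simp
    have "colourings d ([] @ slices (smoothed (\<lambda>_. merged)) D) \<le> colourings d (slices flip_rel D)"
      by (simp add: card_mono finite_paths flip_paths_merged)
    also have "\<dots> \<le> d" using card_flip_paths_knot[OF D, of "colours d"] by simp
    finally show "colourings d ([] @ slices (smoothed (\<lambda>_. merged)) D) \<le> d" .
  qed simp
  then have "(9 * q) ^ crossings D * real (colourings d ([] @ slices ?v D) * colourings d ([] @ slices ?h D)) \<le>
      (9 * q) ^ crossings D * real d ^ (crossings D + 2)"
    using q(1) by (intro mult_left_mono) (metis of_nat_le_iff of_nat_power, simp)
  also have "\<dots> \<le> (9 * q) ^ crossings D * (2 * q) ^ (crossings D + 2)"
    using q(1) d by (intro mult_left_mono power_mono) auto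
  finally show ?thesis .
qed

section \<open>Pretzel diagrams\<close>

definition pretzel_caps :: "nat \<Rightarrow> diagram" where
  "pretzel_caps m = (0, Cap) # map (\<lambda>i. (2 * i + 1, Cap)) [0..<m - 1]"

definition pretzel_cups :: "nat \<Rightarrow> diagram" where
  "pretzel_cups m = map (\<lambda>i. (2 * i + 1, Cup)) (rev [0..<m - 1]) @ [(0, Cup)]"

definition pretzel_columns :: "bool \<Rightarrow> nat list \<Rightarrow> diagram" where
  "pretzel_columns s ps = concat (map (\<lambda>i. replicate (ps ! i) (2 * i, Cross s)) [0..<length ps])"

definition signed_pretzel :: "bool \<Rightarrow> nat list \<Rightarrow> diagram" where
  "signed_pretzel s ps = pretzel_caps (length ps) @ pretzel_columns s ps @ pretzel_cups (length ps)"

lemma pretzel_caps_Suc: "pretzel_caps (Suc (Suc k)) = pretzel_caps (Suc k) @ [(2 * k + 1, Cap)]"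
  by (simp add: pretzel_caps_def)

lemma pretzel_cups_Suc: "pretzel_cups (Suc (Suc k)) = (2 * k + 1, Cup) # pretzel_cups (Suc k)"
  by (simp add: pretzel_cups_def)

lemma pretzel_caps_cups_1 [simp]:
  "pretzel_caps (Suc 0) = [(0, Cap)]" "pretzel_cups (Suc 0) = [(0, Cup)]"
  by (simp_all add: pretzel_caps_def pretzel_cups_def)

lemma pretzel_columns_Nil [simp]: "pretzel_columns s [] = []"
  by (simp add: pretzel_columns_def)

lemma pretzel_columns_snoc:
  "pretzel_columns s (ps @ [p]) = pretzel_columns s ps @ replicate p (2 * length ps, Cross s)"
proof -
  have "map (\<lambda>i. replicate ((ps @ [p]) ! i) (2 * i, Cross s)) [0..<length ps] =
    map (\<lambda>i. replicate (ps ! i) (2 * i, Cross s)) [0..<length ps]"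
    by (intro map_cong) (auto simp: nth_append)
  then have "concat (map (\<lambda>i. replicate ((ps @ [p]) ! i) (2 * i, Cross s)) [0..<length ps]) =
    concat (map (\<lambda>i. replicate (ps ! i) (2 * i, Cross s)) [0..<length ps])"
    by (rule arg_cong)
  then show ?thesis by (simp add: pretzel_columns_def)
qed

lemma tangle_pretzel_caps: "tangle 0 (pretzel_caps (Suc k)) (2 * k + 2)"
proof (induction k)
  case (Suc k)
  then show ?case unfolding pretzel_caps_Suc tangle_append by (intro exI[of _ "2 * k + 2"]) simp
qed simp

lemma pretzel_columns_bound:
  assumes "(j, q) \<in> set (pretzel_columns s ps)"
  shows "j + 2 \<le> 2 * length ps \<and> q = Cross s"
  using assms by (auto simp: pretzel_columns_def split: if_splits)

lemma tangle_crosses: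
  assumes "\<And>j q. (j, q) \<in> set X \<Longrightarrow> j + 2 \<le> w \<and> (\<exists>s. q = Cross s)"
  shows "tangle w X w"
  using assms
proof (induction X)
  case (Cons x X)
  obtain j s where x: "x = (j, Cross s)" "j + 2 \<le> w" using Cons.prems[of "fst x" "snd x"] by (cases x) auto
  then have "w - 2 + 2 = w" by simp
  moreover have "tangle w X w" using Cons.prems by (intro Cons.IH) auto
  ultimately show ?case using x by (simp del: add_2_eq_Suc')
qed simp

lemma tangle_pretzel_columns:
  "2 * length ps \<le> w \<Longrightarrow> tangle w (pretzel_columns s ps) w"
  using pretzel_columns_bound[of _ _ s ps] by (intro tangle_crosses) fastforce

section \<open>The Kauffman bracket of a pretzel diagram in closed form\<close>

context tl_model
begin

text \<open>In the Temperley-Lieb algebra \<open>p\<close> equal crossings in a column are the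
  identity plus \<open>column s p\<close> times a minimum followed by a maximum.\<close>

fun column :: "bool \<Rightarrow> nat \<Rightarrow> 'r" where
  "column s 0 = 0"
| "column s (Suc p) = column s p + \<kappa> s * (1 + column s p * \<delta>)"

lemma column_expand:
  assumes "y \<in> words S m" "tangle m u k" "i + 2 \<le> k"
  shows "P (u @ replicate p (i, Cross s) @ v) g y =
    P (u @ v) g y + column s p * P (u @ (i, Cup) # (i, Cap) # v) g y"
  using assms(2)
proof (induction p arbitrary: u)
  case (Suc p)
  have k: "k - 2 + 2 = k" using assms(3) by simp
  have E: "tangle m (u @ [(i, Cup), (i, Cap)]) k" "tangle m (u @ [(i, Cup)]) (k - 2)"
    using Suc.prems assms(3) k by (auto simp: tangle_append simp del: add_2_eq_Suc')
  have loop: "P (u @ (i, Cup) # (i, Cap) # (i, Cup) # (i, Cap) # v) g y =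
      \<delta> * P (u @ (i, Cup) # (i, Cap) # v) g y"
    using loop_in[OF assms(1) E(2), of i "(i, Cap) # v" g] assms(3) by simp
  have "P (u @ replicate (Suc p) (i, Cross s) @ v) g y =
     P (u @ replicate p (i, Cross s) @ v) g y +
     \<kappa> s * P ((u @ [(i, Cup), (i, Cap)]) @ replicate p (i, Cross s) @ v) g y"
    using cross_expand[OF assms(1) Suc.prems assms(3), of s "replicate p (i, Cross s) @ v" g] by simp
  also have "\<dots> = P (u @ v) g y + column s (Suc p) * P (u @ (i, Cup) # (i, Cap) # v) g y"
    unfolding Suc.IH[OF Suc.prems] Suc.IH[OF E(1)] using loop by (simp add: algebra_simps)
  finally show ?case .
qed simp

lemma commute_crosses:
  assumes "y \<in> words S m" "tangle m u w" "i + top_ends q \<le> w"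
    and "\<And>j p. (j, p) \<in> set X \<Longrightarrow> j + 2 \<le> i \<and> (\<exists>s. p = Cross s)"
  shows "P (u @ X @ (i, q) # v) g y = P (u @ (i, q) # X @ v) g y"
  using assms(2,4)
proof (induction X arbitrary: u)
  case (Cons x X)
  obtain j s where x: "x = (j, Cross s)" "j + 2 \<le> i" using Cons.prems(2)[of "fst x" "snd x"] by (cases x) auto
  then obtain k where k: "i = j + 2 + k" using le_Suc_ex by blast
  have "w - 2 + 2 = w" using x k assms(3) by simp
  then have "tangle m (u @ [(j, Cross s)]) w"
    using Cons.prems(1) x assms(3) by (auto simp: tangle_append simp del: add_2_eq_Suc')
  then have "P (u @ (x # X) @ (i, q) # v) g y = P (u @ [(j, Cross s), (i, q)] @ X @ v) g y"
    using Cons.IH[of "u @ [(j, Cross s)]", OF _ Cons.prems(2)] by (simp add: x)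
  also have "\<dots> = 1 * P (u @ [(i, q), (j, Cross s)] @ X @ v) g y"
  proof (rule P_replace[OF assms(1) Cons.prems(1)])
    fix g z assume z: "z \<in> words S w"
    have "j + 2 + k + top_ends q \<le> w" using assms(3) k by simp
    then have "P [(j, Cross s), (j + 2 + k, q)] g z = P [(j + 2 + k, q), (j, Cross s)] g z"
      unfolding P_def slices_simps top_ends.simps bottom_ends.simps by (rule transfer_exchange[OF z])
    then show "P [(j, Cross s), (i, q)] g z = 1 * P [(i, q), (j, Cross s)] g z"
      by (simp add: k)
  qed
  finally show ?case by (simp add: x)
qed simp

text \<open>An additional column without crossings, that is a pretzel entry \<open>0\<close>, stands
  at the right. It breaks the cycle of columns, so the bracket becomes a product over the
  columns.\<close>

definition open_pretzel :: "bool \<Rightarrow> nat list \<Rightarrow> 'r" where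
  "open_pretzel s ps = bracket S M N \<kappa> (pretzel_caps (Suc (length ps)) @ pretzel_columns s ps @ pretzel_cups (Suc (length ps)))"

text \<open>Without its crossings the new column leaves a separate loop; replaced by a minimum and a
  maximum it becomes two zigzags.\<close>

lemma open_pretzel_snoc: "open_pretzel s (ps @ [p]) = (\<delta> + column s p) * open_pretzel s ps"
proof -
  let ?k = "length ps"
  let ?C = "pretzel_columns s ps" and ?a = "pretzel_caps (Suc ?k)" and ?u = "pretzel_cups (Suc ?k)"
  let ?Q = "\<lambda>D. P D (\<lambda>_. 1) []"
  have y: "[] \<in> words S 0" by simp
  have cols: "j + 2 \<le> i \<and> (\<exists>s. q = Cross s)" if "(j, q) \<in> set ?C" "2 * ?k \<le> i" for i j q
    using pretzel_columns_bound[OF that(1)] that(2) by auto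
  have Ta: "tangle 0 ?a (2 * ?k + 2)" by (rule tangle_pretzel_caps)
  have Tac: "tangle 0 (?a @ ?C) (2 * ?k + 2)"
    using Ta tangle_pretzel_columns[of ps "2 * ?k + 2" s] by (auto simp: tangle_append)
  have Tb: "tangle 0 (?a @ [(2 * ?k + 1, Cap)]) (2 * ?k + 4)" using Ta by (auto simp: tangle_append)
  have Tbc: "tangle 0 ((?a @ [(2 * ?k + 1, Cap)]) @ ?C) (2 * ?k + 4)"
    using Tb tangle_pretzel_columns[of ps "2 * ?k + 4" s] by (subst tangle_append) auto
  have "open_pretzel s (ps @ [p]) = ?Q (((?a @ [(2 * ?k + 1, Cap)]) @ ?C) @ replicate p (2 * ?k, Cross s) @ (2 * ?k + 1, Cup) # ?u)"
    by (simp add: open_pretzel_def bracket_P pretzel_caps_Suc pretzel_cups_Suc pretzel_columns_snoc)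
  also have "\<dots> = ?Q ((?a @ [(2 * ?k + 1, Cap)]) @ ?C @ (2 * ?k + 1, Cup) # ?u) +
      column s p * ?Q ((?a @ [(2 * ?k + 1, Cap)]) @ ?C @ (2 * ?k, Cup) # (2 * ?k, Cap) # (2 * ?k + 1, Cup) # ?u)"
    using column_expand[OF y Tbc, of "2 * ?k" p s "(2 * ?k + 1, Cup) # ?u" "\<lambda>_. 1"] by simp
  also have "?Q ((?a @ [(2 * ?k + 1, Cap)]) @ ?C @ (2 * ?k + 1, Cup) # ?u) =
      ?Q ((?a @ [(2 * ?k + 1, Cap)]) @ (2 * ?k + 1, Cup) # ?C @ ?u)"
    by (rule commute_crosses[OF y Tb]) (use cols[of _ _ "2 * ?k + 1"] in auto)
  also have "\<dots> = \<delta> * ?Q (?a @ ?C @ ?u)"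
    using loop_in[OF y Ta, of "2 * ?k + 1" "?C @ ?u" "\<lambda>_. 1"] by simp
  also have "?Q ((?a @ [(2 * ?k + 1, Cap)]) @ ?C @ (2 * ?k, Cup) # (2 * ?k, Cap) # (2 * ?k + 1, Cup) # ?u) =
      ?Q ((?a @ [(2 * ?k + 1, Cap)]) @ (2 * ?k, Cup) # ?C @ (2 * ?k, Cap) # (2 * ?k + 1, Cup) # ?u)"
    by (rule commute_crosses[OF y Tb]) (use cols in auto)
  also have "\<dots> = ?Q (?a @ ?C @ (2 * ?k, Cap) # (2 * ?k + 1, Cup) # ?u)"
    using zigzag_in(2)[OF y Ta, of "2 * ?k" _ "\<lambda>_. 1"] by simp
  also have "\<dots> = ?Q (?a @ ?C @ ?u)"
    using zigzag_in(1)[OF y Tac, of "2 * ?k" ?u "\<lambda>_. 1"] by simp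
  finally show ?thesis
    by (simp add: open_pretzel_def bracket_P algebra_simps)
qed

text \<open>Expanding the last column leaves either an entry \<open>0\<close>, hence
  \<open>open_pretzel s ps\<close>, or two zigzags, hence the pretzel without that column.\<close>

lemma bracket_pretzel_snoc:
  assumes "ps \<noteq> []"
  shows "bracket S M N \<kappa> (signed_pretzel s (ps @ [p])) =
    open_pretzel s ps + column s p * bracket S M N \<kappa> (signed_pretzel s ps)"
proof -
  obtain k where k: "length ps = Suc k" using assms by (cases ps) auto
  let ?C = "pretzel_columns s ps" and ?a = "pretzel_caps (Suc k)" and ?u = "pretzel_cups (Suc k)"
  let ?Q = "\<lambda>D. P D (\<lambda>_. 1) []"
  have y: "[] \<in> words S 0" by simp
  have cols: "j + 2 \<le> i \<and> (\<exists>s. q = Cross s)" if "(j, q) \<in> set ?C" "2 * k + 2 \<le> i" for i j q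
    using pretzel_columns_bound[OF that(1)] that(2) k by auto
  have Ta: "tangle 0 ?a (2 * k + 2)" by (rule tangle_pretzel_caps)
  have Tac: "tangle 0 (?a @ ?C) (2 * k + 2)"
    using Ta tangle_pretzel_columns[of ps "2 * k + 2" s] k by (auto simp: tangle_append)
  have Tb: "tangle 0 (?a @ [(2 * k + 1, Cap)]) (2 * k + 4)" using Ta by (auto simp: tangle_append)
  have Tbc: "tangle 0 ((?a @ [(2 * k + 1, Cap)]) @ ?C) (2 * k + 4)"
    using Tb tangle_pretzel_columns[of ps "2 * k + 4" s] k by (subst tangle_append) auto
  have "bracket S M N \<kappa> (signed_pretzel s (ps @ [p])) =
      ?Q (((?a @ [(2 * k + 1, Cap)]) @ ?C) @ replicate p (2 * k + 2, Cross s) @ (2 * k + 1, Cup) # ?u)"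
    by (simp add: signed_pretzel_def bracket_P pretzel_caps_Suc pretzel_cups_Suc pretzel_columns_snoc k)
  also have "\<dots> = ?Q (((?a @ [(2 * k + 1, Cap)]) @ ?C) @ (2 * k + 1, Cup) # ?u) +
      column s p * ?Q ((?a @ [(2 * k + 1, Cap)]) @ ?C @ (2 * k + 2, Cup) # (2 * k + 2, Cap) # (2 * k + 1, Cup) # ?u)"
    using column_expand[OF y Tbc, of "2 * k + 2" p s "(2 * k + 1, Cup) # ?u" "\<lambda>_. 1"] by simp
  also have "?Q (((?a @ [(2 * k + 1, Cap)]) @ ?C) @ (2 * k + 1, Cup) # ?u) = open_pretzel s ps"
    by (simp add: open_pretzel_def bracket_P pretzel_caps_Suc pretzel_cups_Suc k)
  also have "?Q ((?a @ [(2 * k + 1, Cap)]) @ ?C @ (2 * k + 2, Cup) # (2 * k + 2, Cap) # (2 * k + 1, Cup) # ?u) =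
      ?Q ((?a @ [(2 * k + 1, Cap)]) @ (2 * k + 2, Cup) # ?C @ (2 * k + 2, Cap) # (2 * k + 1, Cup) # ?u)"
    by (rule commute_crosses[OF y Tb]) (use cols in auto)
  also have "\<dots> = ?Q (?a @ ?C @ (2 * k + 2, Cap) # (2 * k + 1, Cup) # ?u)"
    using zigzag_in(1)[OF y Ta, of "2 * k + 1" _ "\<lambda>_. 1"] by simp
  also have "\<dots> = ?Q (?a @ ?C @ ?u)"
    using zigzag_in(2)[OF y Tac, of "2 * k + 1" ?u "\<lambda>_. 1"] by simp
  finally show ?thesis
    by (simp add: signed_pretzel_def bracket_P k)
qed

lemma bracket_circle: "bracket S M N \<kappa> circle = \<delta>"
  using loop_value[of "[]" 0 0 "\<lambda>_. 1"] by (simp add: bracket_P circle_def)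

lemma open_pretzel: "open_pretzel s ps = \<delta> * (\<Prod>p\<leftarrow>ps. \<delta> + column s p)"
proof (induction ps rule: rev_induct)
  case Nil
  show ?case using bracket_circle by (simp add: open_pretzel_def circle_def)
qed (simp add: open_pretzel_snoc mult_ac)

lemma bracket_pretzel:
  assumes "ps \<noteq> []"
  shows "bracket S M N \<kappa> (signed_pretzel s ps) =
    (\<Prod>p\<leftarrow>ps. \<delta> + column s p) + (\<delta>\<^sup>2 - 1) * (\<Prod>p\<leftarrow>ps. column s p)"
  using assms
proof (induction ps rule: rev_nonempty_induct)
  case (single p)
  have y: "[] \<in> words S 0" and T: "tangle 0 [(0, Cap)] 2" by simp_all
  have "bracket S M N \<kappa> (signed_pretzel s [p]) = P ([(0, Cap)] @ replicate p (0, Cross s) @ [(0, Cup)]) (\<lambda>_. 1) []"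
    using pretzel_columns_snoc[of s "[]" p] by (simp add: signed_pretzel_def bracket_P)
  also have "\<dots> = P ([] @ (0, Cap) # (0, Cup) # []) (\<lambda>_. 1) [] + column s p * P ([] @ (0, Cap) # (0, Cup) # [(0, Cap), (0, Cup)]) (\<lambda>_. 1) []"
    using column_expand[OF y T, of 0 p s "[(0, Cup)]" "\<lambda>_. 1"] by simp
  also have "\<dots> = \<delta> + column s p * (\<delta> * \<delta>)"
    using loop_in[OF y, of "[]" 0 0 _ "\<lambda>_. 1"] by simp
  finally show ?case by (simp add: algebra_simps power2_eq_square)
next
  case (snoc p ps)
  show ?case
    unfolding bracket_pretzel_snoc[OF snoc(1)] open_pretzel snoc(2)
    by (simp add: algebra_simps power2_eq_square)
qed

text \<open>Closing a column by a minimum turns its crossings into \<open>p\<close> curls, each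
  worth \<open>- (\<kappa> s)\<^sup>2\<close>. The factor \<open>\<delta>\<close> stays on the left
  because the ring is arbitrary and \<open>\<delta>\<close> need not be invertible.\<close>

lemma column_closed_form: "\<delta> * column s p = (- (\<kappa> s)\<^sup>2) ^ p - 1"
proof (induction p)
  case (Suc p)
  have "1 + \<kappa> s * \<delta> = - (\<kappa> s)\<^sup>2"
    unfolding \<delta>_split[of s] by (simp add: algebra_simps power2_eq_square)
  then have e: "\<kappa> s * \<delta> = - (\<kappa> s)\<^sup>2 - 1" by (simp add: algebra_simps)
  have "\<delta> * column s (Suc p) = \<delta> * column s p * (1 + \<kappa> s * \<delta>) + \<kappa> s * \<delta>"
    by (simp add: algebra_simps)
  also have "\<dots> = (- (\<kappa> s)\<^sup>2) ^ Suc p - 1"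
    unfolding Suc e by (simp add: algebra_simps)
  finally show ?case .
qed simp

end

section \<open>The crossing number of pretzel knots\<close>

text \<open>\<open>q\<close> is the larger root of \<open>q\<^sup>2 - d * q + 1\<close> and at least
  \<open>d / 2\<close>, so it becomes as large as desired while \<open>d\<close> remains a number of
  colours.\<close>

lemma exists_quantum_parameter:
  fixes C :: real
  obtains d :: nat and q :: real where "C \<le> q" "2 \<le> q" "real d = q + 1 / q"
proof -
  obtain d :: nat where d: "2 * \<bar>C\<bar> + 4 \<le> real d" using real_arch_simple by blast
  define q where "q = (real d + sqrt ((real d)\<^sup>2 - 4)) / 2"
  have "4 \<le> real d" using d by simp
  then have "(4::real)\<^sup>2 \<le> (real d)\<^sup>2" by (intro power_mono) auto
  then have sq: "(sqrt ((real d)\<^sup>2 - 4))\<^sup>2 = (real d)\<^sup>2 - 4" "0 \<le> sqrt ((real d)\<^sup>2 - 4)" by auto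
  then have q: "real d / 2 \<le> q" by (simp add: q_def)
  have "q * q - real d * q + 1 = 0"
    using sq(1) by (simp add: q_def field_simps power2_eq_square)
  moreover have "2 \<le> q" using q d by simp
  ultimately have "real d = q + 1 / q" by (simp add: field_simps)
  moreover have "C \<le> q" using q d by simp
  ultimately show ?thesis using that \<open>2 \<le> q\<close> by blast
qed

lemma prod_list_mono_abs:
  fixes f g :: "'a \<Rightarrow> real"
  assumes "\<And>x. x \<in> set xs \<Longrightarrow> \<bar>f x\<bar> \<le> g x"
  shows "\<bar>prod_list (map f xs)\<bar> \<le> prod_list (map g xs)"
  using assms
proof (induction xs)
  case (Cons x xs)
  then have "\<bar>f x\<bar> \<le> g x" "\<bar>prod_list (map f xs)\<bar> \<le> prod_list (map g xs)" by simp_all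
  then show ?case by (simp add: abs_mult) (meson abs_ge_zero mult_mono order_trans)
qed simp

lemma prod_list_mono_nonneg:
  fixes f g :: "'a \<Rightarrow> real"
  assumes "\<And>x. x \<in> set xs \<Longrightarrow> 0 \<le> f x \<and> f x \<le> g x"
  shows "prod_list (map f xs) \<le> prod_list (map g xs)"
proof -
  have "\<bar>prod_list (map f xs)\<bar> \<le> prod_list (map g xs)"
    using assms by (intro prod_list_mono_abs) auto
  then show ?thesis by simp
qed

lemma prod_list_const: "prod_list (map (\<lambda>_. c) xs) = (c :: real) ^ length xs"
  by (induction xs) simp_all

lemma prod_list_abs: "\<bar>prod_list (map f xs)\<bar> = prod_list (map (\<lambda>x. \<bar>f x\<bar>) xs)" for f :: "'a \<Rightarrow> real"
  by (induction xs) (simp_all add: abs_mult)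

section \<open>Growth in \<open>q\<close> of the bracket product of a pretzel diagram\<close>

context
  fixes q :: real and d :: nat and \<kappa> :: "bool \<Rightarrow> real" and s :: bool
  assumes q2: "2 \<le> q" and dq: "real d = q + 1 / q"
    and model: "tl_model (colours d) kronecker kronecker \<kappa>"
    and trace: "\<kappa> s + \<kappa> (\<not> s) = - real d"
begin

interpretation tl_model "colours d" kronecker kronecker \<kappa> by (rule model)

lemma potts_delta: "\<delta> = real d"
  using \<kappa>_sum[of s] trace by simp

lemma potts_d: "real d \<le> 2 * q" "q \<le> real d" "q\<^sup>2 + 2 \<le> (real d)\<^sup>2"
proof -
  have i: "0 \<le> 1 / q" "1 / q \<le> q" using q2 by (simp_all add: field_simps mult_mono'[of 1 q 1 q, simplified])
  then show "real d \<le> 2 * q" "q \<le> real d" using dq by simp_all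
  have "(real d)\<^sup>2 = q\<^sup>2 + 2 + (1 / q)\<^sup>2"
    using q2 unfolding dq by (simp add: power2_sum field_simps power2_eq_square)
  then show "q\<^sup>2 + 2 \<le> (real d)\<^sup>2" by simp
qed

text \<open>Each \<open>column s p\<close> lies between \<open>- 1 / q\<close> and \<open>0\<close>,
  so each factor \<open>\<delta> + column s p\<close> is at least \<open>q\<close> and the first
  product of \<open>bracket_pretzel\<close> dominates. With at least three columns the second term
  is at most \<open>4 / q\<close>, and subtracting it leaves at least half of
  \<open>q ^ length ps\<close>.\<close>

lemma potts_pretzel_small:
  assumes "\<kappa> s = - 1 / q" "\<And>p. p \<in> set ps \<Longrightarrow> odd p" "3 \<le> length ps"
  shows "q ^ length ps \<le> 2 * \<bar>bracket (colours d) kronecker kronecker \<kappa> (signed_pretzel s ps)\<bar>"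
proof -
  let ?m = "length ps"
  have c: "0 \<le> - column s p" "- column s p \<le> 1 / q" if "p \<in> set ps" for p
  proof -
    have p: "odd p" using assms(2) that .
    have "real d * column s p = - (1 / q ^ (2 * p)) - 1"
      using column_closed_form[of s p] p by (simp add: potts_delta assms(1) power_divide power_mult)
    then have e: "- column s p = (1 + 1 / q ^ (2 * p)) / real d"
      using potts_d(2) q2 by (simp add: field_simps)
    show "0 \<le> - column s p" unfolding e using q2 by simp
    have "q ^ 2 \<le> q ^ (2 * p)" using p q2 by (intro power_increasing) (auto elim: oddE)
    then have "1 / q ^ (2 * p) \<le> 1 / q ^ 2" using q2 by (intro divide_left_mono) auto
    then have "- column s p \<le> (1 + 1 / q ^ 2) / real d" unfolding e by (intro divide_right_mono) auto
    also have "1 + 1 / q ^ 2 = 1 / q * real d" using q2 by (simp add: dq field_simps power2_eq_square)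
    also have "1 / q * real d / real d = 1 / q" using q2 potts_d(2) by simp
    finally show "- column s p \<le> 1 / q" .
  qed
  have "q ^ ?m \<le> (\<Prod>p\<leftarrow>ps. \<delta> + column s p)"
    unfolding prod_list_const[symmetric]
    using c q2 by (intro prod_list_mono_nonneg) (fastforce simp: potts_delta dq)
  moreover have "\<bar>\<Prod>p\<leftarrow>ps. column s p\<bar> \<le> (1 / q) ^ ?m"
    unfolding prod_list_const[symmetric] using c by (intro prod_list_mono_abs) fastforce
  then have "\<bar>(\<delta>\<^sup>2 - 1) * (\<Prod>p\<leftarrow>ps. column s p)\<bar> \<le> \<bar>\<delta>\<^sup>2 - 1\<bar> * (1 / q) ^ ?m"
    unfolding abs_mult by (intro mult_left_mono) auto
  moreover have "\<bar>\<delta>\<^sup>2 - 1\<bar> * (1 / q) ^ ?m \<le> 2"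
  proof -
    have "1 \<le> \<delta>\<^sup>2" using potts_d(3) by (simp add: potts_delta) (smt (verit) zero_le_power2)
    moreover have "\<delta>\<^sup>2 \<le> (2 * q)\<^sup>2" using potts_d(1) unfolding potts_delta by (intro power_mono) auto
    ultimately have "\<bar>\<delta>\<^sup>2 - 1\<bar> \<le> 4 * q\<^sup>2" by (simp add: power_mult_distrib)
    moreover have "(1 / q) ^ ?m \<le> (1 / q) ^ 3" using assms(3) q2 by (intro power_decreasing) auto
    ultimately have "\<bar>\<delta>\<^sup>2 - 1\<bar> * (1 / q) ^ ?m \<le> 4 * q\<^sup>2 * (1 / q) ^ 3" using q2 by (intro mult_mono) auto
    also have "\<dots> = 4 / q" using q2 by (simp add: field_simps power2_eq_square power3_eq_cube)
    also have "\<dots> \<le> 2" using q2 by (simp add: field_simps)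
    finally show ?thesis .
  qed
  moreover have "4 \<le> q ^ ?m"
  proof -
    have "2 ^ 3 \<le> q ^ 3" using q2 by (intro power_mono) auto
    also have "q ^ 3 \<le> q ^ ?m" using assms(3) q2 by (intro power_increasing) auto
    finally show ?thesis by simp
  qed
  moreover have "bracket (colours d) kronecker kronecker \<kappa> (signed_pretzel s ps) =
     (\<Prod>p\<leftarrow>ps. \<delta> + column s p) + (\<delta>\<^sup>2 - 1) * (\<Prod>p\<leftarrow>ps. column s p)"
    using assms(3) by (intro bracket_pretzel) auto
  ultimately show ?thesis by linarith
qed

text \<open>Each \<open>column s p\<close> is negative of size about \<open>q ^ (2 * p) / d\<close>,
  and adding \<open>\<delta>\<close> does not increase its absolute value. So the second term of
  \<open>bracket_pretzel\<close> is at least \<open>\<delta>\<^sup>2 - 1\<close> times the first,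
  and by \<open>q\<^sup>2 + 2 \<le> d\<^sup>2\<close> a factor \<open>q\<^sup>2\<close> survives in
  the difference.\<close>

lemma potts_pretzel_large:
  assumes "\<kappa> s = - q" "\<And>p. p \<in> set ps \<Longrightarrow> odd p" "ps \<noteq> []"
  shows "q ^ (2 * sum_list ps + 2) \<le>
    (2 * q) ^ length ps * \<bar>bracket (colours d) kronecker kronecker \<kappa> (signed_pretzel s ps)\<bar>"
proof -
  let ?m = "length ps"
  have c: "q ^ (2 * p) \<le> 2 * q * \<bar>column s p\<bar>" "\<bar>\<delta> + column s p\<bar> \<le> \<bar>column s p\<bar>" if "p \<in> set ps" for p
  proof -
    have p: "odd p" using assms(2) that .
    have "real d * column s p = - (q ^ (2 * p)) - 1"
      using column_closed_form[of s p] p by (simp add: potts_delta assms(1) power_mult)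
    then have "column s p = - ((1 + q ^ (2 * p)) / real d)"
      using potts_d(2) q2 by (simp add: field_simps)
    moreover have "0 \<le> (1 + q ^ (2 * p)) / real d" using q2 by simp
    ultimately have e: "\<bar>column s p\<bar> = (1 + q ^ (2 * p)) / real d" and neg: "column s p \<le> 0"
      by linarith+
    have "(1 + q ^ (2 * p)) / (2 * q) \<le> \<bar>column s p\<bar>"
      unfolding e using potts_d q2 by (intro divide_left_mono) auto
    then show "q ^ (2 * p) \<le> 2 * q * \<bar>column s p\<bar>" using q2 by (simp add: field_simps)
    have "q ^ 2 \<le> q ^ (2 * p)" using p q2 by (intro power_increasing) (auto elim: oddE)
    then have "(1 + q ^ 2) / real d \<le> \<bar>column s p\<bar>" unfolding e by (intro divide_right_mono) auto
    moreover have "(1 + q ^ 2) / real d = q"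
    proof -
      have "1 + q ^ 2 = q * real d" using q2 by (simp add: dq field_simps power2_eq_square)
      then show ?thesis using q2 potts_d(2) by simp
    qed
    ultimately have "real d \<le> 2 * \<bar>column s p\<bar>" using potts_d(1) by simp
    then show "\<bar>\<delta> + column s p\<bar> \<le> \<bar>column s p\<bar>"
      using neg unfolding potts_delta by linarith
  qed
  let ?c = "\<Prod>p\<leftarrow>ps. \<bar>column s p\<bar>"
  have c0: "0 \<le> ?c" by (induction ps) auto
  have "\<bar>\<Prod>p\<leftarrow>ps. \<delta> + column s p\<bar> \<le> ?c" using c(2) by (rule prod_list_mono_abs)
  moreover have "\<bar>(\<delta>\<^sup>2 - 1) * (\<Prod>p\<leftarrow>ps. column s p)\<bar> = (\<delta>\<^sup>2 - 1) * ?c"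
  proof -
    have "1 \<le> \<delta>\<^sup>2" using potts_d(3) by (simp add: potts_delta) (smt (verit) zero_le_power2)
    then show ?thesis by (simp add: abs_mult prod_list_abs)
  qed
  moreover have "bracket (colours d) kronecker kronecker \<kappa> (signed_pretzel s ps) =
     (\<Prod>p\<leftarrow>ps. \<delta> + column s p) + (\<delta>\<^sup>2 - 1) * (\<Prod>p\<leftarrow>ps. column s p)"
    using assms(3) by (rule bracket_pretzel)
  ultimately have "(\<delta>\<^sup>2 - 1) * ?c - ?c \<le> \<bar>bracket (colours d) kronecker kronecker \<kappa> (signed_pretzel s ps)\<bar>"
    by linarith
  moreover have "q\<^sup>2 * ?c \<le> (\<delta>\<^sup>2 - 1) * ?c - ?c"
  proof -
    have "q\<^sup>2 * ?c \<le> (\<delta>\<^sup>2 - 2) * ?c" using c0 potts_d(3) by (intro mult_right_mono) (simp_all add: potts_delta)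
    then show ?thesis by (simp add: algebra_simps)
  qed
  ultimately have b: "q\<^sup>2 * ?c \<le> \<bar>bracket (colours d) kronecker kronecker \<kappa> (signed_pretzel s ps)\<bar>" by linarith
  have "q ^ (2 * sum_list ps) = (\<Prod>p\<leftarrow>ps. q ^ (2 * p))"
    by (induction ps) (simp_all add: power_add distrib_left)
  also have "\<dots> \<le> (\<Prod>p\<leftarrow>ps. 2 * q * \<bar>column s p\<bar>)"
    using c(1) q2 by (intro prod_list_mono_nonneg) auto
  also have "\<dots> = (2 * q) ^ ?m * ?c"
    by (induction ps) (simp_all add: mult_ac)
  finally have "q\<^sup>2 * q ^ (2 * sum_list ps) \<le> q\<^sup>2 * ((2 * q) ^ ?m * ?c)"
    by (intro mult_left_mono) auto
  then have "q ^ (2 * sum_list ps + 2) \<le> (2 * q) ^ ?m * (q\<^sup>2 * ?c)"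
    by (simp only: power_add mult_ac)
  also have "\<dots> \<le> (2 * q) ^ ?m * \<bar>bracket (colours d) kronecker kronecker \<kappa> (signed_pretzel s ps)\<bar>"
    using b q2 by (intro mult_left_mono) auto
  finally show ?thesis .
qed

end

lemma potts_product_pretzel:
  assumes "2 \<le> q" "real d = q + 1 / q" "\<And>p. p \<in> set ps \<Longrightarrow> odd p" "3 \<le> length ps"
  shows "q ^ (2 * sum_list ps + 2) \<le> 2 ^ (length ps + 1) * \<bar>potts_product d q (signed_pretzel s ps)\<bar>"
proof -
  define \<kappa> where "\<kappa> = potts_coefficient q"
  let ?br = "\<lambda>\<kappa>. \<bar>bracket (colours d) kronecker kronecker \<kappa> (signed_pretzel s ps)\<bar>"
  interpret tl_model "colours d" kronecker kronecker \<kappa>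
    unfolding \<kappa>_def using assms by (intro potts_model) auto
  \<comment> \<open>\<open>\<kappa>1\<close> belongs to the factor in which the crossings of the
    diagram have coefficient \<open>- 1 / q\<close>; which of the two it is depends on
    \<open>s\<close>.\<close>
  define \<kappa>1 where "\<kappa>1 = (if s then \<kappa> else (\<lambda>s. \<kappa> (\<not> s)))"
  define \<kappa>2 where "\<kappa>2 = (if s then (\<lambda>s. \<kappa> (\<not> s)) else \<kappa>)"
  have m: "tl_model (colours d) kronecker kronecker \<kappa>1" "tl_model (colours d) kronecker kronecker \<kappa>2"
    using swapped tl_model_axioms by (simp_all add: \<kappa>1_def \<kappa>2_def)
  have k: "\<kappa>1 s = - 1 / q" "\<kappa>2 s = - q" "\<kappa>1 s + \<kappa>1 (\<not> s) = - real d" "\<kappa>2 s + \<kappa>2 (\<not> s) = - real d"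
    using assms(2) by (cases s; simp add: \<kappa>1_def \<kappa>2_def \<kappa>_def potts_coefficient_def)+
  have ne: "ps \<noteq> []" using assms(4) by auto
  have 1: "q ^ length ps \<le> 2 * ?br \<kappa>1"
    by (rule potts_pretzel_small[OF assms(1,2) m(1) k(3,1) assms(3,4)])
  have 2: "q ^ (2 * sum_list ps + 2) \<le> (2 * q) ^ length ps * ?br \<kappa>2"
    by (rule potts_pretzel_large[OF assms(1,2) m(2) k(4,2) assms(3) ne])
  have "q ^ length ps * q ^ (2 * sum_list ps + 2) \<le> (2 * ?br \<kappa>1) * ((2 * q) ^ length ps * ?br \<kappa>2)"
    using assms(1) by (intro mult_mono 1 2) auto
  also have "?br \<kappa>1 * ?br \<kappa>2 = \<bar>potts_product d q (signed_pretzel s ps)\<bar>"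
    by (cases s) (simp_all add: bracket_product_def \<kappa>1_def \<kappa>2_def \<kappa>_def abs_mult)
  then have "(2 * ?br \<kappa>1) * ((2 * q) ^ length ps * ?br \<kappa>2) =
      q ^ length ps * (2 ^ (length ps + 1) * \<bar>potts_product d q (signed_pretzel s ps)\<bar>)"
    by (simp add: power_mult_distrib mult_ac)
  finally show ?thesis
    using assms(1) by simp
qed

text \<open>The span argument: an isotopic diagram with fewer crossings would violate the growth in
  \<open>q\<close> of the bracket product.\<close>

lemma crossings_isotopic_pretzel:
  assumes "\<And>p. p \<in> set ps \<Longrightarrow> odd p" "3 \<le> length ps" "isotopic (signed_pretzel s ps) D"
  shows "sum_list ps \<le> crossings D"
proof (rule ccontr)
  let ?c = "crossings D" and ?n = "sum_list ps"
  assume "\<not> ?n \<le> ?c"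
  then have less: "Suc ?c \<le> ?n" by simp
  \<comment> \<open>All constants that do not depend on \<open>q\<close> are collected first;
    \<open>q\<close> is then chosen larger.\<close>
  define C :: real where "C = 2 ^ (length ps + 1) * (9 ^ ?c * 2 ^ (?c + 2))"
  obtain d :: nat and q :: real where q: "C + 1 \<le> q" "2 \<le> q" "real d = q + 1 / q"
    by (rule exists_quantum_parameter)
  interpret tl_model "colours d" kronecker kronecker "potts_coefficient q"
    using q by (intro potts_model) auto
  have D: "knot_diagram D" using assms(3) by (simp add: isotopic_def)
  have "q ^ (2 * ?n + 2) \<le> 2 ^ (length ps + 1) * \<bar>potts_product d q (signed_pretzel s ps)\<bar>"
    using q assms(1,2) by (intro potts_product_pretzel) auto
  also have "potts_product d q (signed_pretzel s ps) = potts_product d q D"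
    using assms(3) by (rule bracket_product_isotopic)
  also have "2 ^ (length ps + 1) * \<bar>potts_product d q D\<bar> \<le>
      2 ^ (length ps + 1) * ((9 * q) ^ ?c * (2 * q) ^ (?c + 2))"
    using D q by (intro mult_left_mono potts_product_bound) auto
  also have "\<dots> = C * q ^ (2 * ?c + 2)"
  proof -
    have "q ^ (2 * ?c + 2) = q ^ ?c * q ^ (?c + 2)"
      by (simp only: power_add[symmetric]) (simp add: mult_2)
    then show ?thesis by (simp only: C_def power_mult_distrib mult_ac)
  qed
  finally have "q ^ (2 * ?n + 2) \<le> C * q ^ (2 * ?c + 2)" .
  moreover have "q * q ^ (2 * ?c + 2) \<le> q ^ (2 * ?n + 2)"
    using less q(2) power_increasing[of "Suc (2 * ?c + 2)" "2 * ?n + 2" q] by simp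
  ultimately have "q * q ^ (2 * ?c + 2) \<le> C * q ^ (2 * ?c + 2)" by linarith
  then have "q \<le> C" using q(2) by simp
  with q(1) show False by simp
qed

section \<open>The second Conway coefficient\<close>

unbundle fps_syntax

lemma fps_mult_coeff_1: "(f * g) $ 1 = f $ 0 * g $ 1 + f $ 1 * g $ 0" for f g :: "real fps"
  by (simp add: fps_mult_nth)

lemma fps_mult_coeff_2: "(f * g) $ 2 = f $ 0 * g $ 2 + f $ 1 * g $ 1 + f $ 2 * g $ 0" for f g :: "real fps"
  by (simp add: fps_mult_nth numeral_2_eq_2)

lemmas fps_mult_nths = fps_mult_nth_0 fps_mult_coeff_1 fps_mult_coeff_2

lemma fps_exp_nths: "fps_exp a $ 0 = 1" "fps_exp a $ 1 = a" "fps_exp a $ 2 = a\<^sup>2 / 2" for a :: real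
  by (simp_all add: fact_numeral)

text \<open>Together with \<open>cup_matrix\<close> this is the pairing of quantum
  \<open>sl(2)\<close> on two colours with \<open>q = exp h\<close>. The loop value is
  \<open>exp h + exp (- h)\<close>, and at \<open>h = 0\<close> only the requirement of opposite
  colours at the two ends is left.\<close>

definition cap_matrix :: "int \<Rightarrow> int \<Rightarrow> real fps" where
  "cap_matrix u v = (if u = 0 \<and> v = 1 then fps_exp 1 else if u = 1 \<and> v = 0 then 1 else 0)"

definition cup_matrix :: "int \<Rightarrow> int \<Rightarrow> real fps" where
  "cup_matrix u v = (if u = 0 \<and> v = 1 then 1 else if u = 1 \<and> v = 0 then fps_exp (- 1) else 0)"

definition jones_coefficient :: "bool \<Rightarrow> real fps" where
  "jones_coefficient s = - fps_exp (if s then - 1 else 1)"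

lemma colours_2: "colours 2 = {0, 1}"
  by auto

lemma sum_colours_2: "(\<Sum>a\<in>colours 2. f a) = f 0 + f 1"
  unfolding colours_2 by simp

lemma exp_mult_inverse: "fps_exp 1 * fps_exp (- 1) = (1 :: real fps)" "fps_exp (- 1) * fps_exp 1 = (1 :: real fps)"
  by (simp_all flip: fps_exp_add_mult)

interpretation jones: tl_model "colours 2" cap_matrix cup_matrix jones_coefficient
proof
  show "(\<Sum>b\<in>colours 2. cap_matrix a b * cup_matrix b c) = of_bool (a = c)" if "a \<in> colours 2" "c \<in> colours 2" for a c
    using that unfolding sum_colours_2 unfolding colours_2
    by (auto simp: cap_matrix_def cup_matrix_def exp_mult_inverse)
  show "(\<Sum>b\<in>colours 2. cup_matrix a b * cap_matrix b c) = of_bool (a = c)" if "a \<in> colours 2" "c \<in> colours 2" for a c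
    using that unfolding sum_colours_2 unfolding colours_2
    by (auto simp: cap_matrix_def cup_matrix_def exp_mult_inverse)
  show "(\<Sum>a\<in>colours 2. \<Sum>b\<in>colours 2. cap_matrix a b * cup_matrix a b) = - (jones_coefficient True + jones_coefficient False)"
    unfolding sum_colours_2 by (simp add: cap_matrix_def cup_matrix_def jones_coefficient_def)
  show "jones_coefficient True * jones_coefficient False = 1"
    by (simp add: jones_coefficient_def exp_mult_inverse)
qed simp

abbreviation jones_bracket :: "(bool \<Rightarrow> real fps) \<Rightarrow> diagram \<Rightarrow> real fps" where
  "jones_bracket \<equiv> bracket (colours 2) cap_matrix cup_matrix"

text \<open>Up to normalization this is the second coefficient of the Conway polynomial: it equals
  \<open>4 - 96 * a\<^sub>2\<close>.\<close>

definition conway_invariant :: "diagram \<Rightarrow> real" where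
  "conway_invariant D = bracket_product (colours 2) cap_matrix cup_matrix jones_coefficient D $ 2"

lemma conway_invariant_isotopic: "isotopic D D' \<Longrightarrow> conway_invariant D = conway_invariant D'"
  unfolding conway_invariant_def by (drule jones.bracket_product_isotopic) (rule arg_cong)

lemma loop_nths: "jones.\<delta> $ 0 = 2" "jones.\<delta> $ 1 = 0" "jones.\<delta> $ 2 = 1"
  by (simp_all add: jones.\<delta>_def jones_coefficient_def fps_exp_nths del: One_nat_def fps_exp_nth)

text \<open>Side \<open>True\<close> is the bracket of the diagram and side \<open>False\<close>
  that of its mirror image, so one computation with a sign serves both factors.\<close>

definition jones_side :: "bool \<Rightarrow> bool \<Rightarrow> real fps" where
  "jones_side e s = jones_coefficient (s = e)"

lemma jones_side_model: "tl_model (colours 2) cap_matrix cup_matrix (jones_side e)"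
  using jones.tl_model_axioms jones.swapped by (cases e) (simp_all add: jones_side_def[abs_def])

lemma conway_invariant_sides:
  "conway_invariant D = (jones_bracket (jones_side True) D * jones_bracket (jones_side False) D) $ 2"
  by (simp add: conway_invariant_def bracket_product_def jones_side_def[abs_def])

lemma jones_side_loop: "tl_model.\<delta> (jones_side e) = jones.\<delta>"
proof -
  interpret e: tl_model "colours 2" cap_matrix cup_matrix "jones_side e" by (rule jones_side_model)
  show ?thesis
    unfolding e.\<delta>_def jones.\<delta>_def by (cases e) (simp_all add: jones_side_def)
qed

lemma conway_invariant_circle: "conway_invariant circle = 4"
proof -
  have "jones_bracket (jones_side e) circle = jones.\<delta>" for e
    using tl_model.bracket_circle[OF jones_side_model] by (simp add: jones_side_loop)
  then show ?thesis unfolding conway_invariant_sides fps_mult_nths by (simp add: loop_nths del: One_nat_def)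
qed

text \<open>The loop value has constant term \<open>2\<close>, so \<open>column_closed_form\<close>
  determines the coefficients of \<open>e.column s p\<close> one after the other. The products over
  the columns follow by induction, and the odd number of columns fixes the sign of the second
  one.\<close>

lemma jones_pretzel_nths:
  fixes e s :: bool and ps :: "nat list"
  assumes "\<forall>p\<in>set ps. odd p" "odd (length ps)"
  defines "a \<equiv> if s = e then - 1 else 1 :: real" and "n \<equiv> \<Sum>p\<leftarrow>ps. real p" and "n2 \<equiv> \<Sum>p\<leftarrow>ps. (real p)\<^sup>2"
  shows "jones_bracket (jones_side e) (signed_pretzel s ps) $ 0 = - 2"
    "jones_bracket (jones_side e) (signed_pretzel s ps) $ 1 = - 4 * a * n"
    "jones_bracket (jones_side e) (signed_pretzel s ps) $ 2 = - (n\<^sup>2 - n2) + 3 * real (length ps) - 4 * n2 - 4"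
proof -
  interpret e: tl_model "colours 2" cap_matrix cup_matrix "jones_side e" by (rule jones_side_model)
  have [simp]: "e.\<delta> = jones.\<delta>" by (rule jones_side_loop)
  have a2: "a\<^sup>2 = 1" "a * a = 1" by (simp_all add: a_def)
  have c: "e.column s p $ 0 = - 1" "e.column s p $ 1 = - a * real p" "e.column s p $ 2 = 1 / 2 - (real p)\<^sup>2"
    if "odd p" for p
  proof -
    have "(jones_side e s)\<^sup>2 = fps_exp (2 * a)"
      by (simp add: jones_side_def jones_coefficient_def a_def fps_exp_power_mult)
    then have "jones.\<delta> * e.column s p = - fps_exp (real p * (2 * a)) - 1"
      using e.column_closed_form[of s p] that by (simp add: fps_exp_power_mult)
    then have *: "(jones.\<delta> * e.column s p) $ k = (- fps_exp (real p * (2 * a)) - 1) $ k" for k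
      by simp
    show 0: "e.column s p $ 0 = - 1"
      using *[of 0] by (simp add: fps_mult_nths loop_nths)
    show 1: "e.column s p $ 1 = - a * real p"
      using *[of 1] 0 unfolding fps_mult_nths by (simp add: loop_nths fps_exp_nths del: One_nat_def fps_exp_nth)
    \<comment> \<open>The \<open>- 1\<close> is the quadratic coefficient \<open>1\<close> of the
      loop value times the constant term \<open>- 1\<close> of the column.\<close>
    have "2 * e.column s p $ 2 - 1 = - (real p * (2 * a))\<^sup>2 / 2"
      using *[of 2] 0 1 unfolding fps_mult_nths by (simp add: loop_nths fps_exp_nths del: One_nat_def fps_exp_nth)
    then show "e.column s p $ 2 = 1 / 2 - (real p)\<^sup>2"
      using a2 by (simp add: power_mult_distrib)
  qed
  let ?n = "\<lambda>ps. \<Sum>p\<leftarrow>ps. real p" and ?n2 = "\<lambda>ps. \<Sum>p\<leftarrow>ps. (real p)\<^sup>2"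
  have A: "(\<Prod>p\<leftarrow>ps. jones.\<delta> + e.column s p) $ 0 = 1 \<and>
     (\<Prod>p\<leftarrow>ps. jones.\<delta> + e.column s p) $ 1 = - a * ?n ps \<and>
     (\<Prod>p\<leftarrow>ps. jones.\<delta> + e.column s p) $ 2 = ((?n ps)\<^sup>2 - ?n2 ps) / 2 + 3 / 2 * real (length ps) - ?n2 ps"
    if "\<forall>p\<in>set ps. odd p" for ps
    using that
  proof (induction ps)
    case (Cons p ps)
    have odd: "odd p" using Cons.prems by simp
    have a: "a * (a * z) = z" for z using a2 by (simp flip: mult.assoc)
    show ?case
      using Cons by (simp add: fps_mult_nths loop_nths c[OF odd] a power2_sum add_divide_distrib diff_divide_distrib algebra_simps del: One_nat_def)
  qed simp
  have B: "(\<Prod>p\<leftarrow>ps. e.column s p) $ 0 = (- 1) ^ length ps \<and>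
     (\<Prod>p\<leftarrow>ps. e.column s p) $ 1 = (- 1) ^ length ps * (a * ?n ps) \<and>
     (\<Prod>p\<leftarrow>ps. e.column s p) $ 2 = (- 1) ^ length ps * (((?n ps)\<^sup>2 - ?n2 ps) / 2 + ?n2 ps - real (length ps) / 2)"
    if "\<forall>p\<in>set ps. odd p" for ps
    using that
  proof (induction ps)
    case (Cons p ps)
    have odd: "odd p" using Cons.prems by simp
    have a: "a * (a * z) = z" for z using a2 by (simp flip: mult.assoc)
    show ?case
      using Cons by (simp add: fps_mult_nths c[OF odd] a power2_sum add_divide_distrib diff_divide_distrib algebra_simps del: One_nat_def)
  qed simp
  have ne: "ps \<noteq> []" using assms(2) by auto
  have d: "(jones.\<delta>\<^sup>2 - 1) $ 0 = 3" "(jones.\<delta>\<^sup>2 - 1) $ 1 = 0" "(jones.\<delta>\<^sup>2 - 1) $ 2 = 4"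
    by (simp_all add: power2_eq_square fps_mult_nths loop_nths del: One_nat_def)
  note X = e.bracket_pretzel[OF ne, of s] 
  have sgn: "(- 1 :: real) ^ length ps = - 1" using assms(2) by simp
  note A' = A[OF assms(1)] and B' = B[OF assms(1)]
  show "jones_bracket (jones_side e) (signed_pretzel s ps) $ 0 = - 2"
    unfolding X using A' B' d sgn by (simp add: fps_mult_nths del: One_nat_def)
  show "jones_bracket (jones_side e) (signed_pretzel s ps) $ 1 = - 4 * a * n"
    unfolding X using A' B' d sgn by (simp add: fps_mult_nths n_def del: One_nat_def)
  show "jones_bracket (jones_side e) (signed_pretzel s ps) $ 2 = - (n\<^sup>2 - n2) + 3 * real (length ps) - 4 * n2 - 4"
    unfolding X using A' B' d sgn by (simp add: fps_mult_nths n_def n2_def field_simps del: One_nat_def)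
qed

text \<open>The linear coefficients of the two sides are opposite and contribute \<open>- 16\<close>
  times the square of the number of crossings. The rest is \<open>- 4\<close> times the common
  quadratic coefficient.\<close>

lemma conway_invariant_pretzel:
  assumes "\<forall>p\<in>set ps. odd p" "odd (length ps)"
  shows "conway_invariant (signed_pretzel s ps) =
    16 - 12 * real (length ps) - 12 * ((\<Sum>p\<leftarrow>ps. real p)\<^sup>2 - (\<Sum>p\<leftarrow>ps. (real p)\<^sup>2))"
  unfolding conway_invariant_sides fps_mult_nths jones_pretzel_nths[OF assms]
  by (cases s) (simp_all add: algebra_simps power2_eq_square)

section \<open>The effect of a Delta-move\<close>

lemma transfer_hom:
  fixes S :: "'c set" and \<phi> :: "'r::comm_ring_1 \<Rightarrow> 's::comm_ring_1"
  assumes "\<And>x y. \<phi> (x + y) = \<phi> x + \<phi> y" "\<And>x y. \<phi> (x * y) = \<phi> x * \<phi> y" "\<phi> 0 = 0"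
  shows "\<phi> (transfer S sl g y) = transfer S (map (\<lambda>(i, t, b, W). (i, t, b, \<lambda>a x. \<phi> (W a x))) sl) (\<lambda>z. \<phi> (g z)) y"
proof (induction sl arbitrary: y)
  case (Cons s sl)
  have "\<phi> (sum f A) = (\<Sum>x\<in>A. \<phi> (f x))" for f and A :: "'c list set"
    by (induction A rule: infinite_finite_induct) (simp_all add: assms)
  then show ?case using Cons by (cases s) (simp add: assms)
qed simp

lemma transfer_abs_le:
  fixes sl :: "(nat \<Rightarrow> ('c, real) weight) slice list"
  assumes "fits m (label_at 0 sl) n" "y \<in> words S m"
    and "\<And>i t b L a x. (i, t, b, L) \<in> set sl \<Longrightarrow> a \<in> words S t \<Longrightarrow> x \<in> words S b \<Longrightarrow> \<bar>L 0 a x\<bar> \<le> L 1 a x"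
  shows "\<bar>transfer S (label_at 0 sl) (\<lambda>_. 1) y\<bar> \<le> transfer S (label_at 1 sl) (\<lambda>_. 1) y"
  using assms
proof (induction sl arbitrary: m y)
  case (Cons s sl)
  obtain i t b L where s: "s = (i, t, b, L)" by (cases s)
  let ?y = "\<lambda>x. take i y @ x @ drop (i + t) y"
  have f: "i + t \<le> m" "fits (m - t + b) (label_at 0 sl) n" using Cons.prems s by auto
  have "\<bar>transfer S (label_at 0 (s # sl)) (\<lambda>_. 1) y\<bar> \<le>
      (\<Sum>x\<in>words S b. \<bar>L 0 (take t (drop i y)) x * transfer S (label_at 0 sl) (\<lambda>_. 1) (?y x)\<bar>)"
    by (simp add: s sum_abs)
  also have "\<dots> \<le> (\<Sum>x\<in>words S b. L 1 (take t (drop i y)) x * transfer S (label_at 1 sl) (\<lambda>_. 1) (?y x))"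
  proof (rule sum_mono)
    fix x assume x: "x \<in> words S b"
    have "\<bar>L 0 (take t (drop i y)) x\<bar> \<le> L 1 (take t (drop i y)) x"
      using Cons.prems(3)[of i t b L] window_words[OF Cons.prems(2) f(1)] x by (simp add: s)
    moreover have "\<bar>transfer S (label_at 0 sl) (\<lambda>_. 1) (?y x)\<bar> \<le> transfer S (label_at 1 sl) (\<lambda>_. 1) (?y x)"
      using Cons.IH[OF f(2) splice_words[OF Cons.prems(2) x f(1)]] Cons.prems(3) by (meson list.set_intros(2))
    ultimately show "\<bar>L 0 (take t (drop i y)) x * transfer S (label_at 0 sl) (\<lambda>_. 1) (?y x)\<bar>
        \<le> L 1 (take t (drop i y)) x * transfer S (label_at 1 sl) (\<lambda>_. 1) (?y x)"
      unfolding abs_mult by (intro mult_mono) auto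
  qed
  also have "\<dots> = transfer S (label_at 1 (s # sl)) (\<lambda>_. 1) y"
    by (simp add: s)
  finally show ?case .
qed simp

text \<open>At \<open>q = 1\<close> the colours \<open>0\<close> and \<open>1\<close> become orientations of the strands: they are opposite at
  the two ends of a maximum or minimum, and a crossing of antiparallel strands contributes a sign.\<close>

fun orientation :: "piece \<Rightarrow> int rel" where
  "orientation Cap a x \<longleftrightarrow> x ! 0 \<noteq> x ! 1"
| "orientation Cup a x \<longleftrightarrow> a ! 0 \<noteq> a ! 1"
| "orientation (Cross s) a x \<longleftrightarrow> x ! 0 = a ! 1 \<and> x ! 1 = a ! 0"

text \<open>This is the constant term of \<open>tl_weight\<close>: at \<open>h = 0\<close> every
  crossing is the identity minus a minimum followed by a maximum. For antiparallel strands the two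
  cancel on \<open>x = a\<close> and leave \<open>- 1\<close> on the exchanged pair.\<close>

fun orientation_weight :: "piece \<Rightarrow> (int, real) weight" where
  "orientation_weight Cap a x = of_bool (x ! 0 \<noteq> x ! 1)"
| "orientation_weight Cup a x = of_bool (a ! 0 \<noteq> a ! 1)"
| "orientation_weight (Cross s) a x = of_bool (x = a) - of_bool (a ! 0 \<noteq> a ! 1 \<and> x ! 0 \<noteq> x ! 1)"

lemma transfer_weight_cong:
  assumes "fits m (slices W D) n" "y \<in> words S m"
    and "\<And>p a x. a \<in> words S (top_ends p) \<Longrightarrow> x \<in> words S (bottom_ends p) \<Longrightarrow> W p a x = W' p a x"
  shows "transfer S (slices W D) g y = transfer S (slices W' D) g y"
  using assms(1,2)
proof (induction D arbitrary: m y)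
  case (Cons q D)
  obtain i p where q: "q = (i, p)" by (cases q)
  have f: "i + top_ends p \<le> m" "fits (m - top_ends p + bottom_ends p) (slices W D) n" using Cons.prems q by auto
  show ?case
    using Cons.IH[OF f(2) splice_words[OF Cons.prems(2) _ f(1)]] assms(3)[OF window_words[OF Cons.prems(2) f(1)]]
    by (auto simp: q intro!: sum.cong)
qed simp

lemma words_colours_2:
  "words {0..<2 :: int} 2 = {[0, 0], [0, 1], [1, 0], [1, 1]}"
  by (auto simp: words_def length_2_conv)

lemma two_words_cases:
  assumes "a \<in> words (colours 2) 2"
  obtains "a = [0, 0]" | "a = [0, 1]" | "a = [1, 0]" | "a = [1, 1]"
  using assms unfolding of_nat_numeral words_colours_2 by blast

lemma jones_bracket_nth_0:
  assumes "tangle 0 D 0" "jones_side e = \<kappa>"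
  shows "jones_bracket \<kappa> D $ 0 = closed_sum (colours 2) (slices orientation_weight D)"
proof -
  have "jones_bracket \<kappa> D $ 0 = closed_sum (colours 2) (slices (\<lambda>p a x. tl_weight cap_matrix cup_matrix \<kappa> p a x $ 0) D)"
    unfolding bracket_def
    by (subst transfer_hom[where \<phi> = "\<lambda>f. f $ 0"]) (simp_all add: slices_def comp_def case_prod_unfold)
  also have "\<dots> = closed_sum (colours 2) (slices orientation_weight D)"
  proof (rule transfer_weight_cong[where m = 0 and n = 0])
    show "tl_weight cap_matrix cup_matrix \<kappa> p a x $ 0 = orientation_weight p a x"
      if "a \<in> words (colours 2) (top_ends p)" "x \<in> words (colours 2) (bottom_ends p)" for p a x
    proof -
      note defs = cap_matrix_def cup_matrix_def jones_side_def jones_coefficient_def assms(2)[symmetric]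
      show ?thesis
      proof (cases p)
        case Cap
        then have "x \<in> words (colours 2) 2" using that by simp
        then show ?thesis unfolding Cap by (elim two_words_cases) (simp_all add: defs)
      next
        case Cup
        then have "a \<in> words (colours 2) 2" using that by simp
        then show ?thesis unfolding Cup by (elim two_words_cases) (simp_all add: defs)
      next
        case (Cross s)
        then have "a \<in> words (colours 2) 2" "x \<in> words (colours 2) 2" using that by simp_all
        then show ?thesis unfolding Cross by (elim two_words_cases) (simp_all add: defs)
      qed
    qed
  qed (use assms in simp_all)
  finally show ?thesis .
qed

lemma orientation_weight_abs:
  assumes "a \<in> words (colours 2) (top_ends p)" "x \<in> words (colours 2) (bottom_ends p)"
  shows "\<bar>orientation_weight p a x\<bar> \<le> of_bool (orientation p a x)"
proof (cases p)
  case (Cross s)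
  then have "a \<in> words (colours 2) 2" "x \<in> words (colours 2) 2" using assms by simp_all
  then show ?thesis unfolding Cross by (elim two_words_cases) simp_all
qed simp_all

definition orientation_labels :: "diagram \<Rightarrow> (nat \<Rightarrow> int rel) slice list" where
  "orientation_labels D = slices (\<lambda>p n. if n = 2 then flip_rel p else orientation p) D"

lemma label_at_slices: "label_at k (slices L D) = slices (\<lambda>p. L p k) D"
  by (simp add: label_at_def slices_def case_prod_unfold)

lemma compatibleI:
  assumes "\<And>a a' x x'. \<lbrakk>a \<in> words S t; a' \<in> words S t; x \<in> words S b; x' \<in> words S b; L 0 a x; L 1 a' x'\<rbrakk>
    \<Longrightarrow> L 2 (map2 F a a') (map2 F x x')"
  shows "compatible S F (i, t, b, L)"
  using assms by (simp add: compatible_def)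

lemma orientation_difference:
  assumes "a \<in> words (colours 2) (top_ends p)" "a' \<in> words (colours 2) (top_ends p)"
    and "x \<in> words (colours 2) (bottom_ends p)" "x' \<in> words (colours 2) (bottom_ends p)"
    and "orientation p a x" "orientation p a' x'"
  shows "flip_rel p (map2 (sub_mod 2) a a') (map2 (sub_mod 2) x x')"
proof (cases p)
  case Cap
  then have "x \<in> words (colours 2) 2" "x' \<in> words (colours 2) 2" using assms by simp_all
  then show ?thesis using assms(5,6) unfolding Cap by (elim two_words_cases) (simp_all add: sub_mod_def)
next
  case Cup
  then have "a \<in> words (colours 2) 2" "a' \<in> words (colours 2) 2" using assms by simp_all
  then show ?thesis using assms(5,6) unfolding Cup by (elim two_words_cases) (simp_all add: sub_mod_def)
next
  case (Cross s)
  then have "a \<in> words (colours 2) 2" "a' \<in> words (colours 2) 2" "x \<in> words (colours 2) 2" "x' \<in> words (colours 2) 2"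
    using assms by simp_all
  then show ?thesis using assms(5,6) unfolding Cross by (elim words_2E) simp
qed

lemma compatible_orientation_labels:
  assumes "s \<in> set (orientation_labels D)"
  shows "compatible (colours 2) (sub_mod 2) s"
proof -
  obtain i p where s: "s = (i, top_ends p, bottom_ends p, \<lambda>n. if n = 2 then flip_rel p else orientation p)"
    using assms by (auto simp: orientation_labels_def slices_def)
  show ?thesis
    unfolding s
  proof (rule compatibleI)
    fix a a' x x'
    assume *: "a \<in> words (colours 2) (top_ends p)" "a' \<in> words (colours 2) (top_ends p)"
      "x \<in> words (colours 2) (bottom_ends p)" "x' \<in> words (colours 2) (bottom_ends p)"
    assume "(if (0 :: nat) = 2 then flip_rel p else orientation p) a x" "(if (1 :: nat) = 2 then flip_rel p else orientation p) a' x'"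
    then have "orientation p a x" "orientation p a' x'" by simp_all
    with * have "flip_rel p (map2 (sub_mod 2) a a') (map2 (sub_mod 2) x x')" by (rule orientation_difference)
    then show "(if (2 :: nat) = 2 then flip_rel p else orientation p) (map2 (sub_mod 2) a a') (map2 (sub_mod 2) x x')" by simp
  qed
qed

text \<open>Two orientations differ modulo 2 by a colouring that is constant along the strands, and
  a knot has at most two of those.\<close>

lemma orientations_le_2:
  assumes "knot_diagram D"
  shows "\<bar>closed_sum (colours 2) (slices orientation_weight D)\<bar> \<le> 2"
proof -
  have T: "tangle 0 D 0" using assms by (simp add: knot_diagram_def link_diagram_def)
  let ?L = "slices (\<lambda>p n. if n = (0 :: nat) then orientation_weight p else (\<lambda>a x. of_bool (orientation p a x))) D"
  have "\<bar>transfer (colours 2) (label_at 0 ?L) (\<lambda>_. 1) []\<bar> \<le> transfer (colours 2) (label_at 1 ?L) (\<lambda>_. 1) []"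
  proof (rule transfer_abs_le[where m = 0 and n = 0])
    show "fits 0 (label_at 0 ?L) 0" using T by (simp add: label_at_slices)
    show "\<bar>L 0 a x\<bar> \<le> L 1 a x" if "(i, t, b, L) \<in> set ?L" "a \<in> words (colours 2) t" "x \<in> words (colours 2) b" for i t b L a x
      using that orientation_weight_abs by (auto simp: slices_def)
  qed simp
  also have "\<dots> = real (colourings 2 (slices orientation D))"
    using closed_sum_colourings[of 2 "slices orientation D"] by (simp add: label_at_slices indicators_slices)
  also have "colourings 2 (slices orientation D) = colourings 2 (label_at 0 (orientation_labels D))"
    by (simp add: orientation_labels_def label_at_slices)
  also have "\<dots> \<le> colourings 2 (label_at 2 (orientation_labels D))"
  proof (rule card_paths_fibre)
    show "fits 0 (label_at 0 (orientation_labels D)) 0" using T by (simp add: orientation_labels_def label_at_slices)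
    show "label_at 0 (orientation_labels D) = label_at 1 (orientation_labels D)"
      by (simp add: orientation_labels_def label_at_slices)
  qed (rule compatible_orientation_labels)
  also have "\<dots> = colourings 2 (slices flip_rel D)"
    by (simp add: orientation_labels_def label_at_slices)
  also have "\<dots> \<le> 2"
    using card_flip_paths_knot[OF assms, of "colours 2"] by simp
  finally show ?thesis by (simp add: label_at_slices)
qed

section \<open>The disk of a Delta-move at \<open>h = 0\<close>\<close>

definition triple_weight :: "(int, real) weight" where
  "triple_weight a x = of_bool (a ! 0 \<noteq> a ! 1 \<and> x ! 0 \<noteq> x ! 1 \<and> x ! 2 = a ! 2)
     - of_bool (a ! 1 \<noteq> a ! 2 \<and> x ! 1 \<noteq> x ! 2 \<and> x ! 0 = a ! 0)"

text \<open>The strand that enters the disk at position \<open>j\<close> leaves it at position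
  \<open>2 - j\<close>, which is why \<open>a ! 0\<close> is compared with
  \<open>x ! 2\<close>.\<close>

definition triple_key :: "bool \<times> bool \<times> bool \<Rightarrow> int rel" where
  "triple_key k a x \<longleftrightarrow> k = (a ! 0 \<noteq> x ! 2, a ! 1 \<noteq> x ! 1, a ! 2 \<noteq> x ! 0)"

abbreviation reversal :: "int rel" where
  "reversal \<equiv> triple_key (False, False, False)"

lemma sum_words_3: "(\<Sum>x\<in>words S 3. f x) = (\<Sum>a\<in>S. \<Sum>b\<in>S. \<Sum>c\<in>S. f [a, b, c])"
  by (simp add: numeral_3_eq_3 sum_words_Suc)

lemma length_3_conv: "length a = 3 \<longleftrightarrow> (\<exists>u v w. a = [u, v, w])"
  by (auto simp: numeral_3_eq_3 length_Suc_conv)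

lemma words_3E:
  assumes "a \<in> words S 3" obtains u v w where "a = [u, v, w]" "u \<in> S" "v \<in> S" "w \<in> S"
  using assms by (auto simp: words_def length_3_conv)

lemma triple_transfer:
  assumes "y \<in> words (colours 2) m" "i + 3 \<le> m"
  shows "transfer (colours 2) (slices orientation_weight [(i, Cup), (i, Cap)]) g y -
      transfer (colours 2) (slices orientation_weight [(Suc i, Cup), (Suc i, Cap)]) g y =
      transfer (colours 2) [(i, 3, 3, triple_weight)] g y"
proof -
  obtain l a r where "y = l @ a @ r" and l: "length l = i" and "a \<in> words (colours 2) 3"
    using words_split[OF assms] by metis
  then obtain u v w where y: "y = l @ [u, v, w] @ r" and uvw: "u \<in> colours 2" "v \<in> colours 2" "w \<in> colours 2"
    by (auto elim: words_3E)
  have 1: "transfer (colours 2) (slices orientation_weight [(i, Cup), (i, Cap)]) g y =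
      of_bool (u \<noteq> v) * (g (l @ [0, 1, w] @ r) + g (l @ [1, 0, w] @ r))"
    unfolding y using l by (simp add: sum_words_2 sum_colours_2[simplified] algebra_simps)
  have 2: "transfer (colours 2) (slices orientation_weight [(Suc i, Cup), (Suc i, Cap)]) g y =
      of_bool (v \<noteq> w) * (g (l @ [u, 0, 1] @ r) + g (l @ [u, 1, 0] @ r))"
    unfolding y using l by (simp add: sum_words_2 sum_colours_2[simplified] algebra_simps)
  have 3: "transfer (colours 2) [(i, 3, 3, triple_weight)] g y =
      (\<Sum>a\<in>colours 2. \<Sum>b\<in>colours 2. \<Sum>c\<in>colours 2. triple_weight [u, v, w] [a, b, c] * g (l @ [a, b, c] @ r))"
    unfolding y using l by (simp add: sum_words_3)
  show ?thesis
    unfolding 1 2 3 sum_colours_2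
    using uvw unfolding colours_2 by (auto simp: triple_weight_def)
qed

lemma triple_flip:
  assumes "y \<in> words (colours 2) m" "i + 3 \<le> m"
  shows "transfer {0, 1} [(i, 3, 3, \<lambda>a x. of_bool (reversal a x))] g y =
    transfer {0, 1} (slices flip_weight [(i, Cross x), (Suc i, Cross w), (i, Cross z)]) g y"
proof -
  obtain l a r where "y = l @ a @ r" and l: "length l = i" and "a \<in> words (colours 2) 3"
    using words_split[OF assms] by metis
  then obtain p q t where y: "y = l @ [p, q, t] @ r" and pqt: "p \<in> {0, 1}" "q \<in> {0, 1}" "t \<in> {0, 1}"
    unfolding colours_2 by (auto elim: words_3E)
  have "transfer {0, 1} [(i, 3, 3, \<lambda>a x. of_bool (reversal a x))] g y =
      (\<Sum>a\<in>{0, 1}. \<Sum>b\<in>{0, 1}. \<Sum>c\<in>{0, 1}. of_bool (reversal [p, q, t] [a, b, c]) * g (l @ [a, b, c] @ r))"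
    unfolding y using l by (simp add: sum_words_3)
  also have "\<dots> = g (l @ [t, q, p] @ r)"
    using pqt by (auto simp: triple_key_def)
  finally have *: "transfer {0, 1} [(i, 3, 3, \<lambda>a x. of_bool (reversal a x))] g y = g (l @ [t, q, p] @ r)" .
  show "transfer {0, 1} [(i, 3, 3, \<lambda>a x. of_bool (reversal a x))] g y =
    transfer {0, 1} (slices flip_weight [(i, Cross x), (Suc i, Cross w), (i, Cross z)]) g y"
    unfolding * unfolding y by (rule flip_triple_window(1)[OF pqt l, symmetric])
qed

text \<open>The slice \<open>reversal\<close> carries colours from top to bottom exactly as the
  three crossings do, so the count is that of the knot diagram.\<close>

lemma colourings_triple_flip:
  assumes "knot_diagram (u @ [(i, Cross x), (Suc i, Cross w), (i, Cross z)] @ v)"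
  shows "colourings 2 (slices flip_rel u @ (i, 3, 3, reversal) # slices flip_rel v) = 2"
proof -
  let ?l = "[(i, Cross x), (Suc i, Cross w), (i, Cross z)]"
  let ?t = "(i, 3, 3, reversal)"
  have "link_diagram (u @ ?l @ v)" using assms by (simp add: knot_diagram_def)
  then obtain k n where k: "tangle 0 u k" "tangle k ?l n"
    by (rule link_diagram_split)
  have "int (colourings 2 (slices flip_rel u @ ?t # slices flip_rel v)) =
     closed_sum {0, 1} (indicators (slices flip_rel u @ ?t # slices flip_rel v))"
    using transfer_indicators[of "{0, 1 :: int}" "slices flip_rel u @ ?t # slices flip_rel v" "[]", where 'r = int]
    unfolding colours_2 by simp
  also have "\<dots> = closed_sum {0, 1} (slices flip_weight u @ [(i, 3, 3, \<lambda>a x. of_bool (reversal a x))] @ slices flip_weight v)"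
    by (simp add: indicators_slices flip_weight_def[abs_def])
  also have "\<dots> = 1 * closed_sum {0, 1} (slices flip_weight u @ slices flip_weight ?l @ slices flip_weight v)"
  proof (rule transfer_replace[where m = 0 and k = k])
    have "i + 3 \<le> k" using k(2) by auto
    then show "transfer {0, 1} [(i, 3, 3, \<lambda>a x. of_bool (reversal a x))] g y =
        1 * transfer {0, 1} (slices flip_weight ?l) g y" if "y \<in> words {0, 1} k" for g y
      using triple_flip[of y k i g x w z] that unfolding colours_2 mult_1 by blast
  qed (use k in simp_all)
  also have "\<dots> = int (flip_count (u @ ?l @ v))"
    unfolding flip_count_transfer by simp
  finally show ?thesis using flip_count_knot[OF assms] by simp
qed

lemma sub_mod_2_eq:
  assumes "p \<in> colours 2" "q \<in> colours 2" "p' \<in> colours 2" "q' \<in> colours 2" "(p \<noteq> q) = (p' \<noteq> q')"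
  shows "sub_mod 2 p p' = sub_mod 2 q q'"
proof -
  have "p = 0 \<or> p = 1" "q = 0 \<or> q = 1" "p' = 0 \<or> p' = 1" "q' = 0 \<or> q' = 1"
    using assms(1-4) unfolding colours_2 by simp_all
  then show ?thesis using assms(5) by (elim disjE) (simp_all add: sub_mod_def)
qed

lemma triple_key_difference:
  assumes "a \<in> words (colours 2) 3" "a' \<in> words (colours 2) 3" "x \<in> words (colours 2) 3" "x' \<in> words (colours 2) 3"
    and "triple_key k a x" "triple_key k a' x'"
  shows "reversal (map2 (sub_mod 2) a a') (map2 (sub_mod 2) x x')"
proof -
  obtain p q t where a: "a = [p, q, t]" "p \<in> colours 2" "q \<in> colours 2" "t \<in> colours 2" using assms(1) by (rule words_3E)
  obtain p' q' t' where a': "a' = [p', q', t']" "p' \<in> colours 2" "q' \<in> colours 2" "t' \<in> colours 2" using assms(2) by (rule words_3E)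
  obtain f g h where x: "x = [f, g, h]" "f \<in> colours 2" "g \<in> colours 2" "h \<in> colours 2" using assms(3) by (rule words_3E)
  obtain f' g' h' where x': "x' = [f', g', h']" "f' \<in> colours 2" "g' \<in> colours 2" "h' \<in> colours 2" using assms(4) by (rule words_3E)
  have "(p \<noteq> h) = (p' \<noteq> h')" "(q \<noteq> g) = (q' \<noteq> g')" "(t \<noteq> f) = (t' \<noteq> f')"
    using assms(5,6) unfolding triple_key_def a(1) a'(1) x(1) x'(1) by auto
  then show ?thesis
    using sub_mod_2_eq[OF a(2) x(4) a'(2) x'(4)] sub_mod_2_eq[OF a(3) x(3) a'(3) x'(3)] sub_mod_2_eq[OF a(4) x(2) a'(4) x'(2)]
    by (simp add: triple_key_def a(1) a'(1) x(1) x'(1))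
qed

text \<open>The key records which of the three strands change orientation across the disk. If none does,
  the two terms of \<open>triple_weight\<close> agree, so three keys remain, with two orientations each.\<close>

lemma triple_weight_keys:
  assumes "a \<in> words (colours 2) 3" "x \<in> words (colours 2) 3"
  shows "\<bar>triple_weight a x\<bar> \<le> of_bool (\<exists>k\<in>{(True, True, False), (True, False, True), (False, True, True)}. triple_key k a x)"
proof -
  obtain p q t where a: "a = [p, q, t]" "p \<in> colours 2" "q \<in> colours 2" "t \<in> colours 2" using assms(1) by (rule words_3E)
  obtain f g h where x: "x = [f, g, h]" "f \<in> colours 2" "g \<in> colours 2" "h \<in> colours 2" using assms(2) by (rule words_3E)
  have "p = 0 \<or> p = 1" "q = 0 \<or> q = 1" "t = 0 \<or> t = 1" "f = 0 \<or> f = 1" "g = 0 \<or> g = 1" "h = 0 \<or> h = 1"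
    using a x unfolding colours_2 by auto
  then show ?thesis
    unfolding a(1) x(1) by (elim disjE) (simp_all add: triple_weight_def triple_key_def)
qed

text \<open>Only three keys have nonzero weight. Two orientations with the same key differ by a
  colouring that is constant along the strands of the knot, so each key admits at most two.\<close>

lemma triple_difference_bound:
  assumes "colourings 2 (slices flip_rel u @ (i, 3, 3, reversal) # slices flip_rel v) = 2"
    and "tangle 0 u k" "i + 3 \<le> k" "tangle k v 0"
  shows "\<bar>closed_sum (colours 2) (slices orientation_weight u @ (i, 3, 3, triple_weight) # slices orientation_weight v)\<bar> \<le> 6"
proof -
  let ?K = "{(True, True, False), (True, False, True), (False, True, True)}"
  let ?L = "slices (\<lambda>p n. if n = (0 :: nat) then orientation_weight p else (\<lambda>a x. of_bool (orientation p a x)))"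
  let ?T = "\<lambda>n. if n = (0 :: nat) then triple_weight else (\<lambda>a x. of_bool (\<exists>k\<in>?K. triple_key k a x))"
  let ?sl = "?L u @ (i, 3, 3, ?T) # ?L v"
  let ?C = "\<lambda>R. colourings 2 (slices orientation u @ (i, 3, 3, R) # slices orientation v)"
  have kk: "k - 3 + 3 = k" using assms(3) by simp
  have fits: "fits 0 (slices W u @ (i, 3, 3, w) # slices W' v) 0" for W :: "piece \<Rightarrow> 'a" and W' w
    unfolding fits_append fits.simps using assms kk by (intro exI[of _ k]) simp
  have "\<bar>transfer (colours 2) (label_at 0 ?sl) (\<lambda>_. 1) []\<bar> \<le> transfer (colours 2) (label_at 1 ?sl) (\<lambda>_. 1) []"
  proof (rule transfer_abs_le[where m = 0 and n = 0])
    show "fits 0 (label_at 0 ?sl) 0" using fits by (simp add: label_at_slices)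
    fix j t b L a x assume s: "(j, t, b, L) \<in> set ?sl" and w: "a \<in> words (colours 2) t" "x \<in> words (colours 2) b"
    from s consider "t = 3" "b = 3" "L = ?T" | D where "(j, t, b, L) \<in> set (?L D)" by auto
    then show "\<bar>L 0 a x\<bar> \<le> L 1 a x"
    proof cases
      case 1
      then show ?thesis using triple_weight_keys w by simp
    next
      case 2
      then obtain p where "t = top_ends p" "b = bottom_ends p" "L 0 = orientation_weight p" "L 1 = (\<lambda>a x. of_bool (orientation p a x))"
        by (auto simp: slices_def)
      then show ?thesis using orientation_weight_abs w by simp
    qed
  qed simp
  also have "\<dots> = real (?C (\<lambda>a x. \<exists>k\<in>?K. triple_key k a x))"
    using closed_sum_colourings[of 2 "slices orientation u @ (i, 3, 3, \<lambda>a x. \<exists>k\<in>?K. triple_key k a x) # slices orientation v"]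
    by (simp add: label_at_slices indicators_slices)
  also have "?C (\<lambda>a x. \<exists>k\<in>?K. triple_key k a x) \<le> card (\<Union>k\<in>?K. paths (colours 2) (slices orientation u @ (i, 3, 3, triple_key k) # slices orientation v) [])"
  proof (rule card_mono)
    show "finite (\<Union>k\<in>?K. paths (colours 2) (slices orientation u @ (i, 3, 3, triple_key k) # slices orientation v) [])"
      by (intro finite_UN_I finite_paths) auto
    show "paths (colours 2) (slices orientation u @ (i, 3, 3, \<lambda>a x. \<exists>k\<in>?K. triple_key k a x) # slices orientation v) [] \<subseteq>
      (\<Union>k\<in>?K. paths (colours 2) (slices orientation u @ (i, 3, 3, triple_key k) # slices orientation v) [])"
      by (rule paths_cover_slot[OF fits]) simp_all
  qed
  also have "\<dots> \<le> (\<Sum>k\<in>?K. ?C (triple_key k))"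
    by (rule card_UN_le) simp
  also have "\<dots> \<le> (\<Sum>k\<in>?K. 2)"
  proof (rule sum_mono)
    fix k
    let ?l = "orientation_labels u @ (i, 3, 3, \<lambda>n. if n = (2 :: nat) then reversal else triple_key k) # orientation_labels v"
    have at: "label_at 0 ?l = slices orientation u @ (i, 3, 3, triple_key k) # slices orientation v"
      "label_at 1 ?l = slices orientation u @ (i, 3, 3, triple_key k) # slices orientation v"
      "label_at 2 ?l = slices flip_rel u @ (i, 3, 3, reversal) # slices flip_rel v"
      by (simp_all add: orientation_labels_def label_at_slices)
    have "colourings 2 (label_at 0 ?l) \<le> colourings 2 (label_at 2 ?l)"
    proof (rule card_paths_fibre)
      show "label_at 0 ?l = label_at 1 ?l" unfolding at ..
      show "fits 0 (label_at 0 ?l) 0" unfolding at by (rule fits)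
      have slot: "compatible (colours 2) (sub_mod 2) (i, 3, 3, \<lambda>n. if n = (2 :: nat) then reversal else triple_key k)"
      proof (rule compatibleI)
        fix a a' x x' :: "int list"
        assume *: "a \<in> words (colours 2) 3" "a' \<in> words (colours 2) 3" "x \<in> words (colours 2) 3" "x' \<in> words (colours 2) 3"
        assume "(if (0 :: nat) = 2 then reversal else triple_key k) a x"
          "(if (1 :: nat) = 2 then reversal else triple_key k) a' x'"
        then have "triple_key k a x" "triple_key k a' x'" by simp_all
        with * have "reversal (map2 (sub_mod 2) a a') (map2 (sub_mod 2) x x')"
          by (rule triple_key_difference)
        then show "(if (2 :: nat) = 2 then reversal else triple_key k) (map2 (sub_mod 2) a a') (map2 (sub_mod 2) x x')" by simp
      qed
      show "compatible (colours 2) (sub_mod 2) s" if "s \<in> set ?l" for s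
        using that slot compatible_orientation_labels[of s]
        by (simp only: set_append list.set Un_iff insert_iff) blast
    qed
    then show "?C (triple_key k) \<le> 2" unfolding at assms(1) .
  qed
  finally show ?thesis by (simp add: label_at_slices)
qed

text \<open>By \<open>triple_difference\<close> the two sides differ by \<open>c\<close> times the
  difference of two planar smoothings. As \<open>c\<close> begins with \<open>4 h\<^sup>2\<close>,
  only the constant term of the latter matters, and it is at most \<open>6\<close> in absolute
  value.\<close>

lemma triple_bracket_difference:
  assumes "knot_diagram (u @ [(i, Cross x), (Suc i, Cross (\<not> x)), (i, Cross x)] @ v)"
  obtains Y where
    "jones_bracket (jones_side e) (u @ [(i, Cross x), (Suc i, Cross (\<not> x)), (i, Cross x)] @ v) =
     jones_bracket (jones_side e) (u @ [(Suc i, Cross x), (i, Cross (\<not> x)), (Suc i, Cross x)] @ v) + Y"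
    "Y $ 0 = 0" "Y $ 1 = 0" "\<bar>Y $ 2\<bar> \<le> 24"
proof -
  interpret e: tl_model "colours 2" cap_matrix cup_matrix "jones_side e" by (rule jones_side_model)
  let ?l = "[(i, Cross x), (Suc i, Cross (\<not> x)), (i, Cross x)]" and ?r = "[(Suc i, Cross x), (i, Cross (\<not> x)), (Suc i, Cross x)]"
  let ?E = "\<lambda>i. [(i, Cup), (i, Cap)] :: diagram"
  have "link_diagram (u @ ?l @ v)" using assms by (simp add: knot_diagram_def)
  then obtain k n where kn: "tangle 0 u k" "tangle k ?l n" "tangle n v 0"
    by (rule link_diagram_split)
  have ik: "i + 3 \<le> k" using kn(2) by auto
  then have "tangle k ?l k" using le_add_diff_inverse2[of 2 k] by (auto simp del: add_2_eq_Suc')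
  then have [simp]: "n = k" using kn(2) tangle_unique by blast
  define c where "c = jones_side e x + jones_side e x + jones_side e x * jones_side e x * e.\<delta> +
    jones_side e x * jones_side e (\<not> x) * jones_side e x - jones_side e (\<not> x)"
  let ?b = "\<lambda>D. e.P D (\<lambda>_. 1) []"
  let ?g = "e.P v (\<lambda>_. 1)"
  have "e.P ?l ?g z = e.P ?r ?g z + c * (e.P (?E i) ?g z + (- 1) * e.P (?E (Suc i)) ?g z)" if "z \<in> words (colours 2) k" for z
    using e.triple_difference[OF that ik, of x "\<not> x" x ?g] by (simp add: c_def algebra_simps)
  then have "?b (u @ ?l @ v) = e.P u (\<lambda>z. e.P ?r ?g z + c * (e.P (?E i) ?g z + (- 1) * e.P (?E (Suc i)) ?g z)) []"
    unfolding e.P_append by (intro e.P_cong[OF kn(1)]) simp_all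
  also have "\<dots> = ?b (u @ ?r @ v) + c * (?b (u @ ?E i @ v) + (- 1) * ?b (u @ ?E (Suc i) @ v))"
    by (simp only: e.P_add e.P_scale e.P_append[abs_def])
  finally have eq: "jones_bracket (jones_side e) (u @ ?l @ v) = jones_bracket (jones_side e) (u @ ?r @ v) +
      c * (jones_bracket (jones_side e) (u @ ?E i @ v) - jones_bracket (jones_side e) (u @ ?E (Suc i) @ v))"
    unfolding e.bracket_P by simp
  define a where "a = (if x = e then - 1 else 1 :: real)"
  have js: "jones_side e x = - fps_exp a" "jones_side e (\<not> x) = - fps_exp (- a)"
    by (auto simp: jones_side_def jones_coefficient_def a_def)
  have "e.\<delta> = fps_exp a + fps_exp (- a)"
    unfolding e.\<delta>_split[of x] js by simp
  \<comment> \<open>The multiplicities \<open>1 + 1 - 2\<close> add up to zero, and so do the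
    weighted exponents \<open>3 a - a - 2 a\<close>; half of \<open>9 + 1 - 2\<close> is the
    quadratic coefficient \<open>4\<close>.\<close>
  then have "c = fps_exp (3 * a) + fps_exp (- a) - 2 * fps_exp a"
    unfolding c_def js by (simp add: algebra_simps flip: fps_exp_add_mult)
  moreover have "a\<^sup>2 = 1" by (simp add: a_def)
  ultimately have c: "c $ 0 = 0" "c $ 1 = 0" "c $ 2 = 4"
    by (simp_all add: fps_exp_nths fps_mult_nths power_mult_distrib numeral_fps_const del: One_nat_def fps_exp_nth)
  let ?d = "jones_bracket (jones_side e) (u @ ?E i @ v) - jones_bracket (jones_side e) (u @ ?E (Suc i) @ v)"
  have T: "tangle 0 (u @ ?E j @ v) 0" if "j + 2 \<le> k" for j
  proof -
    have "tangle k (?E j) k" using that le_add_diff_inverse2[of 2 k] by (simp del: add_2_eq_Suc')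
    then show ?thesis using kn by (auto simp only: tangle_append \<open>n = k\<close>)
  qed
  let ?O = "\<lambda>D. closed_sum (colours 2) (slices orientation_weight D)"
  let ?h = "transfer (colours 2) (slices orientation_weight v) (\<lambda>_. 1)"
  have "?d $ 0 = ?O (u @ ?E i @ v) - ?O (u @ ?E (Suc i) @ v)"
    using jones_bracket_nth_0[OF T refl] ik by simp
  also have "\<dots> = transfer (colours 2) (slices orientation_weight u)
      (\<lambda>z. transfer (colours 2) (slices orientation_weight (?E i)) ?h z +
        (- 1) * transfer (colours 2) (slices orientation_weight (?E (Suc i))) ?h z) []"
  proof -
    have minus: "p - q = p + (- 1) * q" for p q :: real by simp
    show ?thesis
      unfolding minus by (simp only: transfer_add transfer_scale slices_simps(3) transfer_append[abs_def])
  qed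
  also have "\<dots> = transfer (colours 2) (slices orientation_weight u) (transfer (colours 2) [(i, 3, 3, triple_weight)] ?h) []"
  proof (rule transfer_cong[where m = 0 and n = k])
    fix z assume "z \<in> words (colours 2) k"
    from triple_transfer[OF this ik, of ?h]
    show "transfer (colours 2) (slices orientation_weight (?E i)) ?h z +
        (- 1) * transfer (colours 2) (slices orientation_weight (?E (Suc i))) ?h z =
        transfer (colours 2) [(i, 3, 3, triple_weight)] ?h z" by linarith
  qed (use kn in simp_all)
  also have "\<dots> = closed_sum (colours 2) (slices orientation_weight u @ [(i, 3, 3, triple_weight)] @ slices orientation_weight v)"
    by (simp only: transfer_append[abs_def])
  finally have "\<bar>?d $ 0\<bar> \<le> 6"
    using triple_difference_bound[OF colourings_triple_flip[OF assms] kn(1) ik] kn(3) by simp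
  then have "\<bar>(c * ?d) $ 2\<bar> \<le> 24" unfolding fps_mult_nths c by simp
  moreover have "(c * ?d) $ 0 = 0" "(c * ?d) $ 1 = 0" unfolding fps_mult_nths c by simp_all
  ultimately show ?thesis using that[OF eq] by blast
qed

text \<open>The differences of the brackets begin in degree two. So in that degree the product
  changes only by a constant term, at most \<open>2\<close>, times a quadratic coefficient, at most
  \<open>24\<close>, once for each factor.\<close>

lemma conway_invariant_delta:
  assumes "local_move delta D D'"
  shows "\<bar>conway_invariant D - conway_invariant D'\<bar> \<le> 96"
proof -
  from assms obtain u l r v where D: "D = u @ l @ v" "D' = u @ r @ v" and lr: "delta l r" and
    K: "knot_diagram D" "knot_diagram D'"
    unfolding local_move_def by blast
  from lr obtain i x y z where "l = [(i, Cross x), (Suc i, Cross y), (i, Cross z)]"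
    "r = [(Suc i, Cross z), (i, Cross y), (Suc i, Cross x)]" "x = z" "y \<noteq> x"
    by (rule delta.cases)
  moreover from this have "y = (\<not> x)" by simp
  ultimately have l: "l = [(i, Cross x), (Suc i, Cross (\<not> x)), (i, Cross x)]"
    "r = [(Suc i, Cross x), (i, Cross (\<not> x)), (Suc i, Cross x)]"
    by simp_all
  let ?J = "\<lambda>e. jones_bracket (jones_side e)"
  have "\<exists>Y. ?J e D = ?J e D' + Y \<and> Y $ 0 = 0 \<and> Y $ 1 = 0 \<and> \<bar>Y $ 2\<bar> \<le> 24" for e
    using triple_bracket_difference[of u i x v e] K(1) unfolding D l by blast
  then obtain Y where Y: "?J e D = ?J e D' + Y e" "Y e $ 0 = 0" "Y e $ 1 = 0" "\<bar>Y e $ 2\<bar> \<le> 24" for e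
    by metis
  have T: "tangle 0 D' 0" using K(2) by (simp add: knot_diagram_def link_diagram_def)
  have J0: "\<bar>?J e D' $ 0\<bar> \<le> 2" for e
    using jones_bracket_nth_0[OF T refl, of e] orientations_le_2[OF K(2)] by simp
  have "conway_invariant D - conway_invariant D' = ?J True D' $ 0 * Y False $ 2 + Y True $ 2 * ?J False D' $ 0"
    unfolding conway_invariant_sides Y(1) fps_mult_nths by (simp add: Y(2,3) algebra_simps del: One_nat_def)
  moreover have "\<bar>?J True D' $ 0 * Y False $ 2\<bar> \<le> 2 * 24" "\<bar>Y True $ 2 * ?J False D' $ 0\<bar> \<le> 24 * 2"
    unfolding abs_mult by (intro mult_mono J0 Y; simp)+
  ultimately show ?thesis by linarith
qed

section \<open>Unknotting twist knots\<close>

lemma diagram_of_isotopic: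
  assumes "diagram_of D K" "diagram_of D' K"
  shows "isotopic D D'"
proof -
  have "isotopic D D" "isotopic D' D'"
    using assms by (simp_all add: diagram_of_def isotopic_def)
  then show ?thesis
    using assms Quotient3_rel[OF Quotient3_knot] unfolding diagram_of_def by metis
qed

lemma isotopic_diagram_of:
  assumes "isotopic D D'" "diagram_of D K"
  shows "diagram_of D' K"
proof -
  have "isotopic D' D'" using assms by (simp add: isotopic_def)
  then have "abs_knot D = abs_knot D'"
    using assms Quotient3_rel[OF Quotient3_knot, of D D'] unfolding isotopic_def by auto
  then show ?thesis using assms by (simp add: diagram_of_def isotopic_def)
qed

text \<open>Stepwise isotopies of link diagrams; \<open>isotopic\<close> itself asks for knot diagrams, which is only
  checked at one end of a chain of moves.\<close>

definition plane_move :: "diagram \<Rightarrow> diagram \<Rightarrow> bool" where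
  "plane_move D D' \<longleftrightarrow> link_diagram D \<and> link_diagram D' \<and>
     (\<exists>u l r v. D = u @ l @ v \<and> D' = u @ r @ v \<and> (isotopy l r \<or> isotopy r l))"

lemma plane_moves_isotopic:
  assumes "plane_move\<^sup>*\<^sup>* D D'" "knot_diagram D"
  shows "isotopic D D'"
  using assms
proof (induction rule: rtranclp_induct)
  case base
  then show ?case by (simp add: isotopic_def)
next
  case (step y z)
  then have y: "isotopic D y" by simp
  then have "knot_diagram y" by (simp add: isotopic_def)
  moreover obtain u l r v where m: "y = u @ l @ v" "z = u @ r @ v" "isotopy l r \<or> isotopy r l" "link_diagram z"
    using step(2) unfolding plane_move_def by blast
  ultimately have z: "knot_diagram z"
    using knot_diagram_replace[of l r u v] by auto
  then have "local_move isotopy y z \<or> local_move isotopy z y"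
    using m \<open>knot_diagram y\<close> unfolding local_move_def by blast
  then have "equivclp (local_move isotopy) D z"
    using y unfolding isotopic_def by (meson equivclp_into_equivclp)
  then show ?case using y z by (simp add: isotopic_def)
qed

lemma plane_move_sym: "plane_move D D' \<Longrightarrow> plane_move D' D"
  unfolding plane_move_def by blast

lemma plane_moves_sym:
  assumes "plane_move\<^sup>*\<^sup>* D D'"
  shows "plane_move\<^sup>*\<^sup>* D' D"
  using assms by (induction rule: rtranclp_induct) (auto intro: converse_rtranclp_into_rtranclp plane_move_sym)

lemma plane_moveI:
  assumes "isotopy l r \<or> isotopy r l" "D = u @ l @ v" "D' = u @ r @ v" "link_diagram D" "link_diagram D'"
  shows "plane_move D D'"
  using assms unfolding plane_move_def by blast

lemma tangle_replicate_Cross [simp]: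
  "tangle m (replicate p (i, Cross s) @ D) n \<longleftrightarrow> (p = 0 \<or> i + 2 \<le> m) \<and> tangle m D n"
proof (induction p)
  case (Suc p)
  show ?case
  proof (cases "i + 2 \<le> m")
    case True
    then have "m - 2 + 2 = m" by simp
    then show ?thesis using Suc True by (simp del: add_2_eq_Suc')
  qed simp
qed simp

lemma tangle_replicate_Cross_Nil [simp]:
  "tangle m (replicate p (i, Cross s)) n \<longleftrightarrow> (p = 0 \<or> i + 2 \<le> m) \<and> m = n"
  using tangle_replicate_Cross[of m p i s "[]" n] by simp

lemma plane_move_in_context:
  assumes "isotopy l r"
  shows "link_diagram (u @ l @ v) \<Longrightarrow> link_diagram (u @ r @ v) \<Longrightarrow> plane_move (u @ l @ v) (u @ r @ v)"
    "link_diagram (u @ l @ v) \<Longrightarrow> link_diagram (u @ r @ v) \<Longrightarrow> plane_move (u @ r @ v) (u @ l @ v)"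
  using assms by (auto intro: plane_moveI)

text \<open>Positions and over/under bits enter through equations, so that the rules unify with
  concrete values.\<close>

lemma isotopy_shifted:
  "\<lbrakk>j = i + bottom_ends p + k; j' = i + top_ends p + k\<rbrakk> \<Longrightarrow> isotopy [(i, p), (j, q)] [(j', q), (i, p)]"
  "j = Suc i \<Longrightarrow> isotopy [(i, Cap), (j, Cup)] []"
  "j = Suc i \<Longrightarrow> isotopy [(j, Cap), (i, Cup)] []"
  "\<lbrakk>j = Suc i; s' = (\<not> s)\<rbrakk> \<Longrightarrow> isotopy [(i, Cap), (j, Cross s)] [(j, Cap), (i, Cross s')]"
  "\<lbrakk>j = Suc i; s' = (\<not> s)\<rbrakk> \<Longrightarrow> isotopy [(j, Cross s), (i, Cup)] [(i, Cross s'), (j, Cup)]"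
  "s' = (\<not> s) \<Longrightarrow> isotopy [(i, Cross s), (i, Cross s')] []"
  "\<lbrakk>j = Suc i; \<not> (x = z \<and> y \<noteq> x)\<rbrakk> \<Longrightarrow> isotopy [(i, Cross x), (j, Cross y), (i, Cross z)] [(j, Cross z), (i, Cross y), (j, Cross x)]"
  by (auto intro: isotopy.intros)

text \<open>Four strands, with maxima and minima at the ends as in a two-bridge knot.\<close>

definition four_plat :: "diagram \<Rightarrow> diagram" where
  "four_plat w = [(0, Cap), (0, Cap)] @ w @ [(1, Cup), (0, Cup)]"

definition twist_knot :: "nat \<Rightarrow> diagram" where
  "twist_knot r = four_plat ([(1, Cross False), (1, Cross False)] @ replicate r (2, Cross True))"

lemma pass_minimum:
  assumes "tangle 0 u k" "6 \<le> k" "tangle (k - 2) v 0"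
  shows "plane_move\<^sup>*\<^sup>* (u @ replicate r (4, Cross s) @ (1, Cup) # v) (u @ (1, Cup) # replicate r (2, Cross s) @ v)"
  using assms(1)
proof (induction r arbitrary: u)
  case (Suc r)
  have k: "k - 2 + 2 = k" "k - 4 + 2 = k - 2" using assms(2) by simp_all
  have T: "tangle 0 (u @ [(4, Cross s)]) k" "tangle 0 (u @ [(1, Cup)]) (k - 2)"
    using Suc.prems assms(2) k by (auto simp: tangle_append simp del: add_2_eq_Suc')
  have "plane_move\<^sup>*\<^sup>* (u @ replicate (Suc r) (4, Cross s) @ (1, Cup) # v) (u @ [(4, Cross s), (1, Cup)] @ replicate r (2, Cross s) @ v)"
    using Suc.IH[OF T(1)] by simp
  also have "plane_move (u @ [(4, Cross s), (1, Cup)] @ replicate r (2, Cross s) @ v) (u @ [(1, Cup), (2, Cross s)] @ replicate r (2, Cross s) @ v)"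
  proof (rule plane_move_in_context(2))
    show "isotopy [(1, Cup), (2, Cross s)] [(4, Cross s), (1, Cup)]"
      by (rule isotopy_shifted(1)[where k = 1]) simp_all
    have R: "tangle (k - 2) (replicate r (2, Cross s) @ v) 0" using assms(2,3) by (simp add: le_diff_conv2)
    show "link_diagram (u @ [(1, Cup), (2, Cross s)] @ replicate r (2, Cross s) @ v)"
      unfolding link_diagram_def tangle_append[of 0 u] using Suc.prems assms(2) R k
      by (intro exI[of _ k]) (simp del: add_2_eq_Suc' tangle_replicate_Cross)
    show "link_diagram (u @ [(4, Cross s), (1, Cup)] @ replicate r (2, Cross s) @ v)"
      unfolding link_diagram_def tangle_append[of 0 u] using Suc.prems assms(2) R k
      by (intro exI[of _ k]) (simp del: add_2_eq_Suc' tangle_replicate_Cross)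
  qed
  finally show ?case by simp
qed simp

lemma pretzel_diagram_1_1:
  "pretzel_diagram [1, 1, int r] =
    [(0, Cap), (1, Cap), (3, Cap), (0, Cross True), (2, Cross True)] @ replicate r (4, Cross True) @ [(3, Cup), (1, Cup), (0, Cup)]"
  by (cases r) (simp_all add: pretzel_diagram_def numeral_3_eq_3 nat_add_distrib replicate_append_same)

text \<open>The two single crossings slide over maxima to become the clasp. The long column then
  passes a minimum on its left, and the maximum and minimum left between the two clasp crossings
  cancel.\<close>

lemma pretzel_twist_knot: "plane_move\<^sup>*\<^sup>* (pretzel_diagram [1, 1, int r]) (twist_knot r)"
proof -
  let ?a = "\<lambda>i. replicate r (i, Cross True)"
  have 1: "plane_move ([(0, Cap), (1, Cap)] @ [(3, Cap), (0, Cross True)] @ [(2, Cross True)] @ ?a 4 @ [(3, Cup), (1, Cup), (0, Cup)])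
    ([(0, Cap), (1, Cap)] @ [(0, Cross True), (3, Cap)] @ [(2, Cross True)] @ ?a 4 @ [(3, Cup), (1, Cup), (0, Cup)])"
    by (rule plane_move_in_context(2)[OF isotopy_shifted(1)[where k = 1]]) (simp_all add: link_diagram_def)
  have 2: "plane_move ([(0, Cap)] @ [(1, Cap), (0, Cross True)] @ [(3, Cap), (2, Cross True)] @ ?a 4 @ [(3, Cup), (1, Cup), (0, Cup)])
    ([(0, Cap)] @ [(0, Cap), (1, Cross False)] @ [(3, Cap), (2, Cross True)] @ ?a 4 @ [(3, Cup), (1, Cup), (0, Cup)])"
    by (rule plane_move_in_context(2)[OF isotopy_shifted(4)]) (simp_all add: link_diagram_def)
  have 3: "plane_move ([(0, Cap), (0, Cap), (1, Cross False)] @ [(3, Cap), (2, Cross True)] @ ?a 4 @ [(3, Cup), (1, Cup), (0, Cup)])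
    ([(0, Cap), (0, Cap), (1, Cross False)] @ [(2, Cap), (3, Cross False)] @ ?a 4 @ [(3, Cup), (1, Cup), (0, Cup)])"
    by (rule plane_move_in_context(2)[OF isotopy_shifted(4)]) (simp_all add: link_diagram_def)
  have 4: "plane_move (([(0, Cap), (0, Cap), (1, Cross False), (2, Cap), (3, Cross False)] @ ?a 4) @ [(3, Cup), (1, Cup)] @ [(0, Cup)])
    (([(0, Cap), (0, Cap), (1, Cross False), (2, Cap), (3, Cross False)] @ ?a 4) @ [(1, Cup), (1, Cup)] @ [(0, Cup)])"
    by (rule plane_move_in_context(2)[OF isotopy_shifted(1)[where k = 0]]) (simp_all add: link_diagram_def)
  have 5: "plane_move\<^sup>*\<^sup>* ([(0, Cap), (0, Cap), (1, Cross False), (2, Cap), (3, Cross False)] @ ?a 4 @ (1, Cup) # [(1, Cup), (0, Cup)])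
    ([(0, Cap), (0, Cap), (1, Cross False), (2, Cap), (3, Cross False)] @ (1, Cup) # ?a 2 @ [(1, Cup), (0, Cup)])"
    by (rule pass_minimum[where k = 6]) simp_all
  have 6: "plane_move ([(0, Cap), (0, Cap), (1, Cross False), (2, Cap)] @ [(3, Cross False), (1, Cup)] @ ?a 2 @ [(1, Cup), (0, Cup)])
    ([(0, Cap), (0, Cap), (1, Cross False), (2, Cap)] @ [(1, Cup), (1, Cross False)] @ ?a 2 @ [(1, Cup), (0, Cup)])"
    by (rule plane_move_in_context(2)[OF isotopy_shifted(1)[where k = 0]]) (simp_all add: link_diagram_def)
  have 7: "plane_move ([(0, Cap), (0, Cap), (1, Cross False)] @ [(2, Cap), (1, Cup)] @ [(1, Cross False)] @ ?a 2 @ [(1, Cup), (0, Cup)])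
    ([(0, Cap), (0, Cap), (1, Cross False)] @ [] @ [(1, Cross False)] @ ?a 2 @ [(1, Cup), (0, Cup)])"
    by (rule plane_move_in_context(1)[OF isotopy_shifted(3)]) (simp_all add: link_diagram_def numeral_2_eq_2)
  show ?thesis
    unfolding pretzel_diagram_1_1 twist_knot_def four_plat_def
    using 1 2 3 4 5 6 7
    by (simp)
qed

lemma plane_move_four_plat:
  assumes "isotopy l r" "tangle 4 u 4" "tangle 4 l 4" "tangle 4 r 4" "tangle 4 v 4"
  shows "plane_move (four_plat (u @ l @ v)) (four_plat (u @ r @ v))"
    "plane_move (four_plat (u @ r @ v)) (four_plat (u @ l @ v))"
proof -
  have T: "link_diagram (four_plat (u @ x @ v))" if "tangle 4 x 4" for x
  proof -
    have "tangle 4 (u @ x @ v) 4" using assms that by (auto simp: tangle_append)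
    then have "tangle 4 ((u @ x @ v) @ [(1, Cup), (0, Cup)]) 0"
      unfolding tangle_append[of 4 "u @ x @ v"] by (intro exI[of _ 4]) simp
    then show ?thesis
      unfolding link_diagram_def four_plat_def tangle_append[of 0] by (intro exI[of _ 4]) simp
  qed
  show "plane_move (four_plat (u @ l @ v)) (four_plat (u @ r @ v))"
    "plane_move (four_plat (u @ r @ v)) (four_plat (u @ l @ v))"
    using plane_move_in_context[OF assms(1), of "[(0, Cap), (0, Cap)] @ u" "v @ [(1, Cup), (0, Cup)]"]
      T[OF assms(3)] T[OF assms(4)] by (simp_all add: four_plat_def)
qed

text \<open>Exchanging the two maxima puts the right one directly above the crossing, which is then
  a curl; another exchange restores the order.\<close>

lemma remove_first_right_crossing:
  assumes "tangle 4 w 4"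
  shows "plane_move\<^sup>*\<^sup>* (four_plat ((2, Cross s) # w)) (four_plat w)"
proof -
  let ?e = "w @ [(1, Cup), (0, Cup)]"
  have "tangle 4 ?e 0" unfolding tangle_append using assms by (intro exI[of _ 4]) simp
  then have T: "tangle 4 ?e 0" "tangle (Suc (Suc (Suc (Suc 0)))) ?e 0" by (simp_all add: eval_nat_numeral)
  have 1: "plane_move ([] @ [(0, Cap), (0, Cap)] @ [(2, Cross s)] @ ?e) ([] @ [(0, Cap), (2, Cap)] @ [(2, Cross s)] @ ?e)"
    by (rule plane_move_in_context(2)[OF isotopy_shifted(1)[where k = 0]]) (use T in \<open>simp_all add: link_diagram_def\<close>)
  have 2: "plane_move ([(0, Cap)] @ [(2, Cap), (2, Cross s)] @ ?e) ([(0, Cap)] @ [(2, Cap)] @ ?e)"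
    by (rule plane_move_in_context(1)[OF isotopy.r1_cap]) (use T in \<open>simp_all add: link_diagram_def\<close>)
  have 3: "plane_move ([] @ [(0, Cap), (2, Cap)] @ ?e) ([] @ [(0, Cap), (0, Cap)] @ ?e)"
    by (rule plane_move_in_context(1)[OF isotopy_shifted(1)[where k = 0]]) (use T in \<open>simp_all add: link_diagram_def\<close>)
  show ?thesis
    using 1 2 3
    by (simp add: four_plat_def)
qed

section \<open>The Delta-move between twist knots\<close>

context
begin

private abbreviation "a \<equiv> (2 :: nat, Cross True)"
private abbreviation "a' \<equiv> (2 :: nat, Cross False)"
private abbreviation "b \<equiv> (1 :: nat, Cross False)"
private abbreviation "b' \<equiv> (1 :: nat, Cross True)"

text \<open>The word is that of \<open>twist_knot (Suc r)\<close> with a cancelling pair inserted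
  after the first crossing of the twist. This creates the triple in the middle, whose over/under
  information is cyclic.\<close>

definition twist_before :: "nat \<Rightarrow> diagram" where
  "twist_before r = four_plat ([(1, Cross False)] @ [(1, Cross False), (2, Cross True), (1, Cross False)] @ (1, Cross True) # replicate r (2, Cross True))"

definition twist_after :: "nat \<Rightarrow> diagram" where
  "twist_after r = four_plat ([(1, Cross False)] @ [(2, Cross False), (1, Cross True), (2, Cross False)] @ (1, Cross True) # replicate r (2, Cross True))"

lemma twist_knot_before: "plane_move (twist_knot (Suc r)) (twist_before r)"
proof -
  have "plane_move (four_plat ([b, b, a] @ [] @ replicate r a)) (four_plat ([b, b, a] @ [b, b'] @ replicate r a))"
    by (rule plane_move_four_plat(2)[OF isotopy_shifted(6)]) simp_all
  then show ?thesis by (simp add: twist_knot_def twist_before_def)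
qed

text \<open>The braid words \<open>b A B A B\<close>, \<open>a b A A B\<close>, \<open>a b A B b A B\<close>, \<open>a a b A b A B\<close>, \<open>a a b A a b A\<close> and
  \<open>a a b b A\<close>, where capital letters are inverses; the initial letters \<open>a\<close> untwist at a maximum.\<close>

lemma twist_after_reduce:
  "plane_move\<^sup>*\<^sup>* (twist_after r) (four_plat ([(1, Cross False), (1, Cross False), (2, Cross False)] @ replicate r (2, Cross True)))"
proof -
  let ?r = "replicate r a"
  have 1: "plane_move (four_plat ([] @ [b, a', b'] @ [a', b'] @ ?r)) (four_plat ([] @ [a, b, a'] @ [a', b'] @ ?r))"
    by (rule plane_move_four_plat(1)[OF isotopy_shifted(7)]) simp_all
  have 2: "plane_move (four_plat ([a, b, a'] @ [] @ [a', b'] @ ?r)) (four_plat ([a, b, a'] @ [b', b] @ [a', b'] @ ?r))"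
    by (rule plane_move_four_plat(2)[OF isotopy_shifted(6)]) simp_all
  have 3: "plane_move (four_plat ([a] @ [b, a', b'] @ [b, a', b'] @ ?r)) (four_plat ([a] @ [a, b, a'] @ [b, a', b'] @ ?r))"
    by (rule plane_move_four_plat(1)[OF isotopy_shifted(7)]) simp_all
  have 4: "plane_move (four_plat ([a, a, b, a'] @ [b, a', b'] @ ?r)) (four_plat ([a, a, b, a'] @ [a, b, a'] @ ?r))"
    by (rule plane_move_four_plat(1)[OF isotopy_shifted(7), where v = ?r]) simp_all
  have 5: "plane_move (four_plat ([a, a, b] @ [a', a] @ [b, a'] @ ?r)) (four_plat ([a, a, b] @ [] @ [b, a'] @ ?r))"
    by (rule plane_move_four_plat(1)[OF isotopy_shifted(6)]) simp_all
  have 6: "plane_move\<^sup>*\<^sup>* (four_plat (a # ([a, b, b, a'] @ ?r))) (four_plat ([a, b, b, a'] @ ?r))"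
    by (rule remove_first_right_crossing) simp
  have 7: "plane_move\<^sup>*\<^sup>* (four_plat (a # ([b, b, a'] @ ?r))) (four_plat ([b, b, a'] @ ?r))"
    by (rule remove_first_right_crossing) simp
  show ?thesis
    using 1 2 3 4 5 6 7
    by (simp add: twist_after_def)
qed

text \<open>The inverse letter left by \<open>twist_after_reduce\<close> cancels one more
  half-twist, so a single Delta-move shortens the twist by two.\<close>

lemma twist_after_knot: "plane_move\<^sup>*\<^sup>* (twist_after (Suc r)) (twist_knot r)"
proof -
  have "plane_move (four_plat ([b, b] @ [a', a] @ replicate r a)) (four_plat ([b, b] @ [] @ replicate r a))"
    by (rule plane_move_four_plat(1)[OF isotopy_shifted(6)]) simp_all
  with twist_after_reduce[of "Suc r"] show ?thesis
    by (simp add: twist_knot_def)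
qed

text \<open>This is the triviality of \<open>P(1, 1, - 1)\<close>: the last letter of the reduced
  word slides over a minimum and cancels one crossing of the clasp, and the other becomes a
  curl.\<close>

lemma twist_after_circle: "plane_move\<^sup>*\<^sup>* (twist_after 0) circle"
proof -
  have 1: "plane_move ([(0, Cap), (0, Cap), b, b] @ [a', (1, Cup)] @ [(0, Cup)]) ([(0, Cap), (0, Cap), b, b] @ [b', (2, Cup)] @ [(0, Cup)])"
    by (rule plane_move_in_context(1)[OF isotopy_shifted(5)]) (simp_all add: link_diagram_def)
  have 2: "plane_move ([(0, Cap), (0, Cap), b] @ [b, b'] @ [(2, Cup), (0, Cup)]) ([(0, Cap), (0, Cap), b] @ [] @ [(2, Cup), (0, Cup)])"
    by (rule plane_move_in_context(1)[OF isotopy_shifted(6)]) (simp_all add: link_diagram_def)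
  have 3: "plane_move ([] @ [(0, Cap), (0, Cap)] @ [b, (2, Cup), (0, Cup)]) ([] @ [(0, Cap), (2, Cap)] @ [b, (2, Cup), (0, Cup)])"
    by (rule plane_move_in_context(2)[OF isotopy_shifted(1)[where k = 0]]) (simp_all add: link_diagram_def)
  have 4: "plane_move ([(0, Cap)] @ [(2, Cap), b] @ [(2, Cup), (0, Cup)]) ([(0, Cap)] @ [(1, Cap), a] @ [(2, Cup), (0, Cup)])"
    by (rule plane_move_in_context(2)[OF isotopy_shifted(4)]) (simp_all add: link_diagram_def)
  have 5: "plane_move ([(0, Cap), (1, Cap)] @ [a, (2, Cup)] @ [(0, Cup)]) ([(0, Cap), (1, Cap)] @ [(2, Cup)] @ [(0, Cup)])"
    by (rule plane_move_in_context(1)[OF isotopy.r1_cup]) (simp_all add: link_diagram_def)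
  have 6: "plane_move ([(0, Cap)] @ [(1, Cap), (2, Cup)] @ [(0, Cup)]) ([(0, Cap)] @ [] @ [(0, Cup)])"
    by (rule plane_move_in_context(1)[OF isotopy_shifted(2)]) (simp_all add: link_diagram_def)
  show ?thesis
    using twist_after_reduce[of 0] 1 2 3 4 5 6
    by (simp add: four_plat_def circle_def)
qed

lemma twist_delta: "delta [(1, Cross False), (2, Cross True), (1, Cross False)] [(2, Cross False), (1, Cross True), (2, Cross False)]"
  using delta.intros[of False False True 1] by (simp add: numeral_2_eq_2)

lemma twist_before_after:
  assumes "knot_diagram (twist_after r)"
  shows "knot_diagram (twist_before r)" "local_move delta (twist_before r) (twist_after r)"
proof -
  let ?u = "[(0, Cap), (0, Cap), b]" and ?v = "b' # replicate r a @ [(1, Cup), (0, Cup)]"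
  have eq: "twist_before r = ?u @ [b, a, b] @ ?v" "twist_after r = ?u @ [a', b', a'] @ ?v"
    by (simp_all add: twist_before_def twist_after_def four_plat_def)
  have link: "link_diagram (?u @ [b, a, b] @ ?v)" by (simp add: link_diagram_def)
  show K: "knot_diagram (twist_before r)"
    unfolding eq(1) by (rule knot_diagram_replace[OF _ assms[unfolded eq(2)] link]) (intro disjI2 twist_delta)
  show "local_move delta (twist_before r) (twist_after r)"
    unfolding local_move_def
    by (intro conjI K assms exI[of _ ?u] exI[of _ "[b, a, b]"] exI[of _ "[a', b', a']"] exI[of _ ?v] eq twist_delta)
qed

end

lemma twist_knot_adjacent:
  assumes "diagram_of (twist_after r) K"
  obtains K' where "diagram_of (twist_knot (Suc r)) K'" "delta_adjacent K' K"
proof -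
  have K: "knot_diagram (twist_after r)" using assms by (simp add: diagram_of_def)
  note D = twist_before_after[OF K]
  have "plane_move\<^sup>*\<^sup>* (twist_before r) (twist_knot (Suc r))"
    using twist_knot_before by (auto intro: plane_move_sym)
  then have i: "isotopic (twist_before r) (twist_knot (Suc r))"
    using D(1) by (rule plane_moves_isotopic)
  have B: "diagram_of (twist_before r) (abs_knot (twist_before r))"
    using D(1) by (simp add: diagram_of_def)
  show ?thesis
  proof (rule that)
    show "diagram_of (twist_knot (Suc r)) (abs_knot (twist_before r))"
      using isotopic_diagram_of[OF i B] .
    show "delta_adjacent (abs_knot (twist_before r)) K"
      unfolding delta_adjacent_def using B assms D(2) by (auto simp: symclp_def)
  qed
qed

lemma plane_moves_diagram_of:
  assumes "plane_move\<^sup>*\<^sup>* D D'" "diagram_of D' K"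
  shows "diagram_of D K"
proof -
  have "isotopic D' D"
    using plane_moves_isotopic[OF plane_moves_sym[OF assms(1)]] assms(2) by (simp add: diagram_of_def)
  then show ?thesis using assms(2) by (rule isotopic_diagram_of)
qed

lemma circle_trivial_knot: "diagram_of circle trivial_knot"
  by (simp add: diagram_of_def trivial_knot_def knot_diagram_circle)

text \<open>The induction starts at the circle and adds two half-twists per Delta-move. In this
  direction each diagram inherits from the previous one that it is a knot diagram, so this is never
  verified by tracing strands.\<close>

lemma twist_knot_unknotting:
  obtains K where "diagram_of (twist_knot (2 * k + 1)) K" "(delta_adjacent ^^ Suc k) K trivial_knot"
proof (induction k arbitrary: thesis)
  case 0
  have "diagram_of (twist_after 0) trivial_knot"
    using twist_after_circle circle_trivial_knot by (rule plane_moves_diagram_of)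
  then obtain K where "diagram_of (twist_knot (Suc 0)) K" "delta_adjacent K trivial_knot"
    by (rule twist_knot_adjacent)
  then show ?case using 0[of K] by (simp add: eq_OO)
next
  case (Suc k)
  obtain K where K: "diagram_of (twist_knot (2 * k + 1)) K" "(delta_adjacent ^^ Suc k) K trivial_knot"
    by (rule Suc.IH)
  have "diagram_of (twist_after (Suc (2 * k + 1))) K"
    using twist_after_knot K(1) by (rule plane_moves_diagram_of)
  then obtain K' where "diagram_of (twist_knot (Suc (Suc (2 * k + 1)))) K'" "delta_adjacent K' K"
    by (rule twist_knot_adjacent)
  moreover from this K(2) have "(delta_adjacent ^^ Suc (Suc k)) K' trivial_knot"
    using relpowp_Suc_I2 by metis
  ultimately show ?case by (intro Suc.prems) simp_all
qed

section \<open>Pretzel knots\<close>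

lemma pretzel_diagram_signed:
  assumes "\<And>p. p \<in> set ps \<Longrightarrow> 0 < p"
  shows "pretzel_diagram (map int ps) = signed_pretzel True ps"
proof -
  have "map (\<lambda>i. replicate (nat \<bar>map int ps ! i\<bar>) (2 * i, Cross (0 < map int ps ! i))) [0..<length ps] =
    map (\<lambda>i. replicate (ps ! i) (2 * i, Cross True)) [0..<length ps]"
    using assms by (intro map_cong) auto
  then have "concat (map (\<lambda>i. replicate (nat \<bar>map int ps ! i\<bar>) (2 * i, Cross (0 < map int ps ! i))) [0..<length ps]) =
    pretzel_columns True ps"
    unfolding pretzel_columns_def by (rule arg_cong)
  then show ?thesis
    by (simp add: pretzel_diagram_def signed_pretzel_def pretzel_caps_def pretzel_cups_def)
qed

lemma mirror_signed_pretzel: "mirror_diagram (signed_pretzel s ps) = signed_pretzel (\<not> s) ps"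
  by (simp add: mirror_diagram_def signed_pretzel_def pretzel_caps_def pretzel_cups_def pretzel_columns_def
      map_concat comp_def)

lemma crossings_pretzel_columns: "crossings (pretzel_columns s ps) = sum_list ps"
proof (induction ps rule: rev_induct)
  case (snoc p ps)
  have "crossings (replicate p (i, Cross s)) = p" for i by (induction p) simp_all
  then show ?case using snoc by (simp add: pretzel_columns_snoc)
qed simp

lemma crossings_signed_pretzel: "crossings (signed_pretzel s ps) = sum_list ps"
proof -
  have "crossings (pretzel_caps m) = 0" "crossings (pretzel_cups m) = 0" for m
    by (auto simp: pretzel_caps_def pretzel_cups_def crossings_def filter_empty_conv)
  then show ?thesis by (simp add: signed_pretzel_def crossings_pretzel_columns)
qed

lemma diagram_of_rep: obtains D where "diagram_of D K"
proof -
  have "isotopic (rep_knot K) (rep_knot K)" "abs_knot (rep_knot K) = K"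
    using Quotient3_rep_reflp[OF Quotient3_knot] Quotient3_abs_rep[OF Quotient3_knot] by auto
  then show ?thesis using that[of "rep_knot K"] by (simp add: diagram_of_def isotopic_def)
qed

lemma mirror_abs_knot: "knot_diagram D \<Longrightarrow> mirror (abs_knot D) = abs_knot (mirror_diagram D)"
  by (rule mirror.abs_eq) (simp add: isotopic_def)

lemma mirror_mirror: "mirror (mirror K) = K"
proof -
  obtain D where "diagram_of D K" by (rule diagram_of_rep)
  then show ?thesis by (auto simp: diagram_of_def mirror_abs_knot)
qed

lemma positive_odd_pretzel_signed:
  assumes "positive_odd_pretzel_knot K"
  obtains ps where "odd (length ps)" "\<forall>p\<in>set ps. odd p" "diagram_of (signed_pretzel True ps) K"
proof -
  obtain qs where qs: "odd (length qs)" "\<forall>p \<in> set qs. 0 < p \<and> odd p" "diagram_of (pretzel_diagram qs) K"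
    using assms unfolding positive_odd_pretzel_knot_def pretzel_knot_def by blast
  have id: "map int (map nat qs) = qs"
    unfolding map_map by (rule map_idI) (use qs(2) in force)
  have "\<forall>p\<in>set qs. odd (nat p) \<and> 0 < nat p"
  proof
    fix p assume "p \<in> set qs"
    with qs(2) have "0 < p" "odd p" by simp_all
    then show "odd (nat p) \<and> 0 < nat p" by (simp add: even_nat_iff)
  qed
  then have nat: "\<forall>p\<in>set (map nat qs). odd p" "\<And>p. p \<in> set (map nat qs) \<Longrightarrow> 0 < p"
    by auto
  have "diagram_of (signed_pretzel True (map nat qs)) K"
    using qs(3) pretzel_diagram_signed[OF nat(2)] id by metis
  then show ?thesis
    using that[of "map nat qs"] qs(1) nat(1) by simp
qed

lemma positive_odd_pretzel_knots_signed:
  assumes "K \<in> positive_odd_pretzel_knots n"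
  obtains s ps where "odd (length ps)" "\<forall>p\<in>set ps. odd p" "diagram_of (signed_pretzel s ps) K" "crossing_number K = n"
proof -
  consider "positive_odd_pretzel_knot K" | "positive_odd_pretzel_knot (mirror K)"
    using assms by (auto simp: positive_odd_pretzel_knots_def)
  then show ?thesis
  proof cases
    case 1
    then obtain ps where "odd (length ps)" "\<forall>p\<in>set ps. odd p" "diagram_of (signed_pretzel True ps) K"
      by (rule positive_odd_pretzel_signed)
    then show ?thesis using that assms by (auto simp: positive_odd_pretzel_knots_def)
  next
    case 2
    then obtain ps where ps: "odd (length ps)" "\<forall>p\<in>set ps. odd p" "diagram_of (signed_pretzel True ps) (mirror K)"
      by (rule positive_odd_pretzel_signed)
    then have "K = mirror (abs_knot (signed_pretzel True ps))" "knot_diagram (signed_pretzel True ps)"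
      by (simp_all add: diagram_of_def mirror_mirror)
    moreover from this have "knot_diagram (signed_pretzel False ps)"
      using knot_diagram_mirror_diagram[of "signed_pretzel True ps"] by (simp add: mirror_signed_pretzel)
    ultimately have "diagram_of (signed_pretzel False ps) K"
      by (simp add: diagram_of_def mirror_abs_knot mirror_signed_pretzel)
    then show ?thesis
      using that ps(1,2) assms by (auto simp: positive_odd_pretzel_knots_def)
  qed
qed

lemma crossing_number_pretzel:
  assumes "diagram_of (signed_pretzel s ps) K" "3 \<le> length ps" "\<forall>p\<in>set ps. odd p"
  shows "crossing_number K = sum_list ps"
  unfolding crossing_number_def
proof (rule Least_equality)
  show "\<exists>D. diagram_of D K \<and> crossings D = sum_list ps"
    using assms(1) crossings_signed_pretzel by blast
  fix c assume "\<exists>D. diagram_of D K \<and> crossings D = c"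
  then obtain D where "diagram_of D K" "crossings D = c" by blast
  then show "sum_list ps \<le> c"
    using crossings_isotopic_pretzel[OF _ assms(2) diagram_of_isotopic[OF assms(1)]] assms(3) by blast
qed

text \<open>The column unravels by curls. One column is the case in which the crossing number is not
  the sum of the entries.\<close>

lemma crossing_number_single_column:
  assumes "diagram_of (signed_pretzel s [p]) K"
  shows "crossing_number K = 0"
proof -
  have D: "signed_pretzel s [p] = (0, Cap) # replicate p (0, Cross s) @ [(0, Cup)]" for p
    using pretzel_columns_snoc[of s "[]" p] by (simp add: signed_pretzel_def)
  have "plane_move\<^sup>*\<^sup>* (signed_pretzel s [p]) circle"
  proof (induction p)
    case 0
    show ?case by (simp add: D circle_def)
  next
    case (Suc p)
    have "plane_move ([] @ [(0, Cap), (0, Cross s)] @ replicate p (0, Cross s) @ [(0, Cup)])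
      ([] @ [(0, Cap)] @ replicate p (0, Cross s) @ [(0, Cup)])"
      by (rule plane_move_in_context(1)[OF isotopy.r1_cap]) (simp_all add: link_diagram_def)
    then show ?case using Suc by (simp add: D)
  qed
  then have "isotopic (signed_pretzel s [p]) circle"
    using assms by (intro plane_moves_isotopic) (simp_all add: diagram_of_def)
  then have "diagram_of circle K" using assms by (rule isotopic_diagram_of)
  moreover have "crossings circle = 0" by (simp add: circle_def)
  ultimately show ?thesis unfolding crossing_number_def by (intro Least_eq_0) blast
qed

section \<open>The lower bound from the second Conway coefficient\<close>

lemma conway_invariant_delta_path:
  assumes "(delta_adjacent ^^ k) K K'" "diagram_of D K" "diagram_of D' K'"
  shows "\<bar>conway_invariant D - conway_invariant D'\<bar> \<le> 96 * real k"
  using assms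
proof (induction k arbitrary: K D)
  case 0
  then have "isotopic D D'" by (auto intro: diagram_of_isotopic)
  then show ?case by (simp add: conway_invariant_isotopic)
next
  case (Suc k)
  obtain L where L: "delta_adjacent K L" "(delta_adjacent ^^ k) L K'"
    using relpowp_Suc_D2[OF Suc.prems(1)] by blast
  then obtain E E' where E: "diagram_of E K" "diagram_of E' L" "symclp (local_move delta) E E'"
    unfolding delta_adjacent_def by blast
  have "\<bar>conway_invariant E - conway_invariant E'\<bar> \<le> 96"
    using E(3) conway_invariant_delta unfolding symclp_def by (metis abs_minus_commute)
  moreover have "conway_invariant D = conway_invariant E"
    using diagram_of_isotopic[OF Suc.prems(2) E(1)] by (rule conway_invariant_isotopic)
  moreover have "\<bar>conway_invariant E' - conway_invariant D'\<bar> \<le> 96 * real k"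
    using L(2) E(2) Suc.prems(3) by (rule Suc.IH)
  ultimately show ?case by (simp add: algebra_simps)
qed

text \<open>Twice the second elementary symmetric function of numbers \<open>\<ge> 1\<close> exceeds its linearization
  at \<open>(1, \<dots>, 1)\<close>.\<close>

lemma pair_sum_bound:
  assumes "\<And>x. x \<in> set xs \<Longrightarrow> 1 \<le> (x :: real)"
  shows "real (length xs) * (real (length xs) - 1) + 2 * (real (length xs) - 1) * (sum_list xs - real (length xs))
    \<le> (sum_list xs)\<^sup>2 - (\<Sum>x\<leftarrow>xs. x\<^sup>2) \<and> real (length xs) \<le> sum_list xs"
  using assms
proof (induction xs)
  case (Cons x xs)
  then have x: "1 \<le> x" and IH: "real (length xs) * (real (length xs) - 1) + 2 * (real (length xs) - 1) * (sum_list xs - real (length xs))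
    \<le> (sum_list xs)\<^sup>2 - (\<Sum>x\<leftarrow>xs. x\<^sup>2)" "real (length xs) \<le> sum_list xs"
    by simp_all
  have "0 \<le> (x - 1) * (sum_list xs - real (length xs))"
    using x IH(2) by simp
  then show ?case using x IH by (simp add: algebra_simps power2_eq_square)
qed simp

text \<open>With \<open>m\<close> columns, \<open>k\<close> moves to the trivial knot give
  \<open>n\<^sup>2 - n2 + m - 1 \<le> 8 * k\<close>. By \<open>pair_sum_bound\<close> the left side
  is at least \<open>4 * n - 4\<close> for \<open>m = 3\<close>, and this estimate only improves
  with more columns.\<close>

lemma delta_unknotting_lower_bound:
  assumes K: "diagram_of (signed_pretzel s ps) K" and m: "3 \<le> length ps" "odd (length ps)"
    and odd: "\<forall>p\<in>set ps. odd p"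
  shows "enat ((sum_list ps - 1) div 2) \<le> delta_unknotting_number K"
  unfolding delta_unknotting_number_def delta_distance_def
proof (rule Inf_greatest)
  fix x assume "x \<in> {enat k |k. (delta_adjacent ^^ k) K trivial_knot}"
  then obtain k where x: "x = enat k" and k: "(delta_adjacent ^^ k) K trivial_knot" by blast
  define n n2 where "n = (\<Sum>p\<leftarrow>ps. real p)" and "n2 = (\<Sum>p\<leftarrow>ps. (real p)\<^sup>2)"
  have "\<bar>conway_invariant (signed_pretzel s ps) - conway_invariant circle\<bar> \<le> 96 * real k"
    by (rule conway_invariant_delta_path[OF k K circle_trivial_knot])
  then have upper: "n\<^sup>2 - n2 + real (length ps) - 1 \<le> 8 * real k"
    using conway_invariant_pretzel[of ps s] odd m(2) by (simp add: conway_invariant_circle n_def n2_def)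
  have "1 \<le> real p" if "p \<in> set ps" for p
    using odd that by (cases p) auto
  then have "1 \<le> x" if "x \<in> set (map real ps)" for x using that by auto
  then have lower: "real (length ps) * (real (length ps) - 1) + 2 * (real (length ps) - 1) * (n - real (length ps)) \<le> n\<^sup>2 - n2"
    "real (length ps) \<le> n"
    using pair_sum_bound[of "map real ps"] by (auto simp: n_def n2_def comp_def)
  \<comment> \<open>With \<open>m\<close> columns this is the excess of the linear bound plus
    \<open>m - 1\<close> over \<open>4 * n - 4\<close>, written as a sum of products that are
    nonnegative from three columns on.\<close>
  have "0 \<le> (real (length ps) - 3) * (real (length ps) - 1) + 2 * (real (length ps) - 3) * (n - real (length ps))"
    using m(1) lower(2) by (intro add_nonneg_nonneg mult_nonneg_nonneg) auto
  with lower(1) have "4 * n - 4 \<le> n\<^sup>2 - n2 + real (length ps) - 1"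
    by (simp add: algebra_simps)
  with upper have "n - 1 \<le> 2 * real k" by simp
  moreover have "n = real (sum_list ps)" unfolding n_def by (induction ps) simp_all
  ultimately show "enat ((sum_list ps - 1) div 2) \<le> x" unfolding x by simp
qed

theorem theorem1p7:
  fixes n :: nat
  assumes "odd n"
    and "positive_odd_pretzel_knots n \<noteq> {}"
  shows "\<exists>K. pretzel_knot [1, 1, int n - 2] K \<and>
           is_arg_min delta_unknotting_number (\<lambda>L. L \<in> positive_odd_pretzel_knots n) K \<and>
           delta_unknotting_number K = enat ((n - 1) div 2)"
proof -
  have signed: "\<exists>s ps. diagram_of (signed_pretzel s ps) L \<and> 3 \<le> length ps \<and> odd (length ps) \<and>
      (\<forall>p\<in>set ps. odd p) \<and> sum_list ps = n" if L: "L \<in> positive_odd_pretzel_knots n" for L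
  proof -
    obtain s ps where ps: "odd (length ps)" "\<forall>p\<in>set ps. odd p" "diagram_of (signed_pretzel s ps) L" "crossing_number L = n"
      using L by (rule positive_odd_pretzel_knots_signed)
    \<comment> \<open>One column would give the trivial knot, whose crossing number \<open>0\<close>
      is not odd.\<close>
    have "length ps \<noteq> 1"
    proof
      assume "length ps = 1"
      then obtain p where "ps = [p]" by (auto simp: length_Suc_conv)
      then show False using crossing_number_single_column ps(3,4) assms(1) by fastforce
    qed
    then have "3 \<le> length ps" using ps(1) by (auto elim: oddE)
    then show ?thesis using ps crossing_number_pretzel[OF ps(3) _ ps(2)] by auto
  qed
  have lower: "enat ((n - 1) div 2) \<le> delta_unknotting_number L" if "L \<in> positive_odd_pretzel_knots n" for L
    using signed[OF that] delta_unknotting_lower_bound by blast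
  obtain ps :: "nat list" where ps: "3 \<le> length ps" "\<forall>p\<in>set ps. odd p" "sum_list ps = n"
    using assms(2) signed by blast
  have "length qs \<le> sum_list qs" if "\<forall>p\<in>set qs. odd p" for qs :: "nat list"
    using that
  proof (induction qs)
    case (Cons q qs)
    then have "0 < q" "length qs \<le> sum_list qs" by (auto intro: odd_pos)
    then show ?case by simp
  qed simp
  from this[OF ps(2)]
  have "3 \<le> n" using ps by linarith
  obtain j where "n = 2 * j + 1" using assms(1) by (rule oddE)
  \<comment> \<open>With \<open>n = 2 * k + 3\<close> the last column has \<open>2 * k + 1\<close>
    crossings, and \<open>(n - 1) div 2\<close> is \<open>Suc k\<close>, the number of moves that
    unknot it.\<close>
  with \<open>3 \<le> n\<close> obtain k where k: "n = 2 * k + 3" by (intro that[of "j - 1"]) simp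
  have pq: "[1, 1, int n - 2] = [1, 1, int (2 * k + 1)]" by (simp add: k)
  obtain K where K: "diagram_of (twist_knot (2 * k + 1)) K" "(delta_adjacent ^^ Suc k) K trivial_knot"
    by (rule twist_knot_unknotting)
  have P: "diagram_of (pretzel_diagram [1, 1, int n - 2]) K"
    unfolding pq using pretzel_twist_knot K(1) by (rule plane_moves_diagram_of)
  have sp: "pretzel_diagram [1, 1, int n - 2] = signed_pretzel True [1, 1, 2 * k + 1]"
  proof -
    have "map int [1, 1, 2 * k + 1] = [1, 1, int n - 2]" by (simp add: k)
    moreover have "0 < p" if "p \<in> set [1, 1, 2 * k + 1]" for p using that by auto
    ultimately show ?thesis using pretzel_diagram_signed[of "[1, 1, 2 * k + 1]"] by metis
  qed
  have "crossing_number K = n"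
    using crossing_number_pretzel[OF P[unfolded sp]] by (auto simp: k)
  moreover have "positive_odd_pretzel_knot K"
    unfolding positive_odd_pretzel_knot_def pretzel_knot_def
    using P by (intro exI[of _ "[1, 1, int n - 2]"]) (auto simp: k)
  ultimately have mem: "K \<in> positive_odd_pretzel_knots n"
    by (simp add: positive_odd_pretzel_knots_def)
  have "delta_unknotting_number K \<le> enat (Suc k)"
    unfolding delta_unknotting_number_def delta_distance_def using K(2) by (intro Inf_lower) blast
  then have min_value: "delta_unknotting_number K = enat ((n - 1) div 2)"
    using lower[OF mem] by (intro antisym) (simp_all add: k)
  then have "is_arg_min delta_unknotting_number (\<lambda>L. L \<in> positive_odd_pretzel_knots n) K"
    unfolding is_arg_min_def using mem lower by (auto simp: not_less)
  with P min_value show ?thesis unfolding pretzel_knot_def by blast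
qed

end
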